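(* Let $A$ be a nonunital $C^*$-algebra with an admissible quasitracial projection scale $(\mathcal T,\{p_n\},\rho,\mathcal T_{\mathrm{inf}},(\mathcal T_{\mathrm{fin}},e,\varepsilon_0))$, and let $q_n=p_n-p_{n-1}$. Let $\Theta:\mathbb N\to\mathbb N$ be strictly increasing with $\Theta(n)>n$ for all $n$, let $N\ge0$, let $(\alpha_n)$ be a decreasing sequence of positive numbers tending to $0$, and suppose that $a=\sum_{n=N+1}^\infty\alpha_nq_n$ is a $(\Theta,N)$-regular tail, i.e. there is a constant $L_{\Theta,N}>0$ with $$\sup_{n\ge N+1}\frac{\alpha_n}{\alpha_{\Theta(n)}}\le L_{\Theta,N}.$$ Let $b\in A_+$ and $C>0$. Assume: (i) if $\mathcal T_{\mathrm{inf}}\ne\varnothing$, then $\tau(p_{\Theta(n)})\ge2\tau(p_n)+\rho$ for all $n\geq 1$ and all $\tau\in\mathcal T_{\mathrm{inf}}$, and $$\nu^\tau_s(a)\le C\,\nu^\tau_s(b)\qquad(s>0,\ \tau\in\mathcal T_{\mathrm{inf}});$$ (ii) if $\mathcal T_{\mathrm{fin}}\ne\varnothing$, then $\frac{\alpha_{N+1}}{2C}<\varepsilon_0$ and $$\sup_{j\ge1}\tau(p_j)-\tau(p_N)+\rho<d_\tau((b-\varepsilon_0)_+)\qquad(\tau\in\mathcal T_{\mathrm{fin}}).$$ Then there exists $x\in A$ such that $$x^*x=a^2,\qquad xx^*\le4C^2L_{\Theta,N}^2\|b\|\,b.$$ Moreover, if $J$ is a semiprime ideal of $A$ and $b\in J_+$,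 then $a\in J$.
   Context: Ideals are complex-linear two-sided ideals, not assumed norm closed. An ideal $J$ of $A$ is semiprime if for every ideal $I$ of $A$, $\{xy:x,y\in I\}\subseteq J$ implies $I\subseteq J$; $J_+=J\cap A_+$. $\operatorname{Ped}(A)$ is the Pedersen ideal, the smallest norm-dense ideal of $A$. For positive $a,b$, $a\precsim b$ (Cuntz subequivalence) means there are $r_n$ in the algebra with $r_n^*br_n\to a$ in norm. $(x-t)_+$ denotes functional calculus with $s\mapsto\max\{s-t,0\}$. A lower semicontinuous $2$-quasitrace on $A$ is a norm-lower semicontinuous map $\tau:A_+\to[0,\infty]$ with $\tau(0)=0$, $\tau(\lambda a)=\lambda\tau(a)$ for $\lambda>0$, $\tau(a+b)=\tau(a)+\tau(b)$ whenever $ab=ba$, $\tau(x^*x)=\tau(xx^* )$ for $x\in A$, and which extends to a map with the same properties on $M_2(A)_+$; it extends canonically to $(A\otimes\mathcal K)_+$. Put $d_\tau(a)=\lim_n\tau(a^{1/n})\in[0,\infty]$. $\tau$ is faithful if $\tau(a)=0$ implies $a=0$ for $a\in A_+$, and densely finite if $d_\tau(a)<\infty$ for every $a\in\operatorname{Ped}(A)_+$. For $x\in A$ and $s>0$, $$\nu_s^\tau(x)=\inf\{t\ge0:d_\tau((|x|-t)_+)\le s\}.$$ Admissible quasitracial projection scale. $(p_n)_{n\ge1}$ is an increasing approximate unit of $A$ consisting of projections, $p_0=0$, $q_n=p_n-p_{n-1}\ne0$ for all $n\ge1$. $\mathcal T$ is a nonempty family of faithful, densely finite, lower semicontinuous $2$-quasitraces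 on $A$, each normalized by $d_\tau(p_1)=1$; $\mathcal T_{\mathrm{fin}}=\{\tau\in\mathcal T:\sup_n\tau(p_n)<\infty\}$, $\mathcal T_{\mathrm{inf}}=\{\tau\in\mathcal T:\sup_n\tau(p_n)=\infty\}$; $\rho\ge0$, $\varepsilon_0>0$, $e\in\operatorname{Ped}(A)_+$. The tuple is an admissible quasitracial projection scale if: (1) for every $n\ge1$ and $c\in A_+$: if $d_\tau(q_n)+\rho<d_\tau(c)$ for all $\tau\in\mathcal T$, then $q_n\precsim c$; (2) if $\mathcal T_{\mathrm{inf}}\ne\varnothing$, then $\sup_{\tau\in\mathcal T_{\mathrm{inf}}}\tau(p_n)<\infty$ for every $n$ and $\lim_n\inf_{\tau\in\mathcal T_{\mathrm{inf}}}\tau(p_n)=\infty$; (3) if $\mathcal T_{\mathrm{fin}}\ne\varnothing$, then $\inf_{\tau\in\mathcal T_{\mathrm{fin}}}d_\tau((e-\varepsilon_0)_+)>\rho$ and $\sup_{\tau\in\mathcal T_{\mathrm{fin}}}\bigl(\sup_{j\ge1}\tau(p_j)-\tau(p_n)\bigr)\to0$ as $n\to\infty$. Conditions (2), (3) are regarded as satisfied when the corresponding subfamily is empty. *)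

theory Defs
  imports "HOL-Analysis.Analysis" "HOL-Computational_Algebra.Polynomial"
begin

class cstar_algebra = real_normed_algebra + banach +
  fixes scaleC :: "complex \<Rightarrow> 'a \<Rightarrow> 'a" (infixr "*\<^sub>C" 75)
    and star :: "'a \<Rightarrow> 'a"
  assumes scaleC_add_right: "c *\<^sub>C (x + y) = c *\<^sub>C x + c *\<^sub>C y"
    and scaleC_add_left: "(c + d) *\<^sub>C x = c *\<^sub>C x + d *\<^sub>C x"
    and scaleC_scaleC: "c *\<^sub>C (d *\<^sub>C x) = (c * d) *\<^sub>C x"
    and scaleR_scaleC: "r *\<^sub>R x = complex_of_real r *\<^sub>C x"
    and mult_scaleC_left: "(c *\<^sub>C x) * y = c *\<^sub>C (x * y)"
    and mult_scaleC_right: "x * (c *\<^sub>C y) = c *\<^sub>C (x * y)"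
    and norm_scaleC: "norm (c *\<^sub>C x) = cmod c * norm x"
    and star_star: "star (star x) = x"
    and star_add: "star (x + y) = star x + star y"
    and star_scaleC: "star (c *\<^sub>C x) = cnj c *\<^sub>C star x"
    and star_mult: "star (x * y) = star y * star x"
    and cstar_identity: "norm (star x * x) = (norm x)\<^sup>2"

definition nonunital :: "'a::cstar_algebra itself \<Rightarrow> bool" where
  "nonunital _ \<longleftrightarrow> \<not> (\<exists>u::'a. \<forall>x. u * x = x \<and> x * u = x)"

text \<open>The cone of elements \<open>y\<^sup>* y\<close> for an explicitly given product and involution, so that it
  can be used for \<open>A\<close> and for the matrix algebra \<open>M\<^sub>2(A)\<close> alike.\<close>

definition positive_cone :: "('m \<Rightarrow> 'm \<Rightarrow> 'm) \<Rightarrow> ('m \<Rightarrow> 'm) \<Rightarrow> 'm set" where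
  "positive_cone mul adj = {mul (adj y) y | y. True}"

definition Pos :: "'a::cstar_algebra set" where
  "Pos = positive_cone (*) star"

definition cstar_le :: "'a::cstar_algebra \<Rightarrow> 'a \<Rightarrow> bool" (infix "\<preceq>" 50) where
  "x \<preceq> y \<longleftrightarrow> y - x \<in> Pos"

definition is_projection :: "'a::cstar_algebra \<Rightarrow> bool" where
  "is_projection p \<longleftrightarrow> star p = p \<and> p * p = p"

text \<open>The value at \<open>a\<close> of a real polynomial, its constant coefficient being ignored because
  \<open>A\<close> need not have a unit. Note that \<open>((*) a ^^ i) a\<close> is the power of \<open>a\<close> with exponent
  \<open>i + 1\<close>.\<close>

definition poly_at :: "real poly \<Rightarrow> 'a::cstar_algebra \<Rightarrow> 'a" where
  "poly_at P a = (\<Sum>i<degree P. coeff P (Suc i) *\<^sub>R ((*) a ^^ i) a)"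

text \<open>For self-adjoint \<open>a\<close> and continuous \<open>f\<close> with \<open>f 0 = 0\<close>, the element \<open>f(a)\<close> is the norm
  limit of \<open>P\<^sub>k(a)\<close>, where \<open>P\<^sub>k\<close> are polynomials without constant term converging to \<open>f\<close>
  uniformly on the interval from \<open>-\<parallel>a\<parallel>\<close> to \<open>\<parallel>a\<parallel>\<close>, which contains the spectrum of \<open>a\<close>.
  Such polynomials exist by Weierstrass, and the limit does not depend on the choice.\<close>

definition cfc :: "(real \<Rightarrow> real) \<Rightarrow> 'a::cstar_algebra \<Rightarrow> 'a" where
  "cfc f a = (THE y. \<exists>P :: nat \<Rightarrow> real poly.
     (\<forall>k. coeff (P k) 0 = 0) \<and>
     uniform_limit {- norm a .. norm a} (\<lambda>k. poly (P k)) f sequentially \<and>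
     (\<lambda>k. poly_at (P k) a) \<longlonglongrightarrow> y)"

definition pos_cut :: "'a::cstar_algebra \<Rightarrow> real \<Rightarrow> 'a" where
  "pos_cut a t = cfc (\<lambda>s. max (s - t) 0) a"

definition cstar_abs :: "'a::cstar_algebra \<Rightarrow> 'a" where
  "cstar_abs x = cfc sqrt (star x * x)"

definition cstar_ideal :: "'a::cstar_algebra set \<Rightarrow> bool" where
  "cstar_ideal I \<longleftrightarrow> 0 \<in> I \<and> (\<forall>x\<in>I. \<forall>y\<in>I. x + y \<in> I) \<and> (\<forall>c. \<forall>x\<in>I. c *\<^sub>C x \<in> I) \<and>
     (\<forall>x\<in>I. \<forall>y. x * y \<in> I \<and> y * x \<in> I)"

definition semiprime_ideal :: "'a::cstar_algebra set \<Rightarrow> bool" where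
  "semiprime_ideal J \<longleftrightarrow> cstar_ideal J \<and>
     (\<forall>I. cstar_ideal I \<longrightarrow> {x * y | x y. x \<in> I \<and> y \<in> I} \<subseteq> J \<longrightarrow> I \<subseteq> J)"

text \<open>The smallest norm-dense ideal. That the intersection is itself dense is Pedersen's
  theorem.\<close>

definition Ped :: "'a::cstar_algebra set" where
  "Ped = \<Inter>{I. cstar_ideal I \<and> closure I = UNIV}"

definition cuntz_le :: "'a::cstar_algebra \<Rightarrow> 'a \<Rightarrow> bool" where
  "cuntz_le a b \<longleftrightarrow> (\<exists>r :: nat \<Rightarrow> 'a. (\<lambda>n. star (r n) * b * r n) \<longlonglongrightarrow> a)"

definition lsc_quasitrace_on ::
    "('m::real_normed_vector \<Rightarrow> 'm \<Rightarrow> 'm) \<Rightarrow> ('m \<Rightarrow> 'm) \<Rightarrow> ('m \<Rightarrow> ennreal) \<Rightarrow> bool" where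
  "lsc_quasitrace_on mul adj \<tau> \<longleftrightarrow>
     (\<forall>a \<in> positive_cone mul adj. \<forall>t. t < \<tau> a \<longrightarrow>
        (\<forall>\<^sub>F x in at a within positive_cone mul adj. t < \<tau> x)) \<and>
     \<tau> 0 = 0 \<and>
     (\<forall>c>0. \<forall>a \<in> positive_cone mul adj. \<tau> (c *\<^sub>R a) = ennreal c * \<tau> a) \<and>
     (\<forall>a \<in> positive_cone mul adj. \<forall>b \<in> positive_cone mul adj.
        mul a b = mul b a \<longrightarrow> \<tau> (a + b) = \<tau> a + \<tau> b) \<and>
     (\<forall>x. \<tau> (mul (adj x) x) = \<tau> (mul x (adj x)))"

definition mat2_mult :: "'a::cstar_algebra^2^2 \<Rightarrow> 'a^2^2 \<Rightarrow> 'a^2^2" where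
  "mat2_mult X Y = (\<chi> i j. \<Sum>k\<in>UNIV. X $ i $ k * Y $ k $ j)"

definition mat2_star :: "'a::cstar_algebra^2^2 \<Rightarrow> 'a^2^2" where
  "mat2_star X = (\<chi> i j. star (X $ j $ i))"

definition mat2_corner :: "'a::cstar_algebra \<Rightarrow> 'a^2^2" where
  "mat2_corner a = (\<chi> i j. if i = 1 \<and> j = 1 then a else 0)"

text \<open>Only the values on \<open>Pos\<close> matter. The library norm on \<open>'a^2^2\<close> is not the C*-norm of
  \<open>M\<^sub>2(A)\<close> but is equivalent to it, so lower semicontinuity of the extension has its
  usual meaning.\<close>

definition lsc_2_quasitrace :: "('a::cstar_algebra \<Rightarrow> ennreal) \<Rightarrow> bool" where
  "lsc_2_quasitrace \<tau> \<longleftrightarrow> lsc_quasitrace_on (*) star \<tau> \<and>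
     (\<exists>\<tau>2. lsc_quasitrace_on mat2_mult mat2_star \<tau>2 \<and> (\<forall>a\<in>Pos. \<tau>2 (mat2_corner a) = \<tau> a))"

text \<open>Here \<open>root n\<close> extends the n-th root to negative reals as an odd function; on positive
  elements this is irrelevant.\<close>

definition dim_fun :: "('a::cstar_algebra \<Rightarrow> ennreal) \<Rightarrow> 'a \<Rightarrow> ennreal" where
  "dim_fun \<tau> a = lim (\<lambda>n. \<tau> (cfc (root n) a))"

definition faithful :: "('a::cstar_algebra \<Rightarrow> ennreal) \<Rightarrow> bool" where
  "faithful \<tau> \<longleftrightarrow> (\<forall>a\<in>Pos. \<tau> a = 0 \<longrightarrow> a = 0)"

definition densely_finite :: "('a::cstar_algebra \<Rightarrow> ennreal) \<Rightarrow> bool" where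
  "densely_finite \<tau> \<longleftrightarrow> (\<forall>a \<in> Ped \<inter> Pos. dim_fun \<tau> a < \<infinity>)"

definition sing_val :: "('a::cstar_algebra \<Rightarrow> ennreal) \<Rightarrow> real \<Rightarrow> 'a \<Rightarrow> real" where
  "sing_val \<tau> s x = Inf {t. 0 \<le> t \<and> dim_fun \<tau> (pos_cut (cstar_abs x) t) \<le> ennreal s}"

definition projection_approx_unit :: "(nat \<Rightarrow> 'a::cstar_algebra) \<Rightarrow> bool" where
  "projection_approx_unit p \<longleftrightarrow>
     (\<forall>n\<ge>1. is_projection (p n)) \<and> (\<forall>n\<ge>1. p n \<preceq> p (Suc n)) \<and>
     (\<forall>x. (\<lambda>n. p n * x) \<longlonglongrightarrow> x \<and> (\<lambda>n. x * p n) \<longlonglongrightarrow> x)"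

definition scale_diff :: "(nat \<Rightarrow> 'a::cstar_algebra) \<Rightarrow> nat \<Rightarrow> 'a" where
  "scale_diff p n = p n - p (n - 1)"

definition T_fin :: "('a::cstar_algebra \<Rightarrow> ennreal) set \<Rightarrow> (nat \<Rightarrow> 'a) \<Rightarrow> ('a \<Rightarrow> ennreal) set" where
  "T_fin T p = {\<tau>\<in>T. (SUP n\<in>{1..}. \<tau> (p n)) < \<infinity>}"

definition T_inf :: "('a::cstar_algebra \<Rightarrow> ennreal) set \<Rightarrow> (nat \<Rightarrow> 'a) \<Rightarrow> ('a \<Rightarrow> ennreal) set" where
  "T_inf T p = {\<tau>\<in>T. (SUP n\<in>{1..}. \<tau> (p n)) = \<infinity>}"

definition admissible_scale ::
    "('a::cstar_algebra \<Rightarrow> ennreal) set \<Rightarrow> (nat \<Rightarrow> 'a) \<Rightarrow> real \<Rightarrow> 'a \<Rightarrow> real \<Rightarrow> bool" where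
  "admissible_scale T p \<rho> e \<epsilon>\<^sub>0 \<longleftrightarrow>
     projection_approx_unit p \<and> p 0 = 0 \<and> (\<forall>n\<ge>1. scale_diff p n \<noteq> 0) \<and>
     T \<noteq> {} \<and>
     (\<forall>\<tau>\<in>T. lsc_2_quasitrace \<tau> \<and> faithful \<tau> \<and> densely_finite \<tau> \<and> dim_fun \<tau> (p 1) = 1) \<and>
     0 \<le> \<rho> \<and> 0 < \<epsilon>\<^sub>0 \<and> e \<in> Ped \<inter> Pos \<and>
     (\<forall>n\<ge>1. \<forall>c\<in>Pos.
        (\<forall>\<tau>\<in>T. dim_fun \<tau> (scale_diff p n) + ennreal \<rho> < dim_fun \<tau> c) \<longrightarrow>
        cuntz_le (scale_diff p n) c) \<and>
     (T_inf T p \<noteq> {} \<longrightarrow>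
        (\<forall>n\<ge>1. (SUP \<tau>\<in>T_inf T p. \<tau> (p n)) < \<infinity>) \<and>
        (\<lambda>n. INF \<tau>\<in>T_inf T p. \<tau> (p n)) \<longlonglongrightarrow> \<infinity>) \<and>
     (T_fin T p \<noteq> {} \<longrightarrow>
        ennreal \<rho> < (INF \<tau>\<in>T_fin T p. dim_fun \<tau> (pos_cut e \<epsilon>\<^sub>0)) \<and>
        (\<lambda>n. SUP \<tau>\<in>T_fin T p. (SUP j\<in>{1..}. \<tau> (p j)) - \<tau> (p n)) \<longlonglongrightarrow> 0)"

definition regular_tail_bound :: "(nat \<Rightarrow> nat) \<Rightarrow> nat \<Rightarrow> (nat \<Rightarrow> real) \<Rightarrow> real \<Rightarrow> bool" where
  "regular_tail_bound \<Theta> N \<alpha> L \<longleftrightarrow> 0 < L \<and> (\<forall>n\<ge>N + 1. \<alpha> n / \<alpha> (\<Theta> n) \<le> L)"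

end

theory Submission
  imports Defs
begin

text \<open>Let \<open>r\<^sub>n = \<alpha>\<^bsub>\<Theta>(n)\<^esub> / (2 C)\<close> and let \<open>t\<^sub>n\<close> be slightly larger. The hypotheses give
  \<open>\<tau>(p\<^sub>n) - \<tau>(p\<^sub>N) + \<rho> < d\<^sub>\<tau>((b - t\<^sub>n)\<^sub>+)\<close> for all \<open>\<tau>\<close>, so after compressing \<open>(b - t\<^sub>n)\<^sub>+\<close> to the
  complement of the range projections found so far, which costs at most \<open>\<tau>(p\<^sub>n\<^sub>-\<^sub>1) - \<tau>(p\<^sub>N)\<close>, there is
  still room for \<open>q\<^sub>n\<close>. This yields partial isometries \<open>v\<^sub>n\<close> with \<open>v\<^sub>n\<^sup>* v\<^sub>n = q\<^sub>n\<close> and orthogonal ranges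
  inside the spectral subspace \<open>b > r\<^sub>n\<close>. For \<open>k > 0\<close> the element \<open>x = \<Sum> \<alpha>\<^sub>n\<^sup>k\<^sup>/\<^sup>2 v\<^sub>n\<close> satisfies
  \<open>x\<^sup>* x = a\<^sup>k\<close>, and \<open>x x\<^sup>* \<le> (2 C L b)\<^sup>k\<close> because \<open>\<alpha>\<^sub>n \<le> 2 C L r\<^sub>n\<close>. The case \<open>k = 2\<close> is the
  first claim, since \<open>b\<^sup>2 \<le> \<parallel>b\<parallel> b\<close>.

  For a semiprime ideal \<open>J\<close>, the principle that \<open>x x\<^sup>* \<le> K c\<^sup>k\<close> with \<open>k > 1\<close> makes \<open>x\<close> a right multiple
  of \<open>c\<^sup>1\<^sup>/\<^sup>2\<close>, and hence \<open>x\<^sup>* x\<close> a member of the ideal generated by \<open>c\<close>, is used twice with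
  \<open>k = 2\<^sup>1\<^sup>/\<^sup>2\<close>: from \<open>c = b\<close> to \<open>a\<^sup>k\<close>, and from \<open>c = a\<^sup>k\<close> to \<open>a y a\<close> for positive \<open>y\<close>. So
  \<open>a A a \<subseteq> J\<close>, and semiprimeness gives \<open>a \<in> J\<close>.

  The functional calculus rests on \<open>\<parallel>P(a)\<parallel> \<le> sup \<bar>P\<bar>\<close> for self-adjoint \<open>a\<close>, which is first shown
  with an extra factor linear in the degree of \<open>P\<close>; applying this to powers of \<open>P\<close> removes the
  factor.\<close>

section \<open>The involution\<close>

text \<open>A has no unit, and \<open>cfc\<close> is only a limit of polynomials. Polynomials
  therefore act on A by left multiplication, where constant terms make sense, and spectral
  statements become norm bounds such as
  \<open>norm (r *\<^sub>R x - h * x) \<le> r * norm x\<close>, which pass to sums and limits.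

  A quasitrace is additive on commuting elements only. What the construction needs is that cutting x
  by 1 - f, for a projection f, lowers d_\<tau> by at most \<tau>(f). This is proved in M_2(A),
  where the two pieces of x sit in different diagonal corners.

  The factor 2 in r_n makes room for t_n: the comparison of singular values works at every level
  below \<alpha>(\<Theta>(n)) / C = 2 r_n, while t_n > r_n lets a continuous function be 0 up to r_n
  and 1 from t_n on. The exponent 2^(1/2) arises because a^2 is reached from b in two steps, each of
  which asks for an exponent above 1.\<close>

lemma star_zero [simp]: "star (0::'a::cstar_algebra) = 0"
  by (metis add_cancel_left_left star_add)

lemma star_minus [simp]: "star (- x) = - star (x::'a::cstar_algebra)"
  by (metis add.right_inverse add_eq_0_iff star_add star_zero)

lemma star_diff: "star (x - y) = star x - star (y::'a::cstar_algebra)"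
  by (metis add_uminus_conv_diff star_add star_minus)

lemma star_scaleR: "star (r *\<^sub>R x) = r *\<^sub>R star (x::'a::cstar_algebra)"
  by (simp add: scaleR_scaleC star_scaleC)

lemma star_sum: "star (sum f I) = (\<Sum>i\<in>I. star (f i :: 'a::cstar_algebra))"
  by (induction I rule: infinite_finite_induct) (auto simp: star_add)

lemma norm_star: "norm (star x) = norm (x::'a::cstar_algebra)"
proof -
  have le: "norm x \<le> norm (star x)" for x :: 'a
  proof (cases "x = 0")
    case False
    have "norm x * norm x \<le> norm (star x) * norm x"
      by (metis cstar_identity norm_mult_ineq power2_eq_square)
    then show ?thesis using False by simp
  qed simp
  show ?thesis using le[of x] le[of "star x"] by (simp add: star_star)
qed

lemma cstar_identity': "norm (x * star x) = (norm (x::'a::cstar_algebra))\<^sup>2"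
  by (metis cstar_identity norm_star star_star)

lemma bounded_linear_star: "bounded_linear (star :: 'a::cstar_algebra \<Rightarrow> 'a)"
  by (rule bounded_linear_intro[where K=1]) (auto simp: star_add star_scaleR norm_star)

lemmas tendsto_star = bounded_linear.tendsto[OF bounded_linear_star]

lemma star_mult_self_eq_0: "star x * x = 0 \<longleftrightarrow> x = (0::'a::cstar_algebra)"
  by (metis cstar_identity mult_zero_right norm_eq_zero power2_eq_square mult_eq_0_iff)

lemma norm_sa_square: "star a = a \<Longrightarrow> norm (a * a) = (norm (a::'a::cstar_algebra))\<^sup>2"
  by (metis cstar_identity)

lemma scaleC_scaleR_commute: "c *\<^sub>C (r *\<^sub>R x) = r *\<^sub>R (c *\<^sub>C (x::'a::cstar_algebra))"
  by (simp add: scaleR_scaleC scaleC_scaleC mult.commute)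

lemma scaleC_minus_right: "c *\<^sub>C (- x) = - (c *\<^sub>C (x::'a::cstar_algebra))"
  by (metis scaleC_scaleR_commute scaleR_minus1_left)

lemma scaleC_minus_left: "(- c) *\<^sub>C x = - (c *\<^sub>C (x::'a::cstar_algebra))"
  using scaleC_scaleC[of "-1" c x] scaleR_scaleC[of "-1" "c *\<^sub>C x"] by simp

lemma scaleC_diff_right: "c *\<^sub>C (x - y) = c *\<^sub>C x - c *\<^sub>C (y::'a::cstar_algebra)"
  by (metis add_uminus_conv_diff scaleC_add_right scaleC_minus_right)

lemma scaleC_one: "1 *\<^sub>C x = (x::'a::cstar_algebra)"
  by (metis of_real_1 scaleR_one scaleR_scaleC)

section \<open>Polynomials of operators\<close>

text \<open>Unlike \<open>poly_at\<close> this keeps the constant coefficient, as a multiple of the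
  identity map. The map f is arbitrary in order to cover left multiplication by a, an isometry U,
  and multiplication by a complex number applied to 1, which is evaluation.\<close>

definition opoly :: "real poly \<Rightarrow> ('a::real_vector \<Rightarrow> 'a) \<Rightarrow> 'a \<Rightarrow> 'a" where
  "opoly P f x = (\<Sum>i\<le>degree P. coeff P i *\<^sub>R (f ^^ i) x)"

lemma opoly_eq_sum: "degree P \<le> n \<Longrightarrow> opoly P f x = (\<Sum>i\<le>n. coeff P i *\<^sub>R (f ^^ i) x)"
  unfolding opoly_def by (rule sum.mono_neutral_left) (auto simp: coeff_eq_0)

lemma opoly_0 [simp]: "opoly 0 f x = 0"
  by (simp add: opoly_def)

lemma linear_funpow: "linear f \<Longrightarrow> linear (f ^^ i)" for f :: "'a::real_vector \<Rightarrow> 'a"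
  by (induction i) (auto simp: linear_iff)

lemma opoly_pCons: "linear f \<Longrightarrow> opoly (pCons c P) f x = c *\<^sub>R x + f (opoly P f x)"
proof -
  assume f: "linear f"
  have "opoly (pCons c P) f x = (\<Sum>i\<le>Suc (degree P). coeff (pCons c P) i *\<^sub>R (f ^^ i) x)"
    by (rule opoly_eq_sum) (simp add: degree_pCons_le)
  also have "\<dots> = c *\<^sub>R x + (\<Sum>i\<le>degree P. coeff P i *\<^sub>R f ((f ^^ i) x))"
    by (subst sum.atMost_Suc_shift) simp
  also have "\<dots> = c *\<^sub>R x + f (opoly P f x)"
    by (simp add: opoly_def linear_sum[OF f] linear_scale[OF f])
  finally show ?thesis .
qed

lemma opoly_add: "opoly (P + Q) f x = opoly P f x + opoly Q f x"
  using opoly_eq_sum[of "P + Q" "max (degree P) (degree Q)" f x]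
    opoly_eq_sum[of P "max (degree P) (degree Q)" f x]
    opoly_eq_sum[of Q "max (degree P) (degree Q)" f x]
  by (simp add: degree_add_le scaleR_left_distrib sum.distrib)

lemma opoly_smult: "opoly (smult c P) f x = c *\<^sub>R opoly P f x"
  using opoly_eq_sum[of "smult c P" "degree P" f x]
  by (simp add: degree_smult_le scaleR_sum_right opoly_def)

lemma linear_opoly: "linear f \<Longrightarrow> linear (opoly P f)"
  unfolding opoly_def
  by (intro linear_compose_sum ballI linear_compose_scale_right linear_funpow)

lemma opoly_mult: "linear f \<Longrightarrow> opoly (P * Q) f x = opoly P f (opoly Q f x)"
proof (induction P)
  case (pCons c P)
  then show ?case
    by (simp add: opoly_add opoly_smult opoly_pCons)
qed simp

lemma linear_mult_left: "linear ((*) (a::'a::real_algebra))"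
  by (rule linearI) (auto simp: distrib_left)

lemma opoly_mult_right: "opoly P ((*) a) x * y = opoly P ((*) a) (x * (y::'a::real_algebra))"
proof (induction P)
  case (pCons c P)
  then show ?case
    by (simp add: opoly_pCons linear_mult_left distrib_right mult.assoc)
qed simp

lemma opoly_mult_left_commute: "opoly P ((*) a) (a * y) = a * opoly P ((*) a) (y::'a::real_algebra)"
  by (induction P) (simp_all add: opoly_pCons linear_mult_left distrib_left)

text \<open>P(a) is self-adjoint as an operator; it need not be an element of A, hence the
  formulation through x and y.\<close>

lemma star_opoly_mult:
  assumes "star a = (a::'a::cstar_algebra)"
  shows "star (opoly P ((*) a) x) * y = star x * opoly P ((*) a) y"
proof (induction P arbitrary: y)
  case (pCons c P)
  have "star (opoly P ((*) a) x) * a * y = star x * (a * opoly P ((*) a) y)"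
    using pCons.IH[of "a * y"] by (simp add: opoly_mult_left_commute mult.assoc)
  then show ?case
    by (simp add: opoly_pCons linear_mult_left star_add star_scaleR star_mult assms
        distrib_left distrib_right mult.assoc)
qed simp

section \<open>Norm estimate for polynomials of self-adjoint elements\<close>

text \<open>Orthogonality of the characters of the cyclic group of order m: the quotient is an m-th
  root of unity other than 1, so its geometric sum vanishes.\<close>

lemma sum_root_unity_powers:
  assumes "i < m" "j < m" "i \<noteq> j"
  shows "(\<Sum>l<m. (cis (2 * pi * real i / real m) / cis (2 * pi * real j / real m)) ^ l) = 0"
proof -
  let ?z = "cis (2 * pi * real i / real m) / cis (2 * pi * real j / real m)"
  have m: "m > 0" using assms by simp
  have "?z \<noteq> 1"
    using Complex.bij_betw_roots_unity[OF m] assms by (auto simp: bij_betw_def inj_on_def)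
  moreover have "?z ^ m = 1"
    using m by (simp add: power_divide Complex.DeMoivre)
  ultimately show ?thesis
    by (subst geometric_sum) auto
qed

lemma opoly_complex: "opoly P ((*) (z::complex)) 1 = (\<Sum>i\<le>degree P. of_real (coeff P i) * z ^ i)"
proof -
  have "((*) z ^^ i) 1 = z ^ i" for i by (induction i) auto
  then show ?thesis by (simp add: opoly_def scaleR_conv_of_real)
qed

text \<open>Cauchy's estimate, with the contour integral replaced by an average over the m-th roots
  of unity.\<close>

lemma coeff_le_sup_unit_circle:
  fixes R :: "real poly"
  assumes R: "\<And>z::complex. cmod z = 1 \<Longrightarrow> cmod (opoly R ((*) z) 1) \<le> M"
  shows "\<bar>coeff R j\<bar> \<le> M"
proof -
  \<comment> \<open>m exceeds j and every exponent in R, so that only the j-th coefficient survives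
    the average.\<close>
  define m where "m = Suc (degree R + j)"
  define w where "w i = cis (2 * pi * real i / real m)" for i
  have wl: "w i ^ l = w l ^ i" for i l
    by (simp add: w_def Complex.DeMoivre mult_ac)
  have nw: "cmod (w i ^ l) = 1" for i l by (simp add: w_def norm_power)
  have w0: "w i \<noteq> 0" for i by (simp add: w_def)
  have "(\<Sum>l<m. opoly R ((*) (w l)) 1 / w l ^ j) = (\<Sum>l<m. \<Sum>i\<le>degree R. of_real (coeff R i) * (w i / w j) ^ l)"
    by (intro sum.cong refl) (simp add: opoly_complex sum_divide_distrib power_divide wl[symmetric])
  also have "\<dots> = (\<Sum>i\<le>degree R. of_real (coeff R i) * (\<Sum>l<m. (w i / w j) ^ l))"
    by (subst sum.swap) (simp add: sum_distrib_left)
  also have "\<dots> = (\<Sum>i\<le>degree R. if i = j then of_real (coeff R i) * of_nat m else 0)"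
  proof (intro sum.cong refl)
    fix i assume i: "i \<in> {..degree R}"
    show "of_real (coeff R i) * (\<Sum>l<m. (w i / w j) ^ l) = (if i = j then of_real (coeff R i) * of_nat m else 0)"
      using sum_root_unity_powers[of i m j] i w0 by (auto simp: m_def w_def)
  qed
  also have "\<dots> = of_real (coeff R j) * of_nat m"
    by (auto simp: sum.delta coeff_eq_0)
  finally have "\<bar>coeff R j\<bar> * of_nat m = cmod (\<Sum>l<m. opoly R ((*) (w l)) 1 / w l ^ j)"
    by (metis norm_mult norm_of_nat norm_of_real)
  also have "\<dots> \<le> (\<Sum>l<m. M)"
  proof (rule sum_norm_le)
    fix l show "cmod (opoly R ((*) (w l)) 1 / w l ^ j) \<le> M"
      using R[of "w l"] nw[of l 1] nw[of l j] by (simp add: norm_divide)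
  qed
  finally show ?thesis by (simp add: m_def)
qed

lemma opoly_of_real: "opoly P ((*) (of_real t :: complex)) 1 = of_real (poly P t)"
  by (simp add: opoly_complex poly_altdef)

lemma opoly_monom: "linear f \<Longrightarrow> opoly (monom 1 n) f x = (f ^^ n) x"
  by (induction n) (simp_all add: monom_0 monom_Suc opoly_pCons linear_0)

text \<open>If \<open>A = (U + U\<^sup>-\<^sup>1) / 2\<close> then \<open>U\<^sup>D P(A)\<close> is a polynomial in \<open>U\<close>, namely the one given by
  \<open>z\<^sup>D P((z + z\<^sup>-\<^sup>1) / 2)\<close>; its coefficients are bounded by the supremum of \<open>P\<close> on \<open>[-1, 1]\<close>.\<close>

lemma opoly_laurent:
  fixes U A :: "'a::real_vector \<Rightarrow> 'a"
  assumes U: "linear U" and A: "linear A"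
    and UA: "\<And>x. U (A x) = (1/2) *\<^sub>R (U (U x) + x)"
  shows "\<exists>R D. D \<le> degree P + 1 \<and> degree R \<le> 2 * D \<and>
    (\<forall>z. z \<noteq> 0 \<longrightarrow> opoly R ((*) z) 1 =
       z ^ D * opoly P ((*) ((z + inverse z) / 2 :: complex)) 1) \<and>
    (\<forall>x. (U ^^ D) (opoly P A x) = opoly R U x)"
proof (induction P)
  case 0
  show ?case by (intro exI[of _ 0]) simp
next
  case (pCons c P)
  then obtain R D where D: "D \<le> degree P + 1" "degree R \<le> 2 * D"
    and R: "\<And>z. z \<noteq> 0 \<Longrightarrow> opoly R ((*) z) 1 =
       z ^ D * opoly P ((*) ((z + inverse z) / 2 :: complex)) 1"
    and RU: "\<And>x. (U ^^ D) (opoly P A x) = opoly R U x"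
    by blast
  \<comment> \<open>\<open>degree (pCons c 0)\<close> is 0 and not \<open>degree 0 + 1\<close>, so
    for P = 0 the D of the induction hypothesis may be too large by one and is replaced by
    0.\<close>
  obtain R D where D: "D \<le> degree (pCons c P)" "degree R \<le> 2 * D"
    and R: "\<And>z. z \<noteq> 0 \<Longrightarrow> opoly R ((*) z) 1 =
       z ^ D * opoly P ((*) ((z + inverse z) / 2 :: complex)) 1"
    and RU: "\<And>x. (U ^^ D) (opoly P A x) = opoly R U x"
  proof (cases "P = 0")
    case True
    then show ?thesis using that[of 0 0] by simp
  next
    case False
    then show ?thesis using that[of D R] D R RU by simp
  qed
  \<comment> \<open>z^(D+1) (c + (z + 1/z) P / 2) = c z^(D+1) + (z^2 + 1) (z^D P) / 2, and z^D P is
    R.\<close>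
  define Q where "Q = smult c (monom 1 (Suc D)) + smult (1/2) ([:1, 0, 1:] * R)"
  have "degree Q \<le> 2 * Suc D"
    unfolding Q_def
  proof (intro degree_add_le order_trans[OF degree_smult_le])
    show "degree (monom (1::real) (Suc D)) \<le> 2 * Suc D"
      by (simp add: degree_monom_eq)
    show "degree ([:1, 0, 1:] * R) \<le> 2 * Suc D"
      using degree_mult_le[of "[:1, 0, 1:]" R] D(2) by simp
  qed
  moreover have "opoly Q ((*) z) 1 =
      z ^ Suc D * opoly (pCons c P) ((*) ((z + inverse z) / 2)) 1" if "z \<noteq> 0" for z :: complex
  proof -
    have "((*) z ^^ i) 1 = z ^ i" for i by (induction i) auto
    then show ?thesis
      using that R[OF that]
      by (simp add: Q_def opoly_add opoly_smult opoly_mult opoly_pCons opoly_monom linear_mult_left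
          scaleR_conv_of_real field_simps del: mult_pCons_left)
  qed
  moreover have "(U ^^ Suc D) (opoly (pCons c P) A x) = opoly Q U x" for x
  proof -
    have lUD: "linear (U ^^ D)" using U by (rule linear_funpow)
    have "(U ^^ Suc D) (opoly (pCons c P) A x) = c *\<^sub>R (U ^^ Suc D) x + (U ^^ D) (U (A (opoly P A x)))"
      by (simp only: opoly_pCons[OF A] funpow_Suc_right o_apply linear_add[OF U] linear_scale[OF U]
          linear_add[OF lUD] linear_scale[OF lUD])
    also have "(U ^^ D) (U (A (opoly P A x))) = (1/2) *\<^sub>R (U (U (opoly R U x)) + opoly R U x)"
      by (simp only: UA linear_add[OF lUD] linear_scale[OF lUD] RU[symmetric])
        (metis funpow_swap1)
    finally show ?thesis
      by (simp add: Q_def opoly_add opoly_smult opoly_mult[OF U] opoly_pCons[OF U]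
          opoly_monom[OF U] linear_0[OF U] add.commute del: mult_pCons_left)
  qed
  moreover have "Suc D \<le> degree (pCons c P) + 1" using D(1) by simp
  ultimately show ?case by blast
qed

text \<open>Applying the isometry U^D changes no norm and turns P(A) x into R(U) x, a sum of
  \<open>degree R + 1\<close> vectors of norm at most M * norm x. The factor is
  \<open>degree R + 1 \<le> 2 * D + 1 \<le> 2 * degree P + 3\<close>.\<close>

lemma norm_opoly_isometry_le:
  fixes U A :: "'a::real_normed_vector \<Rightarrow> 'a"
  assumes U: "linear U" and A: "linear A"
    and UA: "\<And>x. U (A x) = (1/2) *\<^sub>R (U (U x) + x)"
    and iso: "\<And>x. norm (U x) = norm x"
    and M: "\<And>t. \<bar>t\<bar> \<le> 1 \<Longrightarrow> \<bar>poly P t\<bar> \<le> M"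
  shows "norm (opoly P A x) \<le> real (2 * degree P + 3) * M * norm x"
proof -
  obtain R D where D: "D \<le> degree P + 1" "degree R \<le> 2 * D"
    and R: "\<And>z. z \<noteq> 0 \<Longrightarrow> opoly R ((*) z) 1 =
       z ^ D * opoly P ((*) ((z + inverse z) / 2 :: complex)) 1"
    and RU: "\<And>x. (U ^^ D) (opoly P A x) = opoly R U x"
    using opoly_laurent[OF U A UA] by blast
  have isoD: "norm ((U ^^ i) x) = norm x" for i x
    by (induction i) (auto simp: iso)
  have M0: "0 \<le> M" using M[of 0] by simp
  have bound: "cmod (opoly R ((*) z) 1) \<le> M" if z: "cmod z = 1" for z
  proof -
    have "z \<noteq> 0" using z by auto
    have "inverse z = cnj z"
      using z by (intro inverse_unique) (simp add: complex_norm_square[symmetric])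
    then have "(z + inverse z) / 2 = of_real (Re z)"
      by (simp add: complex_eq_iff)
    moreover have "\<bar>Re z\<bar> \<le> 1" using abs_Re_le_cmod[of z] z by simp
    ultimately show ?thesis
      using R[OF \<open>z \<noteq> 0\<close>] M[of "Re z"] z by (simp add: norm_mult norm_power opoly_of_real)
  qed
  have cR: "\<bar>coeff R i\<bar> \<le> M" for i
    by (rule coeff_le_sup_unit_circle[OF bound])
  have "norm (opoly P A x) = norm (opoly R U x)" using RU isoD by metis
  also have "\<dots> \<le> (\<Sum>i\<le>degree R. norm (coeff R i *\<^sub>R (U ^^ i) x))"
    unfolding opoly_def by (rule norm_sum)
  also have "\<dots> \<le> (\<Sum>i\<le>degree R. M * norm x)"
    by (intro sum_mono) (simp add: isoD mult_right_mono cR)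
  also have "\<dots> = real (degree R + 1) * (M * norm x)" by simp
  also have "\<dots> \<le> real (2 * degree P + 3) * (M * norm x)"
    using D M0 by (intro mult_right_mono) auto
  finally show ?thesis by (simp add: mult.assoc)
qed

text \<open>w plays the part of 1 - (1 - a^2)^(1/2). The functional calculus still depends on this
  lemma, so w is found as a fixed point of w \<mapsto> (a^2 + w^2) / 2.\<close>

lemma sqrt_fixpoint:
  fixes a :: "'a::cstar_algebra"
  assumes a: "star a = a" "norm a < 1"
  obtains w where "star w = w" "w * a = a * w" "2 *\<^sub>R w - w * w = a * a"
proof -
  \<comment> \<open>The smaller root of r = (norm a^2 + r^2) / 2: the ball of radius r is mapped
    into itself, and r < 1 serves as the contraction constant on it.\<close>
  define r where "r = 1 - sqrt (1 - (norm a)\<^sup>2)"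
  have na: "(norm a)\<^sup>2 < 1" using a(2) by (simp add: abs_square_less_1)
  have r: "0 \<le> r" "r < 1" using na by (auto simp: r_def)
  have "(1 - r)\<^sup>2 = 1 - (norm a)\<^sup>2" using na by (simp add: r_def)
  then have rr: "((norm a)\<^sup>2 + r * r) / 2 = r" by (simp add: power2_eq_square algebra_simps)
  define S where "S = cball 0 r \<inter> {w. star w = w} \<inter> {w. w * a = a * w}"
  define f where "f w = (1/2) *\<^sub>R (a * a + w * w)" for w
  have "complete S"
    unfolding S_def complete_eq_closed
    by (intro closed_Int closed_cball closed_Collect_eq continuous_intros
        linear_continuous_on bounded_linear_star)
  moreover have "S \<noteq> {}" proof -
    have "0 \<in> S" using r by (simp add: S_def)
    then show ?thesis by blast
  qed
  moreover have "f ` S \<subseteq> S"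
  proof
    fix y assume "y \<in> f ` S"
    then obtain w where y: "y = f w" and w: "norm w \<le> r" "star w = w" "w * a = a * w"
      by (auto simp: S_def)
    have "norm (a * a + w * w) \<le> (norm a)\<^sup>2 + r * r"
      using norm_triangle_ineq[of "a * a" "w * w"] norm_mult_ineq[of a a] norm_mult_ineq[of w w]
        mult_mono[OF w(1) w(1) r(1)] by (simp add: power2_eq_square)
    then have "norm y \<le> r" using rr by (simp add: y f_def)
    moreover have "w * w * a = a * (w * w)" using w(3) by (metis mult.assoc)
    ultimately show "y \<in> S"
      using w(2) a(1) by (simp add: S_def y f_def star_scaleR star_add star_mult
          distrib_left distrib_right mult.assoc)
  qed
  moreover have "dist (f x) (f y) \<le> r * dist x y" if xy: "x \<in> S" "y \<in> S" for x y
  proof -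
    have n: "norm x \<le> r" "norm y \<le> r" using xy by (auto simp: S_def)
    have "f x - f y = (1/2) *\<^sub>R ((x - y) * x + y * (x - y))"
      by (simp add: f_def algebra_simps)
    then have "norm (f x - f y) \<le> (norm ((x - y) * x) + norm (y * (x - y))) / 2"
      using norm_triangle_ineq[of "(x - y) * x" "y * (x - y)"] by simp
    also have "\<dots> \<le> (norm (x - y) * r + r * norm (x - y)) / 2"
      using norm_mult_ineq[of "x - y" x] norm_mult_ineq[of y "x - y"]
        mult_left_mono[OF n(1), of "norm (x - y)"] mult_right_mono[OF n(2), of "norm (x - y)"]
      by (simp add: mult.commute)
    finally show ?thesis by (simp add: dist_norm mult.commute)
  qed
  ultimately obtain w where w: "w \<in> S" "f w = w"
    using Banach_fix[of S r f] r by blast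
  have "2 *\<^sub>R w = a * a + w * w"
    using arg_cong[OF w(2), of "\<lambda>x. 2 *\<^sub>R x"] by (simp add: f_def)
  then have "2 *\<^sub>R w - w * w = a * a" by simp
  then show ?thesis using w(1) that by (auto simp: S_def)
qed

text \<open>The isometry is \<open>U = a + i (1 - a\<^sup>2)\<^sup>1\<^sup>/\<^sup>2\<close>, acting by left multiplication.\<close>

lemma norm_opoly_le_degree:
  fixes a :: "'a::cstar_algebra"
  assumes a: "star a = a" "norm a < 1"
    and M: "\<And>t. \<bar>t\<bar> \<le> 1 \<Longrightarrow> \<bar>poly P t\<bar> \<le> M"
  shows "norm (opoly P ((*) a) x) \<le> real (2 * degree P + 3) * M * norm x"
proof -
  obtain w where w: "star w = w" "w * a = a * w" "2 *\<^sub>R w - w * w = a * a"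
    using sqrt_fixpoint[OF a] by blast
  \<comment> \<open>x - w * x is (1 - a^2)^(1/2) x, written without a unit.\<close>
  define U where "U x = a * x + \<i> *\<^sub>C (x - w * x)" for x
  have wwx: "2 *\<^sub>R (w * x) - w * (w * x) = a * (a * x)" for x
    using arg_cong[OF w(3), of "\<lambda>y. y * x"] by (simp add: algebra_simps)
  have wax: "w * (a * x) = a * (w * x)" for x using w(2) by (metis mult.assoc)
  show ?thesis
  proof (rule norm_opoly_isometry_le[where U=U])
    show linU: "linear U"
      by (rule linearI) (auto simp: U_def algebra_simps scaleC_add_right scaleC_diff_right
          scaleC_scaleR_commute)
    show "linear ((*) a)" by (rule linear_mult_left)
    have iii: "\<i> *\<^sub>C \<i> *\<^sub>C y = - y" for y :: 'a
      by (simp add: scaleC_scaleC scaleC_minus_left scaleC_one)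
    show "U (a * x) = (1/2) *\<^sub>R (U (U x) + x)" for x
    proof -
      have 1: "U (U x) = a * (a * x) + \<i> *\<^sub>C (a * x - a * (w * x)) + (\<i> *\<^sub>C (a * x - w * (a * x)) 
         + \<i> *\<^sub>C \<i> *\<^sub>C ((x - w * x) - w * (x - w * x)))"
        unfolding U_def
        by (simp add: distrib_left right_diff_distrib mult_scaleC_right scaleC_add_right scaleC_diff_right)
      also have "\<dots> = 2 *\<^sub>R (a * (a * x)) + 2 *\<^sub>R (\<i> *\<^sub>C (a * x - w * (a * x))) - x"
        using wwx[of x] unfolding iii wax by (simp add: algebra_simps scaleR_2)
      also have "\<dots> = 2 *\<^sub>R U (a * x) - x" by (simp add: U_def scaleR_add_right)
      finally show ?thesis by simp
    qed
    show "norm (U x) = norm x" for x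
    proof -
      have sU: "star (U x) = star x * a - \<i> *\<^sub>C (star x - star x * w)"
        by (simp add: U_def star_add star_mult star_scaleC star_diff a(1) w(1) scaleC_minus_left)
      have "star (U x) * U x = star x * (a * (a * x)) + \<i> *\<^sub>C (star x * (a * x) - star x * (a * (w * x)))
         - \<i> *\<^sub>C (star x * (a * x) - star x * (w * (a * x)))
         - \<i> *\<^sub>C \<i> *\<^sub>C (star x * (x - w * x) - star x * (w * (x - w * x)))"
        unfolding sU unfolding U_def
        by (simp add: distrib_left left_diff_distrib right_diff_distrib mult_scaleC_right
            mult_scaleC_left scaleC_add_right scaleC_diff_right mult.assoc)
      also have "\<dots> = star x * x - star x * (2 *\<^sub>R (w * x) - w * (w * x) - a * (a * x))"
        unfolding iii wax by (simp add: algebra_simps scaleR_2)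
      also have "\<dots> = star x * x" by (simp add: wwx)
      finally show ?thesis
        by (metis cstar_identity norm_ge_zero power2_eq_imp_eq)
    qed
  qed (use M in auto)
qed

text \<open>For y = P(a) x self-adjointness gives \<open>star y * y\<close> = star x * P^2(a) x, to
  which the C*-identity applies.\<close>

lemma norm_opoly_sq_le:
  fixes a :: "'a::cstar_algebra"
  assumes "star a = a"
  shows "(norm (opoly P ((*) a) x))\<^sup>2 \<le> norm x * norm (opoly (P ^ 2) ((*) a) x)"
proof -
  have "(norm (opoly P ((*) a) x))\<^sup>2 = norm (star x * opoly (P ^ 2) ((*) a) x)"
    by (simp only: cstar_identity[symmetric] star_opoly_mult[OF assms] power2_eq_square[of P]
        opoly_mult[OF linear_mult_left])
  also have "\<dots> \<le> norm x * norm (opoly (P ^ 2) ((*) a) x)"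
    using norm_mult_ineq[of "star x"] by (simp add: norm_star)
  finally show ?thesis .
qed

text \<open>Repeated squaring. For x \<noteq> 0 it reads (norm (P(a) x) / norm x)^(2^n) \<le> norm
  (P^(2^n)(a) x) / norm x, cleared of denominators.\<close>

lemma norm_opoly_power_le:
  fixes a :: "'a::cstar_algebra"
  assumes "star a = a"
  shows "norm x * norm (opoly P ((*) a) x) ^ 2 ^ n \<le> norm x ^ 2 ^ n * norm (opoly (P ^ 2 ^ n) ((*) a) x)"
proof (induction n)
  case (Suc n)
  let ?N = "\<lambda>k. norm (opoly (P ^ 2 ^ k) ((*) a) x)"
  show ?case
  proof (cases "x = 0")
    case False
    have "(norm x * norm (opoly P ((*) a) x) ^ 2 ^ n)\<^sup>2 \<le> (norm x ^ 2 ^ n * ?N n)\<^sup>2"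
      using Suc by (rule power_mono) simp
    also have "\<dots> \<le> norm x ^ 2 ^ Suc n * (norm x * ?N (Suc n))"
      using mult_left_mono[OF norm_opoly_sq_le[OF assms, of "P ^ 2 ^ n" x], of "norm x ^ 2 ^ Suc n"]
      by (simp add: power_mult_distrib power_mult[symmetric] mult.commute)
    finally have "norm x * (norm x * norm (opoly P ((*) a) x) ^ 2 ^ Suc n)
        \<le> norm x * (norm x ^ 2 ^ Suc n * ?N (Suc n))"
      by (simp add: power_mult_distrib power_mult[symmetric] power2_eq_square mult_ac power_add[symmetric] mult_2)
    then show ?thesis using False by simp
  qed simp
qed simp

lemma norm_opoly_le_1:
  fixes a :: "'a::cstar_algebra"
  assumes a: "star a = a" "norm a < 1"
    and M: "\<And>t. \<bar>t\<bar> \<le> 1 \<Longrightarrow> \<bar>poly P t\<bar> \<le> M"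
  shows "norm (opoly P ((*) a) x) \<le> M * norm x"
proof (rule ccontr)
  assume neg: "\<not> ?thesis"
  have M0: "0 \<le> M" using M[of 0] by simp
  define y where "y = norm (opoly P ((*) a) x)"
  have x0: "norm x > 0" using neg by (cases "x = 0") (auto simp: linear_0[OF linear_opoly[OF linear_mult_left]])
  have yp: "y > M * norm x" using neg by (simp add: y_def)
  \<comment> \<open>M may be 0. The midpoint M' is positive and still below norm (P(a) x) / norm x,
    so the quotient q of the latter by M' is above 1.\<close>
  define M' where "M' = (M + y / norm x) / 2"
  have M': "M < M'" "M' < y / norm x" using yp x0 by (auto simp: M'_def field_simps)
  define q where "q = y / norm x / M'"
  have M'0: "M' > 0" using M0 M' by simp
  have q: "q > 1" using M' M'0 by (simp only: q_def less_divide_eq_1_pos)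
  have le: "q ^ 2 ^ n \<le> 2 * degree P * 2 ^ n + 3" for n
  proof -
    have "norm (opoly (P ^ 2 ^ n) ((*) a) x) \<le> real (2 * degree (P ^ 2 ^ n) + 3) * M' ^ 2 ^ n * norm x"
      by (rule norm_opoly_le_degree[OF a])
        (use M M'(1) M0 in \<open>auto simp: poly_power power_abs intro!: power_mono order_trans[OF M]\<close>)
    also have "\<dots> \<le> real (2 * (degree P * 2 ^ n) + 3) * M' ^ 2 ^ n * norm x"
      using degree_power_le[of P "2 ^ n"] M'0
      by (intro mult_right_mono) (auto simp: mult.commute simp flip: of_nat_mult)
    finally have "norm x ^ 2 ^ n * norm (opoly (P ^ 2 ^ n) ((*) a) x) \<le>
      norm x ^ 2 ^ n * (real (2 * (degree P * 2 ^ n) + 3) * M' ^ 2 ^ n * norm x)"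
      by (intro mult_left_mono) auto
    with norm_opoly_power_le[OF a(1), of x P n]
    have "norm x * y ^ 2 ^ n \<le> norm x ^ 2 ^ n * (real (2 * (degree P * 2 ^ n) + 3) * M' ^ 2 ^ n * norm x)"
      unfolding y_def by linarith
    then have "norm x * y ^ 2 ^ n \<le> norm x * (real (2 * (degree P * 2 ^ n) + 3) * (norm x * M') ^ 2 ^ n)"
      by (simp add: power_mult_distrib mult_ac)
    then have "y ^ 2 ^ n \<le> real (2 * (degree P * 2 ^ n) + 3) * (norm x * M') ^ 2 ^ n"
      using x0 by (meson mult_le_cancel_left_pos)
    then have "(y / (norm x * M')) ^ 2 ^ n \<le> real (2 * (degree P * 2 ^ n) + 3)"
      using x0 M'0 by (simp add: power_divide divide_le_eq)
    then show ?thesis by (simp add: q_def mult.assoc)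
  qed
  \<comment> \<open>q^m outgrows every linear function of m, which \<open>le\<close> contradicts at
    m = 2^n.\<close>
  have "(\<lambda>m. real m * (1 / q) ^ m) \<longlonglongrightarrow> 0"
    using q by (intro powser_times_n_limit_0) auto
  moreover have "(\<lambda>m. (1 / q) ^ m) \<longlonglongrightarrow> 0"
    using q by (intro LIMSEQ_realpow_zero) auto
  ultimately have "(\<lambda>m. 2 * degree P * (real m * (1 / q) ^ m) + 3 * (1 / q) ^ m) \<longlonglongrightarrow> real (2 * degree P) * 0 + 3 * 0"
    by (intro tendsto_add tendsto_mult_left)
  then have "\<forall>\<^sub>F m in sequentially. 2 * degree P * (real m * (1 / q) ^ m) + 3 * (1 / q) ^ m < 1"
    by (rule order_tendstoD) simp
  then obtain m0 where m0: "\<And>m. m \<ge> m0 \<Longrightarrow> 2 * degree P * (real m * (1 / q) ^ m) + 3 * (1 / q) ^ m < 1"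
    by (auto simp: eventually_sequentially)
  have "m0 \<le> 2 ^ m0" using less_exp[of m0] by simp
  from m0[OF this] have "(2 * degree P * real (2 ^ m0) + 3) * (1 / q) ^ 2 ^ m0 < 1"
    by (simp add: algebra_simps)
  then have "2 * degree P * real (2 ^ m0) + 3 < q ^ 2 ^ m0"
    using q by (simp add: power_one_over field_simps)
  then show False using le[of m0] by simp
qed

lemma opoly_scale:
  "opoly P ((*) (r *\<^sub>R a)) x = opoly (pcompose P [:0, r:]) ((*) a) (x::'a::real_algebra)"
proof (induction P)
  case (pCons c P)
  have "opoly ([:0, r:] * pcompose P [:0, r:]) ((*) a) x = r *\<^sub>R (a * opoly (pcompose P [:0, r:]) ((*) a) x)"
    by (simp add: opoly_smult opoly_pCons linear_mult_left)
  then show ?case using pCons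
    unfolding pcompose_pCons opoly_add opoly_pCons[OF linear_mult_left] pCons(2)
    by (simp add: opoly_smult opoly_pCons linear_mult_left)
qed simp

lemma norm_opoly_le:
  fixes a :: "'a::cstar_algebra"
  assumes a: "star a = a"
    and M: "\<And>t. \<bar>t\<bar> \<le> norm a \<Longrightarrow> \<bar>poly P t\<bar> \<le> M"
  shows "norm (opoly P ((*) a) x) \<le> M * norm x"
proof (rule field_le_epsilon)
  fix e :: real assume e: "e > 0"
  define d where "d = e / (norm x + 1)"
  have d: "d > 0" using e by (simp add: d_def add_nonneg_pos)
  \<comment> \<open>\<open>norm_opoly_le_1\<close> wants norm below 1, so a is divided by some r >
    norm a; uniform continuity keeps the supremum over the longer interval below M + d.\<close>
  have "\<exists>r>norm a. \<forall>t. \<bar>t\<bar> \<le> r \<longrightarrow> \<bar>poly P t\<bar> \<le> M + d"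
  proof -
    have uc: "uniformly_continuous_on {-(norm a + 1)..norm a + 1} (poly P)"
      by (intro compact_uniformly_continuous continuous_intros) auto
    then obtain \<delta> where \<delta>: "\<delta> > 0" "\<And>s t. s \<in> {-(norm a + 1)..norm a + 1} \<Longrightarrow> t \<in> {-(norm a + 1)..norm a + 1} \<Longrightarrow>
       \<bar>t - s\<bar> < \<delta> \<Longrightarrow> \<bar>poly P t - poly P s\<bar> < d"
      unfolding uniformly_continuous_on_def dist_real_def using d by metis
    define r where "r = norm a + min 1 (\<delta> / 2)"
    have "\<bar>poly P t\<bar> \<le> M + d" if t: "\<bar>t\<bar> \<le> r" for t
    proof -
      define s where "s = max (- norm a) (min t (norm a))"
      have "\<bar>s\<bar> \<le> norm a" using norm_ge_zero[of a] by (simp add: s_def abs_le_iff)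
      moreover have "\<bar>t - s\<bar> < \<delta>" using t \<delta>(1) by (auto simp: s_def r_def min_def max_def split: if_splits)
      moreover have "\<bar>t\<bar> \<le> norm a + 1" using t by (simp add: r_def)
      ultimately have "\<bar>poly P t - poly P s\<bar> < d" by (intro \<delta>(2)) (auto simp: abs_le_iff)
      then show ?thesis using M[OF \<open>\<bar>s\<bar> \<le> norm a\<close>] by linarith
    qed
    moreover have "r > norm a" using \<delta>(1) by (simp add: r_def)
    ultimately show ?thesis by blast
  qed
  then obtain r where r: "norm a < r" "\<And>t. \<bar>t\<bar> \<le> r \<Longrightarrow> \<bar>poly P t\<bar> \<le> M + d" by blast
  have r0: "r > 0" using r(1) norm_ge_zero[of a] by linarith
  have "norm (opoly (pcompose P [:0, r:]) ((*) ((1/r) *\<^sub>R a)) x) \<le> (M + d) * norm x"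
  proof (rule norm_opoly_le_1)
    show "norm ((1/r) *\<^sub>R a) < 1" using r r0 by simp
    show "\<bar>poly (pcompose P [:0, r:]) t\<bar> \<le> M + d" if "\<bar>t\<bar> \<le> 1" for t
    proof -
      have "\<bar>r * t\<bar> \<le> r" using that r0 by (simp add: abs_mult mult_left_le)
      then show ?thesis using r(2)[of "r * t"] by (simp add: poly_pcompose mult.commute)
    qed
  qed (simp add: star_scaleR a)
  moreover have "opoly (pcompose P [:0, r:]) ((*) ((1/r) *\<^sub>R a)) x = opoly P ((*) a) x"
    using opoly_scale[of P r "(1/r) *\<^sub>R a" x] r0 by simp
  moreover have "d * norm x \<le> e" using e mult_left_mono[of "norm x" "norm x + 1" e]
    by (simp add: d_def pos_divide_le_eq add_nonneg_pos)
  ultimately show "norm (opoly P ((*) a) x) \<le> M * norm x + e"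
    by (simp add: distrib_right)
qed

section \<open>Continuous functional calculus\<close>

text \<open>Continuity is asked on the whole line, not just near the spectrum, so that sums,
  products and compositions stay in the class without side conditions.\<close>

definition fc :: "(real \<Rightarrow> real) \<Rightarrow> bool" where
  "fc f \<longleftrightarrow> continuous_on UNIV f \<and> f 0 = 0"

text \<open>The radius M is independent of any element, so that one sequence of polynomials can
  serve several elements at once.\<close>

definition poly_approx :: "(nat \<Rightarrow> real poly) \<Rightarrow> real \<Rightarrow> (real \<Rightarrow> real) \<Rightarrow> bool" where
  "poly_approx P M f \<longleftrightarrow> (\<forall>k. coeff (P k) 0 = 0) \<and>
     uniform_limit {-M..M} (\<lambda>k. poly (P k)) f sequentially"

lemma poly_fun_simps:
  "poly (P + Q) = (\<lambda>t. poly P t + poly Q t)" "poly (P - Q) = (\<lambda>t. poly P t - poly Q t)"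
  "poly (P * Q) = (\<lambda>t. poly P t * poly Q t)" "poly (smult c P) = (\<lambda>t. c * poly P t)"
  "poly 0 = (\<lambda>t. 0 :: real)" "poly [:0, 1 :: real:] = (\<lambda>t. t)"
  for P Q :: "real poly"
  by (auto simp: fun_eq_iff mult.commute)

lemma poly_approx_exists:
  assumes "fc f" "0 \<le> M"
  obtains P where "poly_approx P M f"
proof -
  have cf: "continuous_on {-M..M} f" "f 0 = 0"
    using assms continuous_on_subset by (auto simp: fc_def)
  have "\<exists>P. coeff P 0 = 0 \<and> (\<forall>t\<in>{-M..M}. \<bar>poly P t - f t\<bar> < 1 / (real k + 1))" for k
  proof -
    \<comment> \<open>Half of the error goes into the approximation by g, half into removing the
      constant term of g, which is small because f vanishes at 0.\<close>
    have e: "0 < 1 / (2 * (real k + 1))" by simp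
    obtain g where g: "real_polynomial_function g"
      and gf: "\<And>t. t \<in> {-M..M} \<Longrightarrow> \<bar>f t - g t\<bar> < 1 / (2 * (real k + 1))"
      using Stone_Weierstrass_real_polynomial_function[OF compact_Icc cf(1) e] by blast
    obtain c n where cn: "g = (\<lambda>x. \<Sum>i\<le>n. c i * x ^ i)"
      using g unfolding real_polynomial_function_iff_sum by blast
    define Q where "Q = (\<Sum>i\<le>n. monom (c i) i)"
    have Q: "poly Q t = g t" for t by (simp add: Q_def cn poly_sum poly_monom)
    have q0: "\<bar>coeff Q 0\<bar> < 1 / (2 * (real k + 1))"
      using gf[of 0] cf(2) assms(2) by (simp add: Q[symmetric] poly_0_coeff_0)
    have "\<bar>poly (Q - [:coeff Q 0:]) t - f t\<bar> < 1 / (real k + 1)" if "t \<in> {-M..M}" for t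
    proof -
      have "1 / (2 * (real k + 1)) + 1 / (2 * (real k + 1)) = 1 / (real k + 1)"
        by (simp add: field_simps)
      then show ?thesis using gf[OF that] q0 by (simp add: Q)
    qed
    then show ?thesis by (intro exI[of _ "Q - [:coeff Q 0:]"]) auto
  qed
  then obtain P where P: "\<And>k. coeff (P k) 0 = 0"
     "\<And>k t. t \<in> {-M..M} \<Longrightarrow> \<bar>poly (P k) t - f t\<bar> < 1 / (real k + 1)"
    by metis
  have "uniform_limit {-M..M} (\<lambda>k. poly (P k)) f sequentially"
  proof (rule uniform_limitI)
    fix e :: real assume "e > 0"
    then obtain n where n: "1 / (real n + 1) < e"
      by (metis Suc_eq_plus1 nat_approx_posE of_nat_1 of_nat_add)
    show "\<forall>\<^sub>F k in sequentially. \<forall>t\<in>{-M..M}. dist (poly (P k) t) (f t) < e"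
    proof (rule eventually_sequentiallyI[of n], intro ballI)
      fix k t assume "n \<le> k" "t \<in> {-M..M}"
      then have "\<bar>poly (P k) t - f t\<bar> < 1 / (real k + 1)" "1 / (real k + 1) \<le> 1 / (real n + 1)"
        using P(2) by (auto simp: frac_le)
      then show "dist (poly (P k) t) (f t) < e" using n by (simp add: dist_real_def)
    qed
  qed
  then show ?thesis using that[of P] P(1) by (simp add: poly_approx_def)
qed

lemma poly_at_pCons: "poly_at (pCons 0 P) a = opoly P ((*) a) a"
  by (cases "P = 0") (simp_all add: poly_at_def opoly_def lessThan_Suc_atMost)

lemma coeff_0_eq_0_cases:
  assumes "coeff Q 0 = (0::real)"
  obtains P where "Q = pCons 0 P"
  using assms by (cases Q) auto

lemma poly_at_mult_right:
  "coeff Q 0 = 0 \<Longrightarrow> poly_at Q a * x = opoly Q ((*) a) (x::'a::cstar_algebra)"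
  by (elim coeff_0_eq_0_cases)
    (simp add: poly_at_pCons opoly_mult_right opoly_mult_left_commute opoly_pCons linear_mult_left)

lemma poly_at_add:
  "coeff P 0 = 0 \<Longrightarrow> coeff Q 0 = 0 \<Longrightarrow> poly_at (P + Q) a = poly_at P a + poly_at Q a"
  by (elim coeff_0_eq_0_cases) (simp add: poly_at_pCons opoly_add)

lemma poly_at_smult: "coeff P 0 = 0 \<Longrightarrow> poly_at (smult c P) a = c *\<^sub>R poly_at P a"
  by (elim coeff_0_eq_0_cases) (simp add: poly_at_pCons opoly_smult)

lemma poly_at_diff:
  "coeff P 0 = 0 \<Longrightarrow> coeff Q 0 = 0 \<Longrightarrow> poly_at (P - Q) a = poly_at P a - poly_at Q a"
  using poly_at_add[of P "smult (-1) Q" a] poly_at_smult[of Q "-1" a] by simp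

lemma poly_at_mult:
  assumes "coeff P 0 = 0" "coeff Q 0 = 0"
  shows "poly_at (P * Q) a = poly_at P a * poly_at Q (a::'a::cstar_algebra)"
proof -
  obtain R where "Q = pCons 0 R" using assms(2) by (rule coeff_0_eq_0_cases)
  moreover obtain S where "P = pCons 0 S" using assms(1) by (rule coeff_0_eq_0_cases)
  moreover have "pCons 0 S * pCons 0 R = pCons 0 (pCons 0 S * R)" by simp
  ultimately show ?thesis
    using poly_at_mult_right[OF assms(1), of a "poly_at Q a"]
    by (simp only: poly_at_pCons opoly_mult[OF linear_mult_left])
qed

lemma star_poly_at:
  assumes "coeff Q 0 = 0" "star a = (a::'a::cstar_algebra)"
  shows "star (poly_at Q a) = poly_at Q a"
proof -
  have "star (opoly P ((*) a) a) = opoly P ((*) a) a" for P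
  proof (induction P)
    case (pCons c P)
    have "opoly P ((*) a) a * a = a * opoly P ((*) a) a"
      by (simp add: opoly_mult_right opoly_mult_left_commute)
    then show ?case using pCons
      by (simp add: opoly_pCons linear_mult_left star_add star_scaleR star_mult assms(2))
  qed simp
  then show ?thesis using assms(1) by (elim coeff_0_eq_0_cases) (simp add: poly_at_pCons)
qed

text \<open>The operator bound is applied to the vector \<open>star (poly_at Q a)\<close>; the
  C*-identity turns the left side into a square and one factor cancels.\<close>

lemma norm_poly_at_le:
  assumes Q: "coeff Q 0 = 0" and a: "star a = (a::'a::cstar_algebra)"
    and M: "\<And>t. \<bar>t\<bar> \<le> norm a \<Longrightarrow> \<bar>poly Q t\<bar> \<le> M"
  shows "norm (poly_at Q a) \<le> M"
proof -
  have "(norm (poly_at Q a))\<^sup>2 = norm (opoly Q ((*) a) (star (poly_at Q a)))"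
    by (simp add: cstar_identity'[symmetric] poly_at_mult_right[OF Q])
  also have "\<dots> \<le> M * norm (poly_at Q a)"
    using norm_opoly_le[OF a M, of "star (poly_at Q a)"] by (simp add: norm_star)
  finally have "norm (poly_at Q a) = 0 \<or> norm (poly_at Q a) \<le> M"
    by (auto simp: power2_eq_square mult_le_cancel_right)
  then show ?thesis using M[of 0] by auto
qed

lemma poly_approx_mono: "poly_approx P M f \<Longrightarrow> N \<le> M \<Longrightarrow> poly_approx P N f"
  unfolding poly_approx_def by (auto elim!: uniform_limit_on_subset)

lemma poly_approx_le:
  assumes P: "poly_approx P M f" and M: "norm a \<le> M" and a: "star a = (a::'a::cstar_algebra)"
    and B: "\<And>t. \<bar>t\<bar> \<le> norm a \<Longrightarrow> \<bar>f t\<bar> \<le> B" and y: "(\<lambda>k. poly_at (P k) a) \<longlonglongrightarrow> y"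
  shows "norm y \<le> B"
proof (rule field_le_epsilon)
  fix e :: real assume "e > 0"
  have "\<forall>\<^sub>F k in sequentially. \<forall>t\<in>{-M..M}. dist (poly (P k) t) (f t) < e"
    using P \<open>e > 0\<close> by (auto simp: poly_approx_def uniform_limit_iff)
  then have "\<forall>\<^sub>F k in sequentially. norm (poly_at (P k) a) \<le> B + e"
  proof eventually_elim
    case (elim k)
    show ?case
    proof (rule norm_poly_at_le[OF _ a])
      fix t assume t: "\<bar>t\<bar> \<le> norm a"
      then have "dist (poly (P k) t) (f t) < e" using elim M by (auto simp: abs_le_iff)
      then show "\<bar>poly (P k) t\<bar> \<le> B + e" using B[OF t] by (simp add: dist_real_def)
    qed (use P in \<open>simp add: poly_approx_def\<close>)
  qed
  then show "norm y \<le> B + e"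
    by (rule tendsto_upperbound[OF tendsto_norm[OF y]]) simp
qed

lemma poly_approx_diff:
  "poly_approx P M f \<Longrightarrow> poly_approx Q M g \<Longrightarrow> poly_approx (\<lambda>k. P k - Q k) M (\<lambda>t. f t - g t)"
  unfolding poly_approx_def by (auto simp: poly_fun_simps intro: uniform_limit_minus)

text \<open>This justifies the definite description in \<open>cfc\<close>: the difference of two
  approximating sequences approximates 0, so their values at a have the same limit.\<close>

lemma cfc_eqI:
  assumes P: "poly_approx P M f" and M: "norm a \<le> M" and a: "star a = (a::'a::cstar_algebra)"
    and y: "(\<lambda>k. poly_at (P k) a) \<longlonglongrightarrow> y"
  shows "cfc f a = y"
  unfolding cfc_def
proof (rule the_equality)
  show "\<exists>P. (\<forall>k. coeff (P k) 0 = 0) \<and>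
      uniform_limit {- norm a..norm a} (\<lambda>k. poly (P k)) f sequentially \<and>
      (\<lambda>k. poly_at (P k) a) \<longlonglongrightarrow> y"
    using poly_approx_mono[OF P M] y by (auto simp: poly_approx_def)
next
  fix z assume "\<exists>P. (\<forall>k. coeff (P k) 0 = 0) \<and>
      uniform_limit {- norm a..norm a} (\<lambda>k. poly (P k)) f sequentially \<and>
      (\<lambda>k. poly_at (P k) a) \<longlonglongrightarrow> z"
  then obtain Q where Q: "poly_approx Q (norm a) f" "(\<lambda>k. poly_at (Q k) a) \<longlonglongrightarrow> z"
    by (auto simp: poly_approx_def)
  have "(\<lambda>k. poly_at (Q k - P k) a) \<longlonglongrightarrow> z - y"
    using tendsto_diff[OF Q(2) y] P Q(1) by (simp add: poly_at_diff poly_approx_def)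
  then have "norm (z - y) \<le> 0"
    by (rule poly_approx_le[OF poly_approx_diff[OF Q(1) poly_approx_mono[OF P M]] order_refl a, rotated]) simp
  then show "z = y" by simp
qed

lemma cfc_tendsto:
  assumes P: "poly_approx P M f" and M: "norm a \<le> M" and a: "star a = (a::'a::cstar_algebra)"
  shows "(\<lambda>k. poly_at (P k) a) \<longlonglongrightarrow> cfc f a"
proof -
  have "Cauchy (\<lambda>k. poly_at (P k) a)"
  proof (rule CauchyI)
    fix e :: real assume e: "e > 0"
    have "\<forall>\<^sub>F k in sequentially. \<forall>t\<in>{-M..M}. dist (poly (P k) t) (f t) < e / 4"
      using P e by (auto simp: poly_approx_def uniform_limit_iff dest!: spec[of _ "e / 4"])
    then obtain n where n: "\<And>k t. k \<ge> n \<Longrightarrow> t \<in> {-M..M} \<Longrightarrow> dist (poly (P k) t) (f t) < e / 4"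
      unfolding eventually_sequentially by blast
    have "norm (poly_at (P k) a - poly_at (P m) a) < e" if "k \<ge> n" "m \<ge> n" for k m
    proof -
      have "norm (poly_at (P k - P m) a) \<le> e / 2"
      proof (rule norm_poly_at_le[OF _ a])
        fix t assume t: "\<bar>t\<bar> \<le> norm a"
        have "t \<in> {-M..M}" using t M by auto
        then show "\<bar>poly (P k - P m) t\<bar> \<le> e / 2"
          using n[OF that(1), of t] n[OF that(2), of t] unfolding dist_real_def poly_diff by argo
      qed (use P in \<open>simp add: poly_approx_def\<close>)
      then show ?thesis using P e by (simp add: poly_at_diff poly_approx_def)
    qed
    then show "\<exists>n. \<forall>k\<ge>n. \<forall>m\<ge>n. norm (poly_at (P k) a - poly_at (P m) a) < e" by blast
  qed
  then obtain y where "(\<lambda>k. poly_at (P k) a) \<longlonglongrightarrow> y"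
    using Cauchy_convergent convergent_def by blast
  then show ?thesis using cfc_eqI[OF P M a] by simp
qed

lemma cfc_cong:
  assumes "\<And>t. \<bar>t\<bar> \<le> norm a \<Longrightarrow> f t = g t"
  shows "cfc f a = cfc g (a::'a::cstar_algebra)"
proof -
  have "uniform_limit {- norm a..norm a} h f F \<longleftrightarrow> uniform_limit {- norm a..norm a} h g F"
    for h :: "nat \<Rightarrow> real \<Rightarrow> real" and F
    by (rule uniform_limit_cong) (auto simp: assms abs_le_iff)
  then show ?thesis by (simp add: cfc_def)
qed

lemma norm_cfc_le:
  assumes f: "fc f" and a: "star a = (a::'a::cstar_algebra)"
    and B: "\<And>t. \<bar>t\<bar> \<le> norm a \<Longrightarrow> \<bar>f t\<bar> \<le> B"
  shows "norm (cfc f a) \<le> B"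
proof -
  obtain P where P: "poly_approx P (norm a) f" using poly_approx_exists[OF f norm_ge_zero] .
  show ?thesis by (rule poly_approx_le[OF P order_refl a B cfc_tendsto[OF P order_refl a]])
qed

lemma star_cfc:
  assumes f: "fc f" and a: "star a = (a::'a::cstar_algebra)"
  shows "star (cfc f a) = cfc f a"
proof -
  obtain P where P: "poly_approx P (norm a) f" using poly_approx_exists[OF f norm_ge_zero] .
  have "(\<lambda>k. star (poly_at (P k) a)) \<longlonglongrightarrow> star (cfc f a)"
    by (intro tendsto_star cfc_tendsto[OF P order_refl a])
  then show ?thesis
    using cfc_tendsto[OF P order_refl a] P a
    by (simp add: star_poly_at poly_approx_def LIMSEQ_unique)
qed

lemma cfc_add:
  assumes f: "fc f" and g: "fc g" and a: "star a = (a::'a::cstar_algebra)"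
  shows "cfc (\<lambda>t. f t + g t) a = cfc f a + cfc g a"
proof -
  obtain P where P: "poly_approx P (norm a) f" using poly_approx_exists[OF f norm_ge_zero] .
  obtain Q where Q: "poly_approx Q (norm a) g" using poly_approx_exists[OF g norm_ge_zero] .
  have "poly_approx (\<lambda>k. P k + Q k) (norm a) (\<lambda>t. f t + g t)"
    using P Q by (auto simp: poly_approx_def poly_fun_simps intro: uniform_limit_add)
  then show ?thesis
  proof (rule cfc_eqI[OF _ order_refl a])
    show "(\<lambda>k. poly_at (P k + Q k) a) \<longlonglongrightarrow> cfc f a + cfc g a"
      using tendsto_add[OF cfc_tendsto[OF P order_refl a] cfc_tendsto[OF Q order_refl a]] P Q
      by (simp add: poly_at_add poly_approx_def)
  qed
qed

lemma cfc_mult: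
  assumes f: "fc f" and g: "fc g" and a: "star a = (a::'a::cstar_algebra)"
  shows "cfc (\<lambda>t. f t * g t) a = cfc f a * cfc g a"
proof -
  obtain P where P: "poly_approx P (norm a) f" using poly_approx_exists[OF f norm_ge_zero] .
  obtain Q where Q: "poly_approx Q (norm a) g" using poly_approx_exists[OF g norm_ge_zero] .
  have bd: "bounded (h ` {-norm a..norm a})" if "fc h" for h
    using that by (intro compact_imp_bounded compact_continuous_image)
      (auto simp: fc_def intro: continuous_on_subset)
  have "uniform_limit {-norm a..norm a} (\<lambda>k t. poly (P k) t * poly (Q k) t) (\<lambda>t. f t * g t) sequentially"
    using P Q by (intro uniform_lim_mult bd f g) (auto simp: poly_approx_def)
  then have "poly_approx (\<lambda>k. P k * Q k) (norm a) (\<lambda>t. f t * g t)"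
    using P Q by (auto simp: poly_approx_def poly_fun_simps coeff_mult_0)
  then show ?thesis
  proof (rule cfc_eqI[OF _ order_refl a])
    show "(\<lambda>k. poly_at (P k * Q k) a) \<longlonglongrightarrow> cfc f a * cfc g a"
      using tendsto_mult[OF cfc_tendsto[OF P order_refl a] cfc_tendsto[OF Q order_refl a]] P Q
      by (simp add: poly_at_mult poly_approx_def)
  qed
qed

lemma cfc_poly:
  assumes "coeff P 0 = 0" "star a = (a::'a::cstar_algebra)"
  shows "cfc (poly P) a = poly_at P a"
  by (rule cfc_eqI[of "\<lambda>_. P" "norm a"]) (auto simp: poly_approx_def assms intro: uniform_limit_const)

lemma poly_at_x: "poly_at [:0, 1:] a = a"
  by (simp add: poly_at_def)

lemma poly_at_0 [simp]: "poly_at 0 a = 0"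
  by (simp add: poly_at_def)

lemma cfc_id: "star a = (a::'a::cstar_algebra) \<Longrightarrow> cfc (\<lambda>t. t) a = a"
  using cfc_poly[of "[:0, 1:]" a] by (simp add: poly_at_x poly_fun_simps del: poly_pCons)

lemma cfc_zero_fun: "star a = (a::'a::cstar_algebra) \<Longrightarrow> cfc (\<lambda>t. 0) a = 0"
  using cfc_poly[of 0 a] by (simp add: poly_fun_simps del: poly_0)

lemma fc_const_mult: "fc f \<Longrightarrow> fc (\<lambda>t. c * f t)"
  by (auto simp: fc_def intro!: continuous_intros)

lemma cfc_scale:
  assumes f: "fc f" and a: "star a = (a::'a::cstar_algebra)"
  shows "cfc (\<lambda>t. c * f t) a = c *\<^sub>R cfc f a"
proof -
  obtain P where P: "poly_approx P (norm a) f" using poly_approx_exists[OF f norm_ge_zero] .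
  have "uniform_limit {-norm a..norm a} (\<lambda>k t. c *\<^sub>R poly (P k) t) (\<lambda>t. c *\<^sub>R f t) sequentially"
    using P by (intro bounded_linear.uniform_limit[OF bounded_linear_scaleR_right]) (simp add: poly_approx_def)
  then have "poly_approx (\<lambda>k. smult c (P k)) (norm a) (\<lambda>t. c * f t)"
    using P by (auto simp: poly_approx_def poly_fun_simps)
  then show ?thesis
  proof (rule cfc_eqI[OF _ order_refl a])
    show "(\<lambda>k. poly_at (smult c (P k)) a) \<longlonglongrightarrow> c *\<^sub>R cfc f a"
      using tendsto_scaleR[OF tendsto_const cfc_tendsto[OF P order_refl a], of c] P
      by (simp add: poly_at_smult poly_approx_def)
  qed
qed

lemma cfc_diff:
  assumes f: "fc f" and g: "fc g" and a: "star a = (a::'a::cstar_algebra)"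
  shows "cfc (\<lambda>t. f t - g t) a = cfc f a - cfc g a"
  using cfc_add[OF f fc_const_mult[OF g, of "-1"] a] cfc_scale[OF g a, of "-1"] by simp

lemma cfc_compose:
  assumes f: "fc f" and g: "fc g" and a: "star a = (a::'a::cstar_algebra)"
  shows "cfc g (cfc f a) = cfc (\<lambda>t. g (f t)) a"
proof -
  let ?c = "cfc f a"
  have c: "star ?c = ?c" by (rule star_cfc[OF f a])
  have gf: "fc (\<lambda>t. g (f t))"
    using f g by (auto simp: fc_def intro: continuous_on_compose2)
  have poly: "poly_at P ?c = cfc (\<lambda>t. poly P (f t)) a \<and> fc (\<lambda>t. poly P (f t))" if P: "coeff P 0 = 0" for P
  proof -
    obtain Q where Q: "P = pCons 0 Q" using P by (rule coeff_0_eq_0_cases)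
    have "opoly Q ((*) ?c) ?c = cfc (\<lambda>t. f t * poly Q (f t)) a \<and> fc (\<lambda>t. f t * poly Q (f t))"
    proof (induction Q)
      case 0
      then show ?case using cfc_zero_fun[OF a] by (simp add: fc_def)
    next
      case (pCons r Q)
      have "(\<lambda>t. f t * poly (pCons r Q) (f t)) = (\<lambda>t. r * f t + f t * (f t * poly Q (f t)))"
        by (simp add: fun_eq_iff algebra_simps)
      moreover have "fc (\<lambda>t. f t * (f t * poly Q (f t)))"
        using f by (auto simp: fc_def intro!: continuous_intros)
      moreover have "fc (\<lambda>t. r * f t + f t * (f t * poly Q (f t)))"
        using f by (auto simp: fc_def intro!: continuous_intros)
      ultimately show ?case
        using pCons.IH f a by (simp add: opoly_pCons linear_mult_left cfc_add fc_const_mult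
            cfc_scale cfc_mult)
    qed
    then show ?thesis by (simp add: Q poly_at_pCons)
  qed
  have cf: "continuous_on {-norm a..norm a} f" using f continuous_on_subset by (auto simp: fc_def)
  obtain B where B: "\<And>t. t \<in> {-norm a..norm a} \<Longrightarrow> \<bar>f t\<bar> \<le> B"
    using compact_imp_bounded[OF compact_continuous_image[OF cf compact_Icc]]
    unfolding bounded_iff by (metis imageI real_norm_def)
  \<comment> \<open>The polynomials for g must be accurate on the values of f, for the right side,
    and on the interval belonging to f(a), for the left side.\<close>
  define M where "M = max B (norm ?c)"
  have "0 \<le> M" by (simp add: M_def le_max_iff_disj)
  then obtain P where P: "poly_approx P M g" using poly_approx_exists[OF g] by blast
  have lim1: "(\<lambda>k. poly_at (P k) ?c) \<longlonglongrightarrow> cfc g ?c"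
    by (rule cfc_tendsto[OF P _ c]) (simp add: M_def)
  have "(\<lambda>k. poly_at (P k) ?c) \<longlonglongrightarrow> cfc (\<lambda>t. g (f t)) a"
  proof (rule tendstoI)
    fix e :: real assume e: "e > 0"
    then have "\<forall>\<^sub>F k in sequentially. \<forall>t\<in>{-M..M}. dist (poly (P k) t) (g t) < e / 2"
      using P by (auto simp: poly_approx_def uniform_limit_iff dest!: spec[of _ "e / 2"])
    then show "\<forall>\<^sub>F k in sequentially. dist (poly_at (P k) ?c) (cfc (\<lambda>t. g (f t)) a) < e"
    proof eventually_elim
      case (elim k)
      have 0: "coeff (P k) 0 = 0" using P by (simp add: poly_approx_def)
      have "poly_at (P k) ?c - cfc (\<lambda>t. g (f t)) a = cfc (\<lambda>t. poly (P k) (f t) - g (f t)) a"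
        using poly[OF 0] gf a by (simp add: cfc_diff)
      also have "norm \<dots> \<le> e / 2"
      proof (rule norm_cfc_le[OF _ a])
        show "fc (\<lambda>t. poly (P k) (f t) - g (f t))"
          using poly[OF 0] gf by (auto simp: fc_def intro: continuous_on_diff)
        fix t assume "\<bar>t\<bar> \<le> norm a"
        then have "\<bar>f t\<bar> \<le> B" by (intro B) auto
        then have "f t \<in> {-M..M}" by (auto simp: M_def)
        then show "\<bar>poly (P k) (f t) - g (f t)\<bar> \<le> e / 2" using elim by (auto simp: dist_real_def less_imp_le)
      qed
      finally show ?case using e by (simp add: dist_norm)
    qed
  qed
  then show ?thesis using lim1 LIMSEQ_unique by blast
qed

text \<open>A convergent sequence is bounded, so a single polynomial is uniformly close to f at all
  x n and at the limit, and polynomials are continuous.\<close>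

lemma tendsto_cfc:
  assumes f: "fc f" and a: "\<And>n. star (x n) = x n" and x: "x \<longlonglongrightarrow> (a::'a::cstar_algebra)"
  shows "(\<lambda>n. cfc f (x n)) \<longlonglongrightarrow> cfc f a"
proof -
  have sa: "star a = a" using tendsto_star[OF x] x a by (simp add: LIMSEQ_unique)
  obtain M where M: "\<And>n. norm (x n) \<le> M"
    using convergent_imp_Bseq[of x] x by (auto simp: convergent_def Bseq_def)
  have Ma: "norm a \<le> M"
    using tendsto_upperbound[OF tendsto_norm[OF x], of M] M by auto
  have M0: "0 \<le> M" using order_trans[OF norm_ge_zero Ma] .
  obtain P where P: "poly_approx P M f" using poly_approx_exists[OF f M0] by blast
  show ?thesis
  proof (rule tendstoI)
    fix e :: real assume e: "e > 0"
    then have "\<forall>\<^sub>F k in sequentially. \<forall>t\<in>{-M..M}. dist (poly (P k) t) (f t) < e / 3"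
      using P by (auto simp: poly_approx_def uniform_limit_iff dest!: spec[of _ "e / 3"])
    then obtain k where k: "\<And>t. t \<in> {-M..M} \<Longrightarrow> dist (poly (P k) t) (f t) < e / 3"
      using eventually_happens'[OF sequentially_bot] by blast
    have 0: "coeff (P k) 0 = 0" using P by (simp add: poly_approx_def)
    have pf: "fc (poly (P k))" using 0 by (auto simp: fc_def poly_0_coeff_0 intro: continuous_intros)
    have near: "norm (poly_at (P k) y - cfc f y) \<le> e / 3" if y: "star y = y" "norm y \<le> M" for y :: 'a
    proof -
      have "poly_at (P k) y - cfc f y = cfc (\<lambda>t. poly (P k) t - f t) y"
        using cfc_diff[OF pf f y(1)] cfc_poly[OF 0 y(1)] by simp
      also have "norm \<dots> \<le> e / 3"
      proof (rule norm_cfc_le[OF _ y(1)])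
        show "fc (\<lambda>t. poly (P k) t - f t)" using pf f by (auto simp: fc_def intro: continuous_on_diff)
        fix t assume "\<bar>t\<bar> \<le> norm y"
        then have "t \<in> {-M..M}" using y(2) by auto
        then show "\<bar>poly (P k) t - f t\<bar> \<le> e / 3" using k by (auto simp: dist_real_def less_imp_le)
      qed
      finally show ?thesis .
    qed
    have pc: "(\<lambda>n. poly_at Q (x n)) \<longlonglongrightarrow> poly_at Q a" for Q
    proof -
      have "(\<lambda>n. ((*) (x n) ^^ i) (x n)) \<longlonglongrightarrow> ((*) a ^^ i) a" for i
        by (induction i) (auto intro: x tendsto_mult)
      then show ?thesis unfolding poly_at_def by (intro tendsto_sum tendsto_scaleR tendsto_const)
    qed
    then have "\<forall>\<^sub>F n in sequentially. dist (poly_at (P k) (x n)) (poly_at (P k) a) < e / 3"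
      using e by (intro tendstoD) auto
    then show "\<forall>\<^sub>F n in sequentially. dist (cfc f (x n)) (cfc f a) < e"
    proof eventually_elim
      case (elim n)
      show ?case
        using near[OF a M, of n] near[OF sa Ma] elim
          dist_triangle3[of "cfc f (x n)" "cfc f a" "poly_at (P k) (x n)"]
          dist_triangle[of "poly_at (P k) (x n)" "cfc f a" "poly_at (P k) a"]
        by (simp add: dist_norm)
    qed
  qed
qed

lemma poly_at_intertwine:
  assumes "coeff P 0 = 0" "a * y = y * (b::'a::cstar_algebra)"
  shows "poly_at P a * y = y * poly_at P b"
proof -
  obtain Q where Q: "P = pCons 0 Q" using assms(1) by (rule coeff_0_eq_0_cases)
  have "opoly Q ((*) a) (a * y) = y * opoly Q ((*) b) b"
  proof (induction Q)
    case (pCons c Q)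
    have "a * (y * z) = y * (b * z)" for z using assms(2) by (metis mult.assoc)
    then show ?case using pCons assms(2)
      by (simp add: opoly_pCons linear_mult_left distrib_left)
  qed simp
  then show ?thesis by (simp add: Q poly_at_pCons opoly_mult_right)
qed

text \<open>Meant for a = y * star y and b = star y * y.\<close>

lemma cfc_intertwine:
  assumes f: "fc f" and a: "star a = a" and b: "star b = b" and y: "a * y = y * (b::'a::cstar_algebra)"
  shows "cfc f a * y = y * cfc f b"
proof -
  define M where "M = max (norm a) (norm b)"
  have "0 \<le> M" by (simp add: M_def le_max_iff_disj)
  then obtain P where P: "poly_approx P M f" using poly_approx_exists[OF f] by blast
  have "(\<lambda>k. poly_at (P k) a * y) \<longlonglongrightarrow> cfc f a * y"
    by (intro tendsto_mult tendsto_const cfc_tendsto[OF P _ a]) (simp add: M_def)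
  moreover have "(\<lambda>k. y * poly_at (P k) b) \<longlonglongrightarrow> y * cfc f b"
    by (intro tendsto_mult tendsto_const cfc_tendsto[OF P _ b]) (simp add: M_def)
  moreover have "poly_at (P k) a * y = y * poly_at (P k) b" for k
    by (rule poly_at_intertwine[OF _ y]) (use P in \<open>simp add: poly_approx_def\<close>)
  ultimately show ?thesis by (simp add: LIMSEQ_unique)
qed

text \<open>The approximating polynomials have no constant term, so each of their monomials ends in
  a factor a, which absorbs q.\<close>

lemma cfc_mult_right_unit:
  assumes f: "fc f" and a: "star a = a" and q: "a * q = (a::'a::cstar_algebra)"
  shows "cfc f a * q = cfc f a"
proof -
  obtain P where P: "poly_approx P (norm a) f" using poly_approx_exists[OF f norm_ge_zero] .
  have "poly_at (P k) a * q = poly_at (P k) a" for k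
  proof -
    obtain Q where Q: "P k = pCons 0 Q" using P coeff_0_eq_0_cases[of "P k"] by (auto simp: poly_approx_def)
    show ?thesis by (simp add: Q poly_at_pCons opoly_mult_right q)
  qed
  then have "(\<lambda>k. poly_at (P k) a) \<longlonglongrightarrow> cfc f a * q"
    using tendsto_mult[OF cfc_tendsto[OF P order_refl a] tendsto_const, of q] by simp
  then show ?thesis using cfc_tendsto[OF P order_refl a] LIMSEQ_unique by blast
qed

lemma cfc_eigen:
  assumes f: "fc f" and a: "star a = a" and y: "a * y = \<alpha> *\<^sub>R (y::'a::cstar_algebra)"
  shows "cfc f a * y = f \<alpha> *\<^sub>R y"
proof -
  \<comment> \<open>If y = 0 then \<alpha> is arbitrary, so the interval is enlarged to contain
    it.\<close>
  define M where "M = max (norm a) \<bar>\<alpha>\<bar>"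
  have "0 \<le> M" by (simp add: M_def le_max_iff_disj)
  then obtain P where P: "poly_approx P M f" using poly_approx_exists[OF f] by blast
  have "(\<lambda>k. poly_at (P k) a * y) \<longlonglongrightarrow> cfc f a * y"
    by (intro tendsto_mult tendsto_const cfc_tendsto[OF P _ a]) (simp add: M_def)
  moreover have "poly_at (P k) a * y = poly (P k) \<alpha> *\<^sub>R y" for k
  proof -
    obtain Q where Q: "P k = pCons 0 Q" using P coeff_0_eq_0_cases[of "P k"] by (auto simp: poly_approx_def)
    have "opoly Q ((*) a) (a * y) = (\<alpha> * poly Q \<alpha>) *\<^sub>R y"
      by (induction Q) (simp_all add: opoly_pCons linear_mult_left y algebra_simps)
    then show ?thesis by (simp add: Q poly_at_pCons opoly_mult_right)
  qed
  moreover have "(\<lambda>k. poly (P k) \<alpha>) \<longlonglongrightarrow> f \<alpha>"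
    using P by (intro tendsto_uniform_limitI[where S="{-M..M}"]) (auto simp: poly_approx_def M_def)
  then have "(\<lambda>k. poly (P k) \<alpha> *\<^sub>R y) \<longlonglongrightarrow> f \<alpha> *\<^sub>R y"
    by (intro tendsto_scaleR tendsto_const)
  ultimately show ?thesis by (simp add: LIMSEQ_unique)
qed

section \<open>Positivity\<close>

lemma fc_simps [simp]:
  "fc (\<lambda>t. t)" "fc (\<lambda>t. 0)" "fc (\<lambda>t. max t 0)" "fc (\<lambda>t. max (- t) 0)" "fc sqrt"
  "0 \<le> s \<Longrightarrow> fc (\<lambda>t. max (t - s) 0)"
  by (auto simp: fc_def intro!: continuous_intros)

lemma fc_add: "fc f \<Longrightarrow> fc g \<Longrightarrow> fc (\<lambda>t. f t + g t)"
  and fc_diff: "fc f \<Longrightarrow> fc g \<Longrightarrow> fc (\<lambda>t. f t - g t)"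
  and fc_mult: "fc f \<Longrightarrow> fc g \<Longrightarrow> fc (\<lambda>t. f t * g t)"
  and fc_comp: "fc f \<Longrightarrow> fc g \<Longrightarrow> fc (\<lambda>t. g (f t))"
  by (auto simp: fc_def intro: continuous_on_compose2 intro!: continuous_intros)

text \<open>For squares of self-adjoint elements the calculus is at hand at once. That they exhaust
  the elements \<open>star y * y\<close> is the hard point, settled in \<open>spos_star_mult\<close>
  and \<open>Pos_iff_spos\<close>.\<close>

definition spos :: "'a::cstar_algebra \<Rightarrow> bool" where
  "spos h \<longleftrightarrow> (\<exists>k. star k = k \<and> h = k * k)"

lemma spos_sa: "spos h \<Longrightarrow> star h = h"
  by (auto simp: spos_def star_mult)

text \<open>The operator form of 0 \<le> r - t \<le> r on the spectrum. Together with its converse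
  \<open>spos_if_bound\<close> it makes positivity stable under sums and limits by the triangle
  inequality.\<close>

lemma spos_bound:
  assumes "spos h" "norm h \<le> r"
  shows "norm (r *\<^sub>R x - h * x) \<le> r * norm x"
proof -
  obtain k where k: "star k = k" "h = k * k" using assms(1) by (auto simp: spos_def)
  have "norm (opoly [:r, 0, -1:] ((*) k) x) \<le> r * norm x"
  proof (rule norm_opoly_le[OF k(1)])
    fix t assume "\<bar>t\<bar> \<le> norm k"
    then have "t\<^sup>2 \<le> (norm k)\<^sup>2" by (metis abs_ge_zero power2_abs power_mono)
    then show "\<bar>poly [:r, 0, - 1:] t\<bar> \<le> r"
      using assms(2) norm_sa_square[OF k(1)] k(2) zero_le_power2[of t] by (simp add: power2_eq_square abs_le_iff)
  qed
  then show ?thesis by (simp add: opoly_pCons linear_mult_left k(2) mult.assoc)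
qed

lemma spos_max: "star h = h \<Longrightarrow> spos (cfc (\<lambda>t. max t 0) (h::'a::cstar_algebra))"
  unfolding spos_def
proof (intro exI conjI)
  assume h: "star h = h"
  have f: "fc (\<lambda>t. sqrt (max t 0))" by (auto simp: fc_def intro!: continuous_intros)
  show "star (cfc (\<lambda>t. sqrt (max t 0)) h) = cfc (\<lambda>t. sqrt (max t 0)) h" by (rule star_cfc[OF f h])
  show "cfc (\<lambda>t. max t 0) h = cfc (\<lambda>t. sqrt (max t 0)) h * cfc (\<lambda>t. sqrt (max t 0)) h"
    by (subst cfc_mult[OF f f h, symmetric]) simp
qed

lemma cfc_pos_neg_parts:
  "star h = h \<Longrightarrow> (h::'a::cstar_algebra) = cfc (\<lambda>t. max t 0) h - cfc (\<lambda>t. max (- t) 0) h"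
proof -
  assume h: "star h = h"
  have "(\<lambda>t::real. max t 0 - max (- t) 0) = (\<lambda>t. t)" by (auto simp: fun_eq_iff)
  then show ?thesis using cfc_diff[of "\<lambda>t. max t 0" "\<lambda>t. max (-t) 0" h] h by (simp add: cfc_id)
qed

text \<open>For the negative part \<open>y\<close> of \<open>h\<close> one has \<open>(r - h) y = r y + y\<^sup>2\<close>, whose norm would
  exceed \<open>r \<parallel>y\<parallel>\<close> unless \<open>y = 0\<close>.\<close>

lemma spos_if_bound:
  assumes h: "star h = (h::'a::cstar_algebra)" and r: "r > 0"
    and bd: "\<And>x. norm (r *\<^sub>R x - h * x) \<le> r * norm x"
  shows "spos h"
proof -
  let ?n = "\<lambda>t::real. max (- t) 0"
  define y where "y = cfc ?n h"
  define m where "m = norm y"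
  \<comment> \<open>The inverse of n \<mapsto> r n + n^2 on n \<ge> 0. Applying it to r y + y^2
    recovers y, so the bound on that element becomes a bound on norm y.\<close>
  define \<psi> where "\<psi> u = (sqrt (r\<^sup>2 + 4 * \<bar>u\<bar>) - r) / 2" for u
  have fn: "fc ?n" by simp
  have F: "fc (\<lambda>t. r * ?n t + ?n t * ?n t)" by (intro fc_add fc_const_mult fc_mult fn)
  have p: "fc \<psi>" using r by (auto simp: fc_def \<psi>_def intro!: continuous_intros)
  have "r *\<^sub>R y - h * y = cfc (\<lambda>t. r * ?n t - t * ?n t) h"
    unfolding y_def using h fn
    by (simp add: cfc_diff fc_const_mult fc_mult cfc_mult cfc_scale cfc_id)
  also have "(\<lambda>t. r * ?n t - t * ?n t) = (\<lambda>t. r * ?n t + ?n t * ?n t)"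
    by (auto simp: fun_eq_iff max_def)
  finally have nF: "norm (cfc (\<lambda>t. r * ?n t + ?n t * ?n t) h) \<le> r * m"
    using bd[of y] by (simp add: m_def)
  have psi: "\<psi> (r * ?n t + ?n t * ?n t) = ?n t" for t
  proof -
    have "r\<^sup>2 + 4 * \<bar>r * ?n t + ?n t * ?n t\<bar> = (r + 2 * ?n t)\<^sup>2"
      using r by (subst abs_of_nonneg) (auto simp: power2_eq_square algebra_simps)
    then show ?thesis using r by (simp add: \<psi>_def)
  qed
  have "y = cfc \<psi> (cfc (\<lambda>t. r * ?n t + ?n t * ?n t) h)"
    by (simp add: cfc_compose[OF F p h] psi y_def)
  also have "norm \<dots> \<le> \<psi> (r * m)"
  proof (rule norm_cfc_le[OF p star_cfc[OF F h]])
    fix u assume "\<bar>u\<bar> \<le> norm (cfc (\<lambda>t. r * ?n t + ?n t * ?n t) h)"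
    then have u: "\<bar>u\<bar> \<le> \<bar>r * m\<bar>" using nF by linarith
    have "r \<le> sqrt (r\<^sup>2 + 4 * \<bar>u\<bar>)" using r by (intro real_le_rsqrt) simp
    moreover have "sqrt (r\<^sup>2 + 4 * \<bar>u\<bar>) \<le> sqrt (r\<^sup>2 + 4 * \<bar>r * m\<bar>)" using u by simp
    ultimately show "\<bar>\<psi> u\<bar> \<le> \<psi> (r * m)" by (simp add: \<psi>_def)
  qed
  finally have "r + 2 * m \<le> sqrt (r\<^sup>2 + 4 * (r * m))"
    using r by (simp add: \<psi>_def m_def)
  then have "(r + 2 * m)\<^sup>2 \<le> r\<^sup>2 + 4 * (r * m)"
    using r by (metis abs_ge_self m_def norm_ge_zero add_nonneg_nonneg mult_nonneg_nonneg
        less_imp_le power_mono real_sqrt_pow2 zero_le_numeral zero_le_power2)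
  then have "m * m \<le> 0" by (simp add: power2_eq_square algebra_simps)
  then have "y = 0" by (auto simp: m_def mult_le_0_iff)
  then show ?thesis using cfc_pos_neg_parts[OF h] spos_max[OF h] by (simp add: y_def)
qed

lemma spos_add: "spos h \<Longrightarrow> spos k \<Longrightarrow> spos (h + k)"
proof -
  assume hk: "spos h" "spos k"
  show ?thesis
  proof (rule spos_if_bound)
    show "star (h + k) = h + k" using hk by (simp add: star_add spos_sa)
    show "0 < (norm h + 1) + (norm k + 1)"
      using norm_ge_zero[of h] norm_ge_zero[of k] by linarith
    fix x
    show "norm ((norm h + 1 + (norm k + 1)) *\<^sub>R x - (h + k) * x) \<le> (norm h + 1 + (norm k + 1)) * norm x"
      using spos_bound[OF hk(1), of "norm h + 1" x] spos_bound[OF hk(2), of "norm k + 1" x]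
        norm_triangle_ineq[of "(norm h + 1) *\<^sub>R x - h * x" "(norm k + 1) *\<^sub>R x - k * x"]
      by (simp add: algebra_simps scaleR_2)
  qed
qed

lemma spos_limit:
  assumes x: "\<And>n. spos (x n)" "x \<longlonglongrightarrow> h"
  shows "spos h"
proof -
  obtain M where M: "\<And>n. norm (x n) \<le> M" "M > 0"
    using convergent_imp_Bseq[of x] x by (auto simp: convergent_def Bseq_def)
  show ?thesis
  proof (rule spos_if_bound[OF _ M(2)])
    show "star h = h" using tendsto_star[OF x(2)] x by (simp add: spos_sa LIMSEQ_unique)
    fix y
    have "(\<lambda>n. norm (M *\<^sub>R y - x n * y)) \<longlonglongrightarrow> norm (M *\<^sub>R y - h * y)"
      by (intro tendsto_norm tendsto_diff tendsto_const tendsto_mult x)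
    then show "norm (M *\<^sub>R y - h * y) \<le> M * norm y"
      by (rule tendsto_upperbound) (use spos_bound[OF x(1) M(1)] in auto)
  qed
qed

lemma spos_cfc:
  assumes h: "star h = h" and f: "fc f" "\<And>t. 0 \<le> f t"
  shows "spos (cfc f (h::'a::cstar_algebra))"
proof -
  have "cfc f h = cfc (\<lambda>t. max t 0) (cfc f h)"
    by (simp add: cfc_compose[OF f(1) _ h] f(2) max_absorb1)
  then show ?thesis using spos_max[OF star_cfc[OF f(1) h]] by simp
qed

lemma spos_cfc_square:
  assumes "star k = (k::'a::cstar_algebra)" "fc f"
  shows "cfc f (k * k) = cfc (\<lambda>t. f (t * t)) k"
  using cfc_compose[OF _ assms(2,1), of "\<lambda>t. t * t"] assms(1)
  by (simp add: cfc_mult cfc_id fc_mult)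

text \<open>A substitute for a nonnegative spectrum: if h = k^2, then f(h) is t \<mapsto> f(t^2)
  applied to k, which sees only nonnegative arguments of f.\<close>

lemma spos_cfc_cong:
  assumes h: "spos h" and f: "fc f" and g: "fc g" and fg: "\<And>t. 0 \<le> t \<Longrightarrow> f t = g t"
  shows "cfc f h = cfc g h"
proof -
  obtain k where k: "star k = k" "h = k * k" using h by (auto simp: spos_def)
  show ?thesis by (simp add: k spos_cfc_square f g fg)
qed

lemma cfc_scaled_neg:
  assumes "star h = (h::'a::cstar_algebra)" "fc f"
  shows "cfc f (- h) = cfc (\<lambda>t. f (- t)) h"
proof -
  have "cfc uminus h = - h" using cfc_scale[of "\<lambda>t. t" h "-1"] assms(1) by (simp add: cfc_id)
  then show ?thesis
    using cfc_compose[OF fc_const_mult[of "\<lambda>t. t" "-1"] assms(2,1)] by simp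
qed

lemma spos_neg_eq_0:
  assumes "spos h" "spos (- h)"
  shows "h = 0"
proof -
  have h: "star h = h" using assms by (simp add: spos_sa)
  have "cfc (\<lambda>t. max (- t) 0) h = cfc (\<lambda>t. 0) h"
    by (rule spos_cfc_cong[OF assms(1)]) auto
  moreover have "cfc (\<lambda>t. max (- t) 0) (- h) = cfc (\<lambda>t. 0) (- h)"
    by (rule spos_cfc_cong[OF assms(2)]) auto
  ultimately show ?thesis
    using cfc_pos_neg_parts[OF h] h by (simp add: cfc_scaled_neg cfc_zero_fun)
qed

text \<open>With s and d twice the real part and, up to sign, twice the imaginary part of y, the
  element is (s^2 + d^2) / 2.\<close>

lemma spos_sum_star:
  "spos (star y * y + y * star (y::'a::cstar_algebra))"
proof -
  define s where "s = y + star y"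
  define d where "d = \<i> *\<^sub>C (y - star y)"
  have "star s = s" by (simp add: s_def star_add star_star add.commute)
  moreover have "star d = d"
    by (simp add: d_def star_scaleC star_diff star_star scaleC_minus_left scaleC_diff_right)
  ultimately have "spos (s * s + d * d)" by (intro spos_add) (auto simp: spos_def)
  moreover have "\<i> *\<^sub>C \<i> *\<^sub>C z = - z" for z :: 'a
    by (simp add: scaleC_scaleC scaleC_minus_left scaleC_one)
  then have "s * s + d * d = 2 *\<^sub>R (star y * y + y * star y)"
    by (simp add: s_def d_def mult_scaleC_left mult_scaleC_right algebra_simps scaleR_2 scaleC_diff_right)
  ultimately obtain k where "star k = k" "2 *\<^sub>R (star y * y + y * star y) = k * k" by (auto simp: spos_def)
  have "(sqrt (1/2) *\<^sub>R k) * (sqrt (1/2) *\<^sub>R k) = (sqrt (1/2) * sqrt (1/2)) *\<^sub>R (k * k)" by simp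
  also have "\<dots> = star y * y + y * star y"
    using \<open>2 *\<^sub>R _ = k * k\<close> by (metis real_sqrt_mult_self abs_of_nonneg zero_le_divide_1_iff zero_le_numeral
        scaleR_half_double scaleR_2 scaleR_scaleR nonzero_eq_divide_eq zero_neq_numeral scaleR_one)
  finally have "star y * y + y * star y = (sqrt (1/2) *\<^sub>R k) * (sqrt (1/2) *\<^sub>R k)" ..
  then show ?thesis unfolding spos_def using \<open>star k = k\<close>
    by (intro exI[of _ "sqrt (1/2) *\<^sub>R k"]) (simp add: star_scaleR)
qed

text \<open>If \<open>- y\<^sup>* y\<close> is positive then so is \<open>y y\<^sup>*\<close>, and since \<open>y (y\<^sup>* y) = (y y\<^sup>*) y\<close>, applying the
  negative part to both sides gives \<open>y (y\<^sup>* y) = 0\<close>.\<close>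

lemma star_mult_neg_spos:
  assumes "spos (- (star y * (y::'a::cstar_algebra)))"
  shows "y = 0"
proof -
  let ?n = "\<lambda>t::real. max (- t) 0"
  have "spos (star y * y + y * star y + - (star y * y))"
    by (intro spos_add spos_sum_star assms)
  then have pos: "spos (y * star y)" by simp
  have h: "star (star y * y) = star y * y" by (simp add: star_mult star_star)
  have g: "star (y * star y) = y * star y" by (simp add: star_mult star_star)
  have "cfc ?n (y * star y) * y = y * cfc ?n (star y * y)"
    by (rule cfc_intertwine[OF _ g h]) (auto simp: mult.assoc)
  moreover have "cfc ?n (y * star y) = cfc (\<lambda>t. 0) (y * star y)"
    by (rule spos_cfc_cong[OF pos]) auto
  moreover have "cfc ?n (star y * y) = - (star y * y)"
  proof -
    have "cfc ?n (star y * y) = cfc (\<lambda>t. max t 0) (- (star y * y))"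
      using cfc_scaled_neg[OF h, of "\<lambda>t. max t 0"] by simp
    also have "\<dots> = cfc (\<lambda>t. t) (- (star y * y))"
      by (rule spos_cfc_cong[OF assms]) auto
    finally show ?thesis by (simp add: cfc_id h)
  qed
  ultimately have "y * (star y * y) = 0" by (simp add: cfc_zero_fun g)
  then have "star (star y * y) * (star y * y) = 0" by (simp add: h mult.assoc)
  then show ?thesis by (simp add: star_mult_self_eq_0)
qed

text \<open>Let h = star x * x and let k be the square root of its negative part n. Then star (x k)
  * (x k) = k h k = - n^2, so x k = 0 by \<open>star_mult_neg_spos\<close>, and n = 0.\<close>

lemma spos_star_mult: "spos (star x * (x::'a::cstar_algebra))"
proof -
  let ?h = "star x * x" and ?n = "\<lambda>t::real. max (- t) 0"
  have h: "star ?h = ?h" by (simp add: star_mult star_star)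
  have f: "fc (\<lambda>t. sqrt (?n t))" by (auto simp: fc_def intro!: continuous_intros)
  define k where "k = cfc (\<lambda>t. sqrt (?n t)) ?h"
  have k: "star k = k" unfolding k_def by (rule star_cfc[OF f h])
  have "star (x * k) * (x * k) = k * (?h * k)"
    by (simp add: star_mult k mult.assoc)
  also have "\<dots> = cfc (\<lambda>t. sqrt (?n t) * (t * sqrt (?n t))) ?h"
    unfolding k_def using f h by (simp add: cfc_mult fc_mult cfc_id)
  also have "(\<lambda>t. sqrt (?n t) * (t * sqrt (?n t))) = (\<lambda>t. (-1) * (?n t * ?n t))"
  proof
    fix t
    have "sqrt (?n t) * (t * sqrt (?n t)) = t * (sqrt (?n t) * sqrt (?n t))" by (simp only: ac_simps)
    also have "\<dots> = t * ?n t" by (subst real_sqrt_mult_self) (simp only: abs_of_nonneg max.cobounded2)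
    also have "\<dots> = (-1) * (?n t * ?n t)" by (simp add: max_def)
    finally show "sqrt (?n t) * (t * sqrt (?n t)) = (-1) * (?n t * ?n t)" .
  qed
  also have "cfc \<dots> ?h = - (cfc ?n ?h * cfc ?n ?h)"
    using h by (subst cfc_scale) (auto simp: cfc_mult fc_mult)
  finally have eq: "star (x * k) * (x * k) = - (cfc ?n ?h * cfc ?n ?h)" .
  then have "spos (- (star (x * k) * (x * k)))"
    using star_cfc[of ?n ?h] h by (auto simp: spos_def)
  then have "x * k = 0" by (rule star_mult_neg_spos)
  then have "cfc ?n ?h * cfc ?n ?h = 0"
    using eq by simp
  then have "cfc ?n ?h = 0"
    using star_mult_self_eq_0[of "cfc ?n ?h"] star_cfc[of ?n ?h] h by simp
  then show ?thesis using cfc_pos_neg_parts[OF h] spos_max[OF h] by simp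
qed

lemma Pos_iff_spos: "h \<in> Pos \<longleftrightarrow> spos h"
proof
  assume "h \<in> Pos"
  then show "spos h" using spos_star_mult by (auto simp: Pos_def positive_cone_def)
next
  assume "spos h"
  then obtain k where "star k = k" "h = k * k" by (auto simp: spos_def)
  then have "h = star k * k" by simp
  then show "h \<in> Pos" unfolding Pos_def positive_cone_def by blast
qed

lemmas Pos_sa = spos_sa[folded Pos_iff_spos]
  and Pos_add = spos_add[folded Pos_iff_spos]
  and Pos_limit = spos_limit[folded Pos_iff_spos]
  and Pos_cfc = spos_cfc[folded Pos_iff_spos]
  and Pos_cfc_cong = spos_cfc_cong[folded Pos_iff_spos]
  and Pos_minus_eq_0 = spos_neg_eq_0[folded Pos_iff_spos]

lemma Pos_star_mult [simp]: "star x * x \<in> Pos" and Pos_mult_star [simp]: "x * star x \<in> Pos"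
  using spos_star_mult[of x] spos_star_mult[of "star x"] by (simp_all add: Pos_iff_spos star_star)

lemma Pos_square: "star k = k \<Longrightarrow> k * k \<in> Pos"
  using Pos_star_mult[of k] by simp

lemma Pos_zero [simp]: "0 \<in> Pos"
  using Pos_star_mult[of 0] by simp

lemma Pos_cfc_nonneg:
  assumes a: "a \<in> Pos" and f: "fc f" "\<And>t. 0 \<le> t \<Longrightarrow> 0 \<le> f t"
  shows "cfc f a \<in> Pos"
proof -
  have "cfc f a = cfc (\<lambda>t. f (max t 0)) a"
    by (rule Pos_cfc_cong[OF a f(1) fc_comp[OF fc_simps(3) f(1)]]) simp
  then show ?thesis using Pos_cfc[OF Pos_sa[OF a] fc_comp[OF fc_simps(3) f(1)]] f(2) by simp
qed

lemma Pos_scale: "h \<in> Pos \<Longrightarrow> 0 \<le> r \<Longrightarrow> r *\<^sub>R h \<in> Pos"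
  using Pos_cfc_nonneg[of h "\<lambda>t. r * t"] cfc_scale[of "\<lambda>t. t" h r]
  by (simp add: fc_const_mult Pos_sa cfc_id)

lemma Pos_sum: "(\<And>i. i \<in> I \<Longrightarrow> f i \<in> Pos) \<Longrightarrow> sum f I \<in> Pos"
  by (induction I rule: infinite_finite_induct) (auto intro: Pos_add)

lemma Pos_conj: "h \<in> Pos \<Longrightarrow> star x * h * x \<in> Pos"
proof -
  assume "h \<in> Pos"
  then obtain y where "h = star y * y" by (auto simp: Pos_def positive_cone_def)
  then have "star x * h * x = star (y * x) * (y * x)" by (simp add: star_mult mult.assoc)
  then show ?thesis by simp
qed

text \<open>\<open>sqrt\<close> is negative on negative reals; truncation makes the function
  nonnegative everywhere, so that \<open>Pos_cfc\<close> applies.\<close>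

definition psqrt :: "'a::cstar_algebra \<Rightarrow> 'a" where
  "psqrt h = cfc (\<lambda>t. sqrt (max t 0)) h"

lemma fc_sqrt_max [simp]: "fc (\<lambda>t. sqrt (max t 0))"
  by (auto simp: fc_def intro!: continuous_intros)

lemma psqrt: "h \<in> Pos \<Longrightarrow> psqrt h * psqrt h = h" "h \<in> Pos \<Longrightarrow> star (psqrt h) = psqrt h"
   "h \<in> Pos \<Longrightarrow> psqrt h \<in> Pos"
proof -
  assume h: "h \<in> Pos"
  have "psqrt h * psqrt h = cfc (\<lambda>t. max t 0) h"
    unfolding psqrt_def using Pos_sa[OF h] by (subst cfc_mult[symmetric]) auto
  also have "\<dots> = h" using Pos_cfc_cong[OF h, of "\<lambda>t. max t 0" "\<lambda>t. t"] Pos_sa[OF h] by (simp add: cfc_id)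
  finally show "psqrt h * psqrt h = h" .
qed (auto simp: psqrt_def intro!: star_cfc Pos_cfc intro: Pos_sa)

lemma cstar_le_trans: "x \<preceq> y \<Longrightarrow> y \<preceq> z \<Longrightarrow> x \<preceq> (z::'a::cstar_algebra)"
  unfolding cstar_le_def using Pos_add[of "y - x" "z - y"] by simp

lemma cstar_le_add: "x \<preceq> y \<Longrightarrow> u \<preceq> v \<Longrightarrow> x + u \<preceq> y + (v::'a::cstar_algebra)"
  unfolding cstar_le_def using Pos_add[of "y - x" "v - u"] by (simp add: algebra_simps)

lemma cstar_le_scale: "x \<preceq> y \<Longrightarrow> 0 \<le> r \<Longrightarrow> r *\<^sub>R x \<preceq> r *\<^sub>R (y::'a::cstar_algebra)"
  unfolding cstar_le_def using Pos_scale[of "y - x" r] by (simp add: scaleR_diff_right)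

lemma cstar_le_conj: "x \<preceq> y \<Longrightarrow> star z * x * z \<preceq> star z * y * (z::'a::cstar_algebra)"
  unfolding cstar_le_def using Pos_conj[of "y - x" z] by (simp add: algebra_simps)

lemma cstar_le_cfc:
  assumes a: "a \<in> Pos" and f: "fc f" and g: "fc g" and le: "\<And>t. 0 \<le> t \<Longrightarrow> f t \<le> g t"
  shows "cfc f a \<preceq> cfc g a"
  unfolding cstar_le_def using Pos_cfc_nonneg[OF a fc_diff[OF g f]] le
  by (simp add: cfc_diff[OF g f Pos_sa[OF a]])

text \<open>Multiplication by \<open>(m - v)\<^sup>1\<^sup>/\<^sup>2\<close> makes sense without a unit, because
  \<open>m\<^sup>1\<^sup>/\<^sup>2 - (m - t)\<^sup>1\<^sup>/\<^sup>2\<close> vanishes at \<open>0\<close>.\<close>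

lemma conj_le_norm:
  assumes v: "v \<in> Pos" and m: "norm v \<le> m"
  shows "star x * v * x \<preceq> m *\<^sub>R (star x * x)"
proof -
  have sv: "star v = v" using v by (rule Pos_sa)
  have m0: "0 \<le> m" using m norm_ge_zero order_trans by blast
  define g where "g t = sqrt m - sqrt (m - min t m)" for t
  have g: "fc g" using m0 by (auto simp: fc_def g_def intro!: continuous_intros)
  define w where "w = cfc g v"
  have sw: "star w = w" unfolding w_def by (rule star_cfc[OF g sv])
  have "2 * sqrt m * g t - g t * g t = min t m" for t
    using m0 by (cases "t \<le> m") (auto simp: g_def min_def algebra_simps)
  then have "(2 * sqrt m) *\<^sub>R w - w * w = cfc (\<lambda>t. min t m) v"
    unfolding w_def using g sv
    by (simp flip: cfc_scale cfc_mult cfc_diff add: fc_const_mult fc_mult)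
  also have "\<dots> = v"
    using cfc_cong[of v "\<lambda>t. min t m" "\<lambda>t. t"] m cfc_id[OF sv] by (auto simp: min_def)
  finally have w: "(2 * sqrt m) *\<^sub>R w - w * w = v" .
  define z where "z = sqrt m *\<^sub>R x - w * x"
  have two: "(2 * c) *\<^sub>R y = c *\<^sub>R y + c *\<^sub>R y" for c and y :: 'a
    by (simp add: scaleR_left_distrib[symmetric])
  have "star z * z = m *\<^sub>R (star x * x) - star x * ((2 * sqrt m) *\<^sub>R w - w * w) * x"
    using m0 by (simp add: z_def star_diff star_scaleR star_mult sw two left_diff_distrib right_diff_distrib
        distrib_left distrib_right scaleR_diff_right mult.assoc)
  then have "m *\<^sub>R (star x * x) - star x * v * x = star z * z" by (simp add: w)
  then show ?thesis by (simp add: cstar_le_def)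
qed

lemma norm_le_of_conj_le:
  assumes u: "u \<in> Pos" and m0: "0 \<le> m" and le: "\<And>x. star x * u * x \<preceq> m *\<^sub>R (star x * x)"
  shows "norm u \<le> m"
proof -
  have su: "star u = u" using u by (rule Pos_sa)
  \<comment> \<open>The test element k(u) lives where u exceeds m. There m k^2 - k u k = - z^2 with
    z = (u - m)_+, so the hypothesis forces z = 0.\<close>
  define k where "k t = sqrt (max (t - m) 0)" for t
  have k: "fc k" using m0 by (auto simp: fc_def k_def intro!: continuous_intros)
  define z where "z = cfc (\<lambda>t. max (t - m) 0) u"
  have fz: "fc (\<lambda>t. max (t - m) 0)" using m0 by simp
  have "m *\<^sub>R (star (cfc k u) * cfc k u) - star (cfc k u) * u * cfc k u
     = cfc (\<lambda>t. m * (k t * k t) - k t * t * k t) u"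
    using k su by (simp add: star_cfc cfc_diff cfc_scale cfc_mult fc_const_mult fc_mult cfc_id)
  also have "(\<lambda>t. m * (k t * k t) - k t * t * k t) = (\<lambda>t. (-1) * (max (t - m) 0 * max (t - m) 0))"
    by (auto simp: fun_eq_iff k_def max_def algebra_simps)
  also have "cfc \<dots> u = - (z * z)"
    unfolding z_def using fz su by (subst cfc_scale) (auto simp: cfc_mult fc_mult)
  finally have "- (z * z) \<in> Pos" using le[of "cfc k u"] by (simp add: cstar_le_def)
  moreover have sz: "star z = z" unfolding z_def by (rule star_cfc[OF fz su])
  ultimately have "z * z = 0" using Pos_minus_eq_0 Pos_square by blast
  then have "z = 0" using star_mult_self_eq_0[of z] sz by simp
  have "u = cfc (\<lambda>t. max t 0) u"
    using Pos_cfc_cong[OF u, of "\<lambda>t. max t 0" "\<lambda>t. t"] su by (simp add: cfc_id)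
  also have "(\<lambda>t::real. max t 0) = (\<lambda>t. (max t 0 - max (t - m) 0) + max (t - m) 0)" by simp
  also have "cfc \<dots> u = cfc (\<lambda>t. max t 0 - max (t - m) 0) u"
    using \<open>z = 0\<close> su fz by (subst cfc_add) (auto intro!: fc_diff simp: z_def)
  also have "norm \<dots> \<le> m"
  proof (rule norm_cfc_le[OF fc_diff[OF fc_simps(3) fz] su])
    show "\<bar>max t 0 - max (t - m) 0\<bar> \<le> m" for t using m0 by (simp add: max_def)
  qed
  finally show ?thesis .
qed

lemma norm_mono: "u \<in> Pos \<Longrightarrow> u \<preceq> v \<Longrightarrow> norm u \<le> norm v"
proof (rule norm_le_of_conj_le)
  assume u: "u \<in> Pos" "u \<preceq> v"
  then have "v \<in> Pos" using Pos_add[of u "v - u"] by (simp add: cstar_le_def)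
  then show "star x * u * x \<preceq> norm v *\<^sub>R (star x * x)" for x
    using cstar_le_trans[OF cstar_le_conj[OF u(2)] conj_le_norm] by blast
qed auto

text \<open>This is (1 - g) h (1 - g), multiplied out in the absence of a unit; the same expression
  stands for a compression everywhere below.\<close>

lemma Pos_compress:
  assumes "h \<in> Pos" "star g = g"
  shows "h - g * h - h * g + g * h * g \<in> Pos"
proof -
  obtain d where d: "h = star d * d" using assms(1) by (auto simp: Pos_def positive_cone_def)
  have "h - g * h - h * g + g * h * g = star (d - d * g) * (d - d * g)"
    by (simp add: d star_diff star_mult assms(2) algebra_simps)
  then show ?thesis by simp
qed

lemma norm_cfc_le_Pos:
  assumes a: "a \<in> Pos" and f: "fc f" and B: "\<And>t. 0 \<le> t \<Longrightarrow> t \<le> norm a \<Longrightarrow> \<bar>f t\<bar> \<le> B"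
  shows "norm (cfc f a) \<le> B"
proof -
  have g: "fc (\<lambda>t. f (max t 0))" by (rule fc_comp[OF fc_simps(3) f])
  have "cfc f a = cfc (\<lambda>t. f (max t 0)) a" by (rule Pos_cfc_cong[OF a f g]) simp
  also have "norm \<dots> \<le> B"
    by (rule norm_cfc_le[OF g Pos_sa[OF a]]) (auto simp: max_def intro!: B)
  finally show ?thesis .
qed

lemma Pos_mult_eq_0_iff:
  assumes h: "h \<in> Pos"
  shows "star x * h * x = 0 \<longleftrightarrow> psqrt h * x = 0"
proof -
  have "star x * h * x = star (psqrt h * x) * (psqrt h * x)"
    using psqrt[OF h] by (metis mult.assoc star_mult)
  then show ?thesis by (simp add: star_mult_self_eq_0)
qed

lemma cstar_abs_Pos:
  assumes a: "a \<in> Pos"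
  shows "cstar_abs a = a"
proof -
  have "cstar_abs a = cfc (\<lambda>t. sqrt (t * t)) a"
    using spos_cfc_square[of a sqrt] Pos_sa[OF a] by (simp add: cstar_abs_def)
  also have "\<dots> = cfc (\<lambda>t. t) a"
    by (rule Pos_cfc_cong[OF a]) (auto simp: fc_def intro!: continuous_intros)
  finally show ?thesis using Pos_sa[OF a] by (simp add: cfc_id)
qed

lemma is_projection_Pos: "is_projection p \<Longrightarrow> p \<in> Pos"
  using Pos_star_mult[of p] by (simp add: is_projection_def)

lemma cfc_projection: "is_projection p \<Longrightarrow> fc f \<Longrightarrow> cfc f p = f 1 *\<^sub>R p"
proof -
  assume p: "is_projection p" and f: "fc f"
  have sp: "star p = p" and pp: "p * p = p" using p by (auto simp: is_projection_def)
  have "cfc f p * p = f 1 *\<^sub>R p" by (rule cfc_eigen[OF f sp]) (simp add: pp)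
  moreover have "cfc f p * p = cfc f p" by (rule cfc_mult_right_unit[OF f sp pp])
  ultimately show ?thesis by simp
qed

section \<open>Quasitraces and dimension functions\<close>

lemma positive_cone_Pos [simp]: "positive_cone (*) star = Pos"
  by (simp add: Pos_def)

context
  fixes \<tau> :: "'a::cstar_algebra \<Rightarrow> ennreal"
  assumes qt: "lsc_quasitrace_on (*) star \<tau>"
begin

lemma qt_zero: "\<tau> 0 = 0"
  using qt by (simp add: lsc_quasitrace_on_def)

lemma qt_add: "a \<in> Pos \<Longrightarrow> b \<in> Pos \<Longrightarrow> a * b = b * a \<Longrightarrow> \<tau> (a + b) = \<tau> a + \<tau> b"
  using qt by (simp add: lsc_quasitrace_on_def)

lemma qt_scale: "a \<in> Pos \<Longrightarrow> 0 < c \<Longrightarrow> \<tau> (c *\<^sub>R a) = ennreal c * \<tau> a"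
  using qt by (simp add: lsc_quasitrace_on_def)

lemma qt_star: "\<tau> (star x * x) = \<tau> (x * star x)"
  using qt by (simp add: lsc_quasitrace_on_def)

lemma qt_lsc:
  assumes x: "x \<longlonglongrightarrow> a" "\<And>n. x n \<in> Pos" and S: "\<And>n. \<tau> (x n) \<le> S"
  shows "\<tau> a \<le> S"
proof (rule ccontr)
  assume "\<not> \<tau> a \<le> S"
  then have less: "S < \<tau> a" by simp
  have "a \<in> Pos" using Pos_limit x by blast
  then have "\<forall>\<^sub>F y in at a within Pos. S < \<tau> y"
    using qt less by (simp add: lsc_quasitrace_on_def)
  \<comment> \<open>\<open>at a within Pos\<close> leaves out a itself, but the sequence may hit a;
    there \<open>less\<close> takes over.\<close>
  then have "\<forall>\<^sub>F y in nhds a. y \<noteq> a \<longrightarrow> y \<in> Pos \<longrightarrow> S < \<tau> y"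
    by (simp add: eventually_at_filter)
  then have "\<forall>\<^sub>F n in sequentially. x n \<noteq> a \<longrightarrow> x n \<in> Pos \<longrightarrow> S < \<tau> (x n)"
    using x(1) unfolding filterlim_iff by blast
  then have "\<forall>\<^sub>F n in sequentially. S < \<tau> (x n)"
    by eventually_elim (use x(2) less in \<open>metis\<close>)
  then obtain n where "S < \<tau> (x n)" by (auto simp: eventually_sequentially)
  then show False using S[of n] by simp
qed

lemma qt_mono:
  assumes "u \<in> Pos" "u \<preceq> v" "u * v = v * u"
  shows "\<tau> u \<le> \<tau> v"
proof -
  have "\<tau> (u + (v - u)) = \<tau> u + \<tau> (v - u)"
    using assms by (intro qt_add) (auto simp: cstar_le_def algebra_simps)
  then show ?thesis by simp
qed

lemma qt_cfc_mono:
  assumes x: "x \<in> Pos" and f: "fc f" and g: "fc g" and "\<And>t. 0 \<le> t \<Longrightarrow> 0 \<le> f t" "\<And>t. 0 \<le> t \<Longrightarrow> f t \<le> g t"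
  shows "\<tau> (cfc f x) \<le> \<tau> (cfc g x)"
  using assms by (intro qt_mono cstar_le_cfc Pos_cfc_nonneg)
    (auto simp: Pos_sa mult.commute simp flip: cfc_mult)

end

text \<open>Vanishing on a whole neighbourhood of 0 permits division by t, which
  \<open>qt_cutoff_le\<close> relies on.\<close>

definition cutoff :: "(real \<Rightarrow> real) set" where
  "cutoff = {k. continuous_on UNIV k \<and> (\<forall>t. 0 \<le> k t \<and> k t \<le> 1) \<and> (\<exists>\<delta>>0. \<forall>t\<le>\<delta>. k t = 0)}"

lemma cutoff_fc: "k \<in> cutoff \<Longrightarrow> fc k"
  unfolding cutoff_def fc_def using less_imp_le by blast

lemma root_tendsto_1:
  assumes "c > 0"
  shows "(\<lambda>n. ennreal (root n c)) \<longlonglongrightarrow> 1"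
  using LIMSEQ_root_const[OF assms] by (metis ennreal_1 tendsto_ennrealI)

lemma fc_root: "0 < n \<Longrightarrow> fc (root n)"
  by (auto simp: fc_def intro!: continuous_intros)

text \<open>The functions \<open>t \<mapsto> t\<^sup>1\<^sup>/\<^sup>n\<close> and the cutoff functions dominate each other up to
  constants tending to \<open>1\<close>.\<close>

lemma dim_fun_eq_SUP:
  fixes \<tau> :: "'a::cstar_algebra \<Rightarrow> ennreal"
  assumes qt: "lsc_quasitrace_on (*) star \<tau>" and x: "x \<in> Pos"
  shows "dim_fun \<tau> x = (SUP k\<in>cutoff. \<tau> (cfc k x))"
proof -
  define S where "S = (SUP k\<in>cutoff. \<tau> (cfc k x))"
  have sx: "star x = x" by (rule Pos_sa[OF x])
  have "(\<lambda>n. \<tau> (cfc (root n) x)) \<longlonglongrightarrow> S"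
  proof (rule order_tendstoI)
    fix l assume "l < S"
    then obtain k where k: "k \<in> cutoff" "l < \<tau> (cfc k x)" by (auto simp: S_def less_SUP_iff)
    then obtain \<delta> where \<delta>: "\<delta> > 0" "\<And>t. t \<le> \<delta> \<Longrightarrow> k t = 0" and k01: "\<And>t. 0 \<le> k t" "\<And>t. k t \<le> 1"
      by (auto simp: cutoff_def)
    have "(\<lambda>n. ennreal (root n \<delta>) * \<tau> (cfc k x)) \<longlonglongrightarrow> 1 * \<tau> (cfc k x)"
      by (intro tendsto_mult_ennreal root_tendsto_1 \<delta> tendsto_const) auto
    then have "\<forall>\<^sub>F n in sequentially. l < ennreal (root n \<delta>) * \<tau> (cfc k x)"
      using k(2) by (intro order_tendstoD(1)) auto
    then show "\<forall>\<^sub>F n in sequentially. l < \<tau> (cfc (root n) x)"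
      using eventually_gt_at_top[of 0]
    proof eventually_elim
      case (elim n)
      have kf: "fc k" using k(1) by (rule cutoff_fc)
      have kP: "cfc k x \<in> Pos" using Pos_cfc[OF sx kf] k01 by simp
      have r: "root n \<delta> > 0" using elim \<delta> by simp
      have "ennreal (root n \<delta>) * \<tau> (cfc k x) = \<tau> (cfc (\<lambda>t. root n \<delta> * k t) x)"
        using qt_scale[OF qt kP r] cfc_scale[OF kf sx] by simp
      also have "\<dots> \<le> \<tau> (cfc (root n) x)"
      proof (rule qt_cfc_mono[OF qt x fc_const_mult[OF kf] fc_root[OF elim(2)]])
        fix t :: real assume t: "0 \<le> t"
        show "0 \<le> root n \<delta> * k t" using r k01 by simp
        show "root n \<delta> * k t \<le> root n t"
        proof (cases "t \<le> \<delta>")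
          case False
          then have "root n \<delta> * k t \<le> root n \<delta> * 1" using r k01 by (intro mult_left_mono) auto
          also have "\<dots> \<le> root n t" using False elim(2) by simp
          finally show ?thesis .
        qed (use \<delta> t elim in simp)
      qed
      finally show ?case using elim(1) by simp
    qed
  next
    fix u assume "S < u"
    \<comment> \<open>Chosen so that root n t \<le> root n c on the spectrum, which keeps the
      truncation at 1 below from being felt; the added 1 makes c positive.\<close>
    define c where "c = norm x + 1"
    have c: "c > 0" by (simp add: c_def add_nonneg_pos)
    have "(\<lambda>n. ennreal (root n c) * S) \<longlonglongrightarrow> 1 * S"
      by (intro tendsto_mult_ennreal root_tendsto_1 c tendsto_const) auto
    then have "\<forall>\<^sub>F n in sequentially. ennreal (root n c) * S < u"
      using \<open>S < u\<close> by (intro order_tendstoD(2)) auto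
    then show "\<forall>\<^sub>F n in sequentially. \<tau> (cfc (root n) x) < u"
      using eventually_gt_at_top[of 0]
    proof eventually_elim
      case (elim n)
      define C where "C = root n c"
      have C: "C > 0" using elim(2) c by (simp add: C_def)
      \<comment> \<open>Subtracting 1 / (j + 1) makes the function vanish near 0. The error tends to
        0 with j, and lower semicontinuity carries the bound over to the n-th root.\<close>
      define k where "k j t = min 1 (max (root n t - 1 / (real j + 1)) 0 / C)" for j t
      have kcut: "k j \<in> cutoff" for j
        unfolding cutoff_def
      proof (intro CollectI conjI)
        show "continuous_on UNIV (k j)"
          unfolding k_def using C by (intro continuous_intros) (auto simp: elim(2))
        show "\<forall>t. 0 \<le> k j t \<and> k j t \<le> 1" using C by (auto simp: k_def)
        show "\<exists>\<delta>>0. \<forall>t\<le>\<delta>. k j t = 0"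
        proof (intro exI[of _ "(1 / (real j + 1)) ^ n"] conjI allI impI)
          fix t assume "t \<le> (1 / (real j + 1)) ^ n"
          then have "root n t \<le> root n ((1 / (real j + 1)) ^ n)" using elim(2) by simp
          also have "\<dots> = 1 / (real j + 1)" using elim(2) by (intro real_root_power_cancel) auto
          finally show "k j t = 0" using C by (simp add: k_def)
        qed simp
      qed
      have kf: "fc (k j)" for j using kcut by (rule cutoff_fc)
      have hf: "fc (\<lambda>t. C * k j t)" for j by (rule fc_const_mult[OF kf])
      have kP: "cfc (k j) x \<in> Pos" for j
        using Pos_cfc[OF sx kf] C by (simp add: k_def)
      have "(\<lambda>j. cfc (\<lambda>t. C * k j t) x - cfc (root n) x) \<longlonglongrightarrow> 0"
      proof (rule Lim_null_comparison)
        show "\<forall>\<^sub>F j in sequentially. norm (cfc (\<lambda>t. C * k j t) x - cfc (root n) x) \<le> 1 / (real j + 1)"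
        proof (intro always_eventually allI)
          fix j
          have "cfc (\<lambda>t. C * k j t) x - cfc (root n) x = cfc (\<lambda>t. C * k j t - root n t) x"
            by (rule cfc_diff[OF hf fc_root[OF elim(2)] sx, symmetric])
          also have "norm \<dots> \<le> 1 / (real j + 1)"
          proof (rule norm_cfc_le_Pos[OF x fc_diff[OF hf fc_root[OF elim(2)]]])
            fix t assume t: "0 \<le> t" "t \<le> norm x"
            have "root n t \<le> C" using t elim(2) unfolding C_def c_def by simp
            moreover have "0 \<le> root n t" using t elim(2) by simp
            moreover have "0 < 1 / (real j + 1)" by simp
            moreover have "max (root n t - 1 / (real j + 1)) 0 / C \<le> 1"
              using \<open>root n t \<le> C\<close> \<open>0 < 1 / (real j + 1)\<close> C by (simp only: divide_le_eq_1_pos)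
            then have "C * k j t = max (root n t - 1 / (real j + 1)) 0"
              using C by (simp add: k_def min_absorb2)
            ultimately show "\<bar>C * k j t - root n t\<bar> \<le> 1 / (real j + 1)" by linarith
          qed
          finally show "norm (cfc (\<lambda>t. C * k j t) x - cfc (root n) x) \<le> 1 / (real j + 1)" .
        qed
        show "(\<lambda>j. 1 / (real j + 1)) \<longlonglongrightarrow> 0"
          using LIMSEQ_inverse_real_of_nat by (simp add: inverse_eq_divide add.commute)
      qed
      then have lim: "(\<lambda>j. cfc (\<lambda>t. C * k j t) x) \<longlonglongrightarrow> cfc (root n) x"
        by (simp add: LIM_zero_iff)
      have "\<tau> (cfc (root n) x) \<le> ennreal C * S"
      proof (rule qt_lsc[OF qt lim])
        fix j
        show "cfc (\<lambda>t. C * k j t) x \<in> Pos" using Pos_scale[OF kP] C by (simp add: cfc_scale[OF kf sx])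
        have "\<tau> (cfc (\<lambda>t. C * k j t) x) = ennreal C * \<tau> (cfc (k j) x)"
          by (simp add: cfc_scale[OF kf sx] qt_scale[OF qt kP C])
        also have "\<dots> \<le> ennreal C * S"
          unfolding S_def by (intro mult_left_mono SUP_upper kcut) simp
        finally show "\<tau> (cfc (\<lambda>t. C * k j t) x) \<le> ennreal C * S" .
      qed
      then show ?case using elim(1) by (simp add: C_def)
    qed
  qed
  then show ?thesis unfolding dim_fun_def S_def[symmetric] by (rule limI)
qed

lemma dim_fun_projection:
  assumes p: "is_projection p"
  shows "dim_fun \<tau> p = \<tau> p"
  unfolding dim_fun_def
proof (rule limI, rule tendsto_eventually)
  show "\<forall>\<^sub>F n in sequentially. \<tau> (cfc (root n) p) = \<tau> p"
    using eventually_gt_at_top[of 0] by eventually_elim (simp add: cfc_projection[OF p fc_root])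
qed

section \<open>Two-by-two matrices and the subadditivity of dimension functions\<close>

definition mk2 :: "'a \<Rightarrow> 'a \<Rightarrow> 'a \<Rightarrow> 'a \<Rightarrow> 'a^2^2" where
  "mk2 a b c d = (\<chi> i j. if i = 1 then if j = 1 then a else b else if j = 1 then c else d)"

lemma mk2_simps:
  fixes a :: "'a::cstar_algebra"
  shows "mat2_mult (mk2 a b c d) (mk2 a' b' c' d') =
      mk2 (a * a' + b * c') (a * b' + b * d') (c * a' + d * c') (c * b' + d * d')"
    "mat2_star (mk2 a b c d) = mk2 (star a) (star c) (star b) (star d)"
    "mat2_corner a = mk2 a 0 0 0"
    "mk2 a b c d + mk2 a' b' c' d' = mk2 (a + a') (b + b') (c + c') (d + d')"
    "mk2 a b c d = mk2 a' b' c' d' \<longleftrightarrow> a = a' \<and> b = b' \<and> c = c' \<and> d = d'"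
  by (auto simp: mk2_def mat2_mult_def mat2_star_def mat2_corner_def vec_eq_iff forall_2 sum_2)

lemma positive_coneI: "mul (adj y) y \<in> positive_cone mul adj"
  by (auto simp: positive_cone_def)

text \<open>With \<open>V\<close> the column \<open>(z\<^sub>1, z\<^sub>2) m(x)\<close> and \<open>E = diag(u\<^sup>2, f)\<close>, the complement \<open>E - V V\<^sup>*\<close> is
  the square of \<open>diag(u, f) - (z\<^sub>1, z\<^sub>2) l(x) (z\<^sub>1, z\<^sub>2)\<^sup>*\<close>; here \<open>m\<^sup>2 = k(t) / t\<close> and
  \<open>l = (1 - (1 - k(t))\<^sup>1\<^sup>/\<^sup>2) / t\<close>, so that \<open>2 l - t l\<^sup>2 = m\<^sup>2\<close>.\<close>

lemma qt_cutoff_le: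
  fixes \<tau> :: "'a::cstar_algebra \<Rightarrow> ennreal"
  assumes qt: "lsc_2_quasitrace \<tau>" and k: "k \<in> cutoff"
    and u: "star u = u" "u * z1 = z1" and f: "is_projection f" "f * z2 = z2"
  shows "\<tau> (cfc k (star z1 * z1 + star z2 * z2)) \<le> \<tau> (u * u) + \<tau> f"
proof -
  define x where "x = star z1 * z1 + star z2 * z2"
  obtain \<tau>2 where qt2: "lsc_quasitrace_on mat2_mult mat2_star \<tau>2"
    and \<tau>2: "\<And>a. a \<in> Pos \<Longrightarrow> \<tau>2 (mk2 a 0 0 0) = \<tau> a"
    using qt by (auto simp: lsc_2_quasitrace_def mk2_simps)
  have t2add: "\<tau>2 (A + B) = \<tau>2 A + \<tau>2 B" if "A \<in> positive_cone mat2_mult mat2_star"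
     "B \<in> positive_cone mat2_mult mat2_star" "mat2_mult A B = mat2_mult B A" for A B
    using qt2 that by (simp add: lsc_quasitrace_on_def)
  have t2star: "\<tau>2 (mat2_mult (mat2_star X) X) = \<tau>2 (mat2_mult X (mat2_star X))" for X
    using qt2 by (simp add: lsc_quasitrace_on_def)
  obtain \<delta> where \<delta>: "\<delta> > 0" "\<And>t. t \<le> \<delta> \<Longrightarrow> k t = 0" and k01: "\<And>t. 0 \<le> k t" "\<And>t. k t \<le> 1"
    and kc: "continuous_on UNIV k"
    using k by (auto simp: cutoff_def)
  have xP: "x \<in> Pos" unfolding x_def by (intro Pos_add) auto
  have sx: "star x = x" by (rule Pos_sa[OF xP])
  \<comment> \<open>The denominator \<open>max t \<delta>\<close> is never 0, and it differs from t
    only where k vanishes.\<close>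
  define m where "m t = sqrt (k t / max t \<delta>)" for t
  define l where "l t = (1 - sqrt (1 - k t)) / max t \<delta>" for t
  have mx: "max t \<delta> \<noteq> 0" for t using \<delta>(1) by (auto simp: max_def)
  have k0: "k 0 = 0" using \<delta> by simp
  have mf: "fc m" unfolding fc_def m_def by (auto intro!: continuous_intros kc simp: mx k0)
  have lf: "fc l" unfolding fc_def l_def by (auto intro!: continuous_intros kc simp: mx k0)
  define M where "M = cfc m x"
  define L where "L = cfc l x"
  have sM: "star M = M" unfolding M_def by (rule star_cfc[OF mf sx])
  have sL: "star L = L" unfolding L_def by (rule star_cfc[OF lf sx])
  have "m t * (t * m t) = k t" for t
  proof (cases "t \<le> \<delta>")
    case False
    then have "m t * m t = k t / t" using \<delta> k01[of t] by (simp add: m_def max_def)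
    then show ?thesis using False \<delta> by (simp add: mult.left_commute)
  qed (simp add: m_def \<delta>)
  then have MxM: "M * (x * M) = cfc k x"
    unfolding M_def using mf sx by (simp add: cfc_mult[symmetric] cfc_id fc_mult
        cfc_mult[of "\<lambda>t. t" m x, unfolded cfc_id[OF sx], symmetric])
  have "2 * l t - l t * (t * l t) = m t * m t" for t
  proof (cases "t \<le> \<delta>")
    case False
    define s where "s = sqrt (1 - k t)"
    have s: "s * s = 1 - k t" using k01[of t] by (simp add: s_def)
    have t: "t > 0" "max t \<delta> = t" using False \<delta> by auto
    have "m t * m t = k t / t" using t k01[of t] by (simp add: m_def)
    have lt: "l t = (1 - s) / t" using t by (simp add: l_def s_def)
    then have tl: "t * l t = 1 - s" using t by simp
    have "2 * l t - l t * (t * l t) = l t * (1 + s)" unfolding tl by (simp add: algebra_simps)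
    also have "\<dots> = ((1 - s) * (1 + s)) / t" by (simp add: lt)
    also have "(1 - s) * (1 + s) = 1 - s * s" by (simp add: algebra_simps)
    finally show ?thesis using s \<open>m t * m t = k t / t\<close> by simp
  qed (simp add: m_def l_def \<delta>)
  then have "cfc (\<lambda>t. 2 * l t - l t * (t * l t)) x = cfc (\<lambda>t. m t * m t) x" by simp
  then have "2 *\<^sub>R L - L * (x * L) = M * M"
    unfolding M_def L_def using mf lf sx
    by (simp only: cfc_id fc_mult fc_const_mult fc_simps cfc_mult cfc_scale cfc_diff)
  then have eqL: "L + L - (L * (star z1 * z1 * L) + L * (star z2 * z2 * L)) = M * M"
    by (simp add: x_def scaleR_2 distrib_left distrib_right)
  have LM: "v * L * w + v * L * w - (v * L * star z1 * z1 * L * w + v * L * star z2 * z2 * L * w) = v * M * M * w"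
    for v w using arg_cong[OF eqL, of "\<lambda>q. v * q * w"]
    by (simp add: distrib_left distrib_right left_diff_distrib right_diff_distrib mult.assoc)
  have sf: "star f = f" "f * f = f" using f(1) by (auto simp: is_projection_def)
  have uz: "star z1 * u = star z1" "star z2 * f = star z2"
    using arg_cong[OF u(2), of star] arg_cong[OF f(2), of star] u(1) sf by (simp_all add: star_mult)
  have uz': "y * star z1 * u = y * star z1" "y * star z2 * f = y * star z2"
     "star z1 * (u * y) = star z1 * y" "star z2 * (f * y) = star z2 * y"
     "u * (z1 * y) = z1 * y" "f * (z2 * y) = z2 * y" for y
    using u(2) f(2) uz by (metis mult.assoc)+
  define V where "V = mk2 (z1 * M) 0 (z2 * M) 0"
  define E where "E = mk2 (u * u) 0 0 f"
  define D where "D = mk2 (u - z1 * L * star z1) (- (z1 * L * star z2)) (- (z2 * L * star z1)) (f - z2 * L * star z2)"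
  have VsV: "mat2_mult (mat2_star V) V = mk2 (cfc k x) 0 0 0"
    using MxM by (simp add: V_def mk2_simps star_mult sM x_def algebra_simps)
  have VVs: "mat2_mult V (mat2_star V) = mk2 (z1 * M * M * star z1) (z1 * M * M * star z2)
      (z2 * M * M * star z1) (z2 * M * M * star z2)"
    by (simp add: V_def mk2_simps star_mult sM mult.assoc)
  have DsD: "mat2_mult (mat2_star D) D = mk2 (u * u - z1 * M * M * star z1) (- (z1 * M * M * star z2))
      (- (z2 * M * M * star z1)) (f - z2 * M * M * star z2)"
    unfolding D_def mk2_simps LM[symmetric]
    by (simp add: star_diff star_mult star_star sL u(1) sf uz uz' u(2) f(2) algebra_simps)
  have Esum: "E = mat2_mult V (mat2_star V) + mat2_mult (mat2_star D) D"
    unfolding VVs DsD by (simp add: mk2_simps E_def)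
  \<comment> \<open>E V = V because u and f are left units for z1 and z2. Hence V V^* commutes with
    E and with the complement, and additivity on commuting elements suffices.\<close>
  have "\<tau>2 E = \<tau>2 (mat2_mult V (mat2_star V)) + \<tau>2 (mat2_mult (mat2_star D) D)"
    unfolding Esum
  proof (rule t2add)
    have "mat2_mult (mat2_star (mat2_star V)) (mat2_star V) \<in> positive_cone mat2_mult mat2_star"
      by (rule positive_coneI)
    then show "mat2_mult V (mat2_star V) \<in> positive_cone mat2_mult mat2_star"
      by (simp add: V_def mk2_simps star_star)
    show "mat2_mult (mat2_star D) D \<in> positive_cone mat2_mult mat2_star" by (rule positive_coneI)
    show "mat2_mult (mat2_mult V (mat2_star V)) (mat2_mult (mat2_star D) D) =
        mat2_mult (mat2_mult (mat2_star D) D) (mat2_mult V (mat2_star V))"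
      unfolding VVs DsD by (simp add: mk2_simps left_diff_distrib right_diff_distrib mult.assoc uz uz' u(2) f(2))
  qed
  then have "\<tau>2 (mat2_mult V (mat2_star V)) \<le> \<tau>2 E" by simp
  then have "\<tau>2 (mk2 (cfc k x) 0 0 0) \<le> \<tau>2 E" by (simp add: t2star[symmetric] VsV)
  also have "cfc k x \<in> Pos" using Pos_cfc[OF sx cutoff_fc[OF k]] k01 by simp
  then have "\<tau>2 (mk2 (cfc k x) 0 0 0) = \<tau> (cfc k x)" by (rule \<tau>2)
  also have "\<tau>2 E = \<tau>2 (mk2 (u * u) 0 0 0) + \<tau>2 (mk2 0 0 0 f)"
  proof -
    have "mk2 (u * u) 0 0 0 = mat2_mult (mat2_star (mk2 u 0 0 0)) (mk2 u 0 0 0)"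
      by (simp add: mk2_simps u(1))
    then have 1: "mk2 (u * u) 0 0 0 \<in> positive_cone mat2_mult mat2_star" by (metis positive_coneI)
    have "mk2 0 0 0 f = mat2_mult (mat2_star (mk2 0 0 0 f)) (mk2 0 0 0 f)"
      by (simp add: mk2_simps sf)
    then have 2: "mk2 0 0 0 f \<in> positive_cone mat2_mult mat2_star" by (metis positive_coneI)
    have "E = mk2 (u * u) 0 0 0 + mk2 0 0 0 f" by (simp add: E_def mk2_simps)
    then show ?thesis using t2add[OF 1 2] by (simp add: mk2_simps)
  qed
  also have "\<tau>2 (mk2 (u * u) 0 0 0) = \<tau> (u * u)" by (rule \<tau>2[OF Pos_square[OF u(1)]])
  \<comment> \<open>The partial isometry with the single entry f off the diagonal moves f from the
    second corner to the first.\<close>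
  also have "\<tau>2 (mk2 0 0 0 f) = \<tau> f"
    using t2star[of "mk2 0 f 0 0"] \<tau>2[OF is_projection_Pos[OF f(1)]] by (simp add: mk2_simps sf)
  finally show ?thesis by (simp add: x_def)
qed

text \<open>Compressing z z^* \<le> K h(c) by 1 - u(c) bounds the square of the error by K (1 - u)^2
  h at c. It serves to approximate z by elements that begin with a function of c.\<close>

lemma norm_diff_cfc_mult_le:
  fixes z c :: "'a::cstar_algebra"
  assumes c: "c \<in> Pos" and u: "fc u" and h: "fc h" and K: "0 \<le> K"
    and z: "z * star z \<preceq> K *\<^sub>R cfc h c"
    and B: "\<And>t. 0 \<le> t \<Longrightarrow> \<bar>(1 - u t)\<^sup>2 * h t\<bar> \<le> B"
  shows "(norm (z - cfc u c * z))\<^sup>2 \<le> K * B"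
proof -
  have sc: "star c = c" by (rule Pos_sa[OF c])
  define U where "U = cfc u c"
  define H where "H = K *\<^sub>R cfc h c"
  have sU: "star U = U" unfolding U_def by (rule star_cfc[OF u sc])
  have A: "(z - U * z) * star (z - U * z) = z * star z - U * (z * star z) - (z * star z) * U + U * (z * star z) * U"
    by (simp add: star_diff star_mult sU algebra_simps)
  have "(H - z * star z) - U * (H - z * star z) - (H - z * star z) * U + U * (H - z * star z) * U \<in> Pos"
    using z by (intro Pos_compress sU) (simp add: cstar_le_def H_def)
  then have "(z - U * z) * star (z - U * z) \<preceq> H - U * H - H * U + U * H * U"
    unfolding A cstar_le_def by (simp add: algebra_simps)
  also have "\<dots> = K *\<^sub>R cfc (\<lambda>t. h t - u t * h t - h t * u t + u t * h t * u t) c"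
    unfolding H_def U_def
    by (simp only: cfc_add cfc_diff cfc_mult fc_mult fc_add fc_diff sc u h) (simp add: algebra_simps)
  also have "(\<lambda>t. h t - u t * h t - h t * u t + u t * h t * u t) = (\<lambda>t. (1 - u t)\<^sup>2 * h t)"
    by (simp add: fun_eq_iff power2_eq_square algebra_simps)
  finally have "norm ((z - U * z) * star (z - U * z)) \<le> norm (K *\<^sub>R cfc (\<lambda>t. (1 - u t)\<^sup>2 * h t) c)"
    by (rule norm_mono[rotated]) simp
  also have "\<dots> \<le> K * B"
    unfolding norm_scaleR abs_of_nonneg[OF K]
  proof (intro mult_left_mono norm_cfc_le_Pos[OF c] K)
    show "fc (\<lambda>t. (1 - u t)\<^sup>2 * h t)"
      using u h by (auto simp: fc_def intro!: continuous_intros)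
  qed (use B in auto)
  finally show ?thesis by (simp add: cstar_identity' U_def)
qed

lemma inverse_Suc_tendsto_0: "(\<lambda>n. 1 / (real n + 1)) \<longlonglongrightarrow> 0"
  using LIMSEQ_inverse_real_of_nat by (simp add: inverse_eq_divide add.commute)

text \<open>It is 0 up to \<epsilon> and 1 from 2 \<epsilon> on, so
  \<open>ramp (\<epsilon> / 2)\<close> is 1 wherever \<open>ramp \<epsilon>\<close> is not
  0.\<close>

definition ramp :: "real \<Rightarrow> real \<Rightarrow> real" where
  "ramp \<epsilon> t = min 1 (max (t / \<epsilon> - 1) 0)"

lemma ramp_cutoff: "0 < \<epsilon> \<Longrightarrow> ramp \<epsilon> \<in> cutoff"
  unfolding cutoff_def
  by (auto simp: ramp_def[abs_def] intro!: continuous_intros exI[of _ \<epsilon>])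

text \<open>z1 is the limit of g z1 with g a ramp of y, and a ramp u of half the width is a left
  unit for g z1. So \<open>qt_cutoff_le\<close> applies to the approximants, u^2 is a cutoff of y,
  and lower semicontinuity gives the limit.\<close>

lemma dim_fun_sum_le:
  fixes \<tau> :: "'a::cstar_algebra \<Rightarrow> ennreal"
  assumes qt: "lsc_2_quasitrace \<tau>" and y: "y \<in> Pos" and K: "0 \<le> K"
    and z1: "z1 * star z1 \<preceq> K *\<^sub>R y" and f: "is_projection f" "f * z2 = z2"
  shows "dim_fun \<tau> (star z1 * z1 + star z2 * z2) \<le> dim_fun \<tau> y + \<tau> f"
proof -
  have qt1: "lsc_quasitrace_on (*) star \<tau>" using qt by (simp add: lsc_2_quasitrace_def)
  define x where "x = star z1 * z1 + star z2 * z2"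
  have xP: "x \<in> Pos" unfolding x_def by (intro Pos_add) auto
  have sy: "star y = y" by (rule Pos_sa[OF y])
  define \<epsilon> where "\<epsilon> n = 1 / (real n + 1)" for n
  have e0: "\<epsilon> n > 0" for n by (simp add: \<epsilon>_def)
  have elim0: "\<epsilon> \<longlonglongrightarrow> 0"
    unfolding \<epsilon>_def[abs_def] by (rule inverse_Suc_tendsto_0)
  define g where "g n = cfc (ramp (\<epsilon> n)) y" for n
  have rf: "0 < e \<Longrightarrow> fc (ramp e)" for e using ramp_cutoff cutoff_fc by blast
  have sg: "star (g n) = g n" for n unfolding g_def by (rule star_cfc[OF rf[OF e0] sy])
  define z where "z n = g n * z1" for n
  have "(norm (z1 - z n))\<^sup>2 \<le> K * (2 * \<epsilon> n)" for n
    unfolding z_def g_def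
  proof (rule norm_diff_cfc_mult_le[OF y rf[OF e0] fc_simps(1) K])
    show "z1 * star z1 \<preceq> K *\<^sub>R cfc (\<lambda>t. t) y" using z1 by (simp add: cfc_id sy)
    fix t :: real assume t: "0 \<le> t"
    have "(1 - ramp (\<epsilon> n) t)\<^sup>2 * t \<le> 2 * \<epsilon> n"
    proof (cases "t \<le> 2 * \<epsilon> n")
      case True
      have "(1 - ramp (\<epsilon> n) t)\<^sup>2 \<le> 1" by (rule power_le_one) (auto simp: ramp_def)
      then have "(1 - ramp (\<epsilon> n) t)\<^sup>2 * t \<le> 1 * t" using t by (intro mult_right_mono)
      then show ?thesis using True by simp
    next
      case False
      then have "ramp (\<epsilon> n) t = 1" using e0[of n] by (simp add: ramp_def field_simps)
      then show ?thesis using e0[of n] by simp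
    qed
    then show "\<bar>(1 - ramp (\<epsilon> n) t)\<^sup>2 * t\<bar> \<le> 2 * \<epsilon> n" using t by simp
  qed
  then have "norm (z n - z1) \<le> sqrt (2 * K * \<epsilon> n)" for n
    by (metis norm_minus_commute real_le_rsqrt mult.assoc mult.commute)
  moreover have "(\<lambda>n. sqrt (2 * K * \<epsilon> n)) \<longlonglongrightarrow> 0"
    using tendsto_real_sqrt[OF tendsto_mult_left[OF elim0, of "2 * K"]] by simp
  ultimately have "(\<lambda>n. z n - z1) \<longlonglongrightarrow> 0"
    by (rule Lim_null_comparison[OF always_eventually, rule_format])
  then have zlim: "z \<longlonglongrightarrow> z1" by (simp add: LIM_zero_iff)
  define X where "X n = star (z n) * z n + star z2 * z2" for n
  have XP: "X n \<in> Pos" for n unfolding X_def by (intro Pos_add) auto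
  have Xlim: "X \<longlonglongrightarrow> x"
    unfolding X_def[abs_def] x_def by (intro tendsto_intros tendsto_star zlim)
  have "dim_fun \<tau> x \<le> dim_fun \<tau> y + \<tau> f"
    unfolding dim_fun_eq_SUP[OF qt1 xP]
  proof (rule SUP_least)
    fix k assume k: "k \<in> cutoff"
    then have k01: "\<And>t. 0 \<le> k t" by (simp add: cutoff_def)
    show "\<tau> (cfc k x) \<le> dim_fun \<tau> y + \<tau> f"
    proof (rule qt_lsc[OF qt1])
      show "(\<lambda>n. cfc k (X n)) \<longlonglongrightarrow> cfc k x"
        by (rule tendsto_cfc[OF cutoff_fc[OF k] Pos_sa[OF XP] Xlim])
      show "cfc k (X n) \<in> Pos" for n by (rule Pos_cfc[OF Pos_sa[OF XP] cutoff_fc[OF k] k01])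
      fix n
      define u where "u = cfc (ramp (\<epsilon> n / 2)) y"
      have e2: "0 < \<epsilon> n / 2" using e0 by simp
      have rr: "(\<lambda>t. ramp (\<epsilon> n / 2) t * ramp (\<epsilon> n) t) = ramp (\<epsilon> n)"
      proof
        fix t show "ramp (\<epsilon> n / 2) t * ramp (\<epsilon> n) t = ramp (\<epsilon> n) t"
          using e0[of n] by (cases "t \<le> \<epsilon> n") (auto simp: ramp_def field_simps min_def max_def)
      qed
      have "u * g n = g n"
        unfolding u_def g_def cfc_mult[OF rf[OF e2] rf[OF e0] sy, symmetric] rr ..
      then have uz: "u * z n = z n" by (simp add: z_def flip: mult.assoc)
      have su: "star u = u" unfolding u_def by (rule star_cfc[OF rf[OF e2] sy])
      have "\<tau> (cfc k (X n)) \<le> \<tau> (u * u) + \<tau> f"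
        unfolding X_def by (rule qt_cutoff_le[OF qt k su uz f])
      also have "\<tau> (u * u) \<le> dim_fun \<tau> y"
        unfolding dim_fun_eq_SUP[OF qt1 y] u_def cfc_mult[OF rf[OF e2] rf[OF e2] sy, symmetric]
      proof (rule SUP_upper)
        have "ramp (\<epsilon> n / 2) \<in> cutoff" using e2 by (rule ramp_cutoff)
        then show "(\<lambda>t. ramp (\<epsilon> n / 2) t * ramp (\<epsilon> n / 2) t) \<in> cutoff"
          by (fastforce simp: cutoff_def mult_le_one intro: continuous_on_mult)
      qed
      finally show "\<tau> (cfc k (X n)) \<le> dim_fun \<tau> y + \<tau> f" by simp
    qed
  qed
  then show ?thesis by (simp add: x_def)
qed

lemma is_projection_0 [simp]: "is_projection 0"
  by (simp add: is_projection_def)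

lemma dim_fun_star_mult_le:
  fixes \<tau> :: "'a::cstar_algebra \<Rightarrow> ennreal"
  assumes qt: "lsc_2_quasitrace \<tau>" and y: "y \<in> Pos" "0 \<le> K" "z * star z \<preceq> K *\<^sub>R y"
  shows "dim_fun \<tau> (star z * z) \<le> dim_fun \<tau> y"
  using dim_fun_sum_le[OF assms is_projection_0, of 0] qt
  by (simp add: lsc_2_quasitrace_def lsc_quasitrace_on_def)

lemma dim_fun_mono:
  fixes \<tau> :: "'a::cstar_algebra \<Rightarrow> ennreal"
  assumes qt: "lsc_2_quasitrace \<tau>" and y: "y \<in> Pos" and x: "x \<in> Pos" "x \<preceq> y"
  shows "dim_fun \<tau> x \<le> dim_fun \<tau> y"
  using dim_fun_star_mult_le[OF qt y, of 1 "psqrt x"] x by (simp add: psqrt)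

text \<open>With s = x^(1/2), x = s (1 - f) s + s f s. The first term is star z1 * z1 for z1 = (1 -
  f) s, and z1 * star z1 is the compression.\<close>

lemma dim_fun_compress:
  fixes \<tau> :: "'a::cstar_algebra \<Rightarrow> ennreal"
  assumes qt: "lsc_2_quasitrace \<tau>" and x: "x \<in> Pos" and f: "is_projection f"
  shows "dim_fun \<tau> x \<le> dim_fun \<tau> (x - f * x - x * f + f * x * f) + \<tau> f"
proof -
  define s where "s = psqrt x"
  have s: "star s = s" "s * s = x" using psqrt[OF x] by (auto simp: s_def)
  have sf: "star f = f" "f * f = f" using f by (auto simp: is_projection_def)
  have ss: "s * (s * v) = x * v" for v using s(2) by (metis mult.assoc)
  have ff: "f * (f * v) = f * v" for v using sf(2) by (metis mult.assoc)
  let ?y = "x - f * x - x * f + f * x * f"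
  have yP: "?y \<in> Pos" by (rule Pos_compress[OF x sf(1)])
  have "(s - f * s) * star (s - f * s) = ?y"
    using s by (simp add: star_diff star_mult sf algebra_simps ss)
  then have "(s - f * s) * star (s - f * s) \<preceq> 1 *\<^sub>R ?y" by (simp add: cstar_le_def)
  from dim_fun_sum_le[OF qt yP _ this f, of "f * s"]
  have "dim_fun \<tau> (star (s - f * s) * (s - f * s) + star (f * s) * (f * s)) \<le> dim_fun \<tau> ?y + \<tau> f"
    by (simp add: ff)
  moreover have "star (s - f * s) * (s - f * s) + star (f * s) * (f * s) = x"
    using s by (simp add: star_diff star_mult sf algebra_simps ff)
  ultimately show ?thesis by simp
qed

section \<open>Partial isometries from Cuntz subequivalence\<close>

text \<open>If \<open>q - q r\<^sup>* c r q = e\<close> has norm at most \<open>1/2\<close>, then \<open>r q\<close> is corrected by \<open>(q - e)\<^sup>-\<^sup>1\<^sup>/\<^sup>2\<close>.\<close>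

lemma cuntz_le_projection:
  fixes q :: "'a::cstar_algebra"
  assumes q: "is_projection q" and c: "star c = c" and le: "cuntz_le q c"
  obtains r where "star r * c * r = q"
proof -
  have sq: "star q = q" "q * q = q" using q by (auto simp: is_projection_def)
  have qq: "q * (q * y) = q * y" for y using sq(2) by (metis mult.assoc)
  obtain R where R: "(\<lambda>n. star (R n) * c * R n) \<longlonglongrightarrow> q" using le by (auto simp: cuntz_le_def)
  have "(\<lambda>n. q * (star (R n) * c * R n) * q) \<longlonglongrightarrow> q * q * q"
    by (intro tendsto_intros R)
  then have "(\<lambda>n. q * (star (R n) * c * R n) * q) \<longlonglongrightarrow> q" by (simp add: sq)
  then have "\<forall>\<^sub>F n in sequentially. dist (q * (star (R n) * c * R n) * q) q < 1/2"
    by (rule tendstoD) simp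
  then obtain n where n: "dist (q * (star (R n) * c * R n) * q) q < 1/2"
    by (auto simp: eventually_sequentially)
  define r where "r = R n"
  define e where "e = q - q * (star r * c * r) * q"
  have ne: "norm e < 1/2" using n by (simp add: e_def r_def dist_norm norm_minus_commute)
  have se: "star e = e" by (simp add: e_def star_diff star_mult star_star sq c mult.assoc)
  have eq: "e * q = e" "q * e = e" by (simp_all add: e_def left_diff_distrib right_diff_distrib sq qq mult.assoc)
  \<comment> \<open>(1 - t)^(-1/2), minus 1 in order to vanish at 0; \<open>min t (1/2)\<close>
    keeps it continuous and changes nothing on the spectrum of e. Then q + \<phi>(e) is (q -
    e)^(-1/2) in the corner qAq.\<close>
  define \<phi> where "\<phi> t = 1 / sqrt (1 - min t (1/2)) - 1" for t :: real
  have \<phi>: "fc \<phi>" proof -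
    have "1 - min t (1/2) \<noteq> 0" for t :: real by (auto simp: min_def)
    then show ?thesis unfolding fc_def \<phi>_def by (auto intro!: continuous_intros)
  qed
  define \<Phi> where "\<Phi> = cfc \<phi> e"
  have s\<Phi>: "star \<Phi> = \<Phi>" unfolding \<Phi>_def by (rule star_cfc[OF \<phi> se])
  have \<Phi>q: "\<Phi> * q = \<Phi>" unfolding \<Phi>_def by (rule cfc_mult_right_unit[OF \<phi> se eq(1)])
  have q\<Phi>: "q * \<Phi> = \<Phi>" using arg_cong[OF \<Phi>q, of star] by (simp add: star_mult s\<Phi> sq)
  have "2 *\<^sub>R \<Phi> - e - \<Phi> * e - e * \<Phi> + \<Phi> * \<Phi> - \<Phi> * e * \<Phi>
      = cfc (\<lambda>t. 2 * \<phi> t - t - \<phi> t * t - t * \<phi> t + \<phi> t * \<phi> t - \<phi> t * t * \<phi> t) e"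
    unfolding \<Phi>_def
    by (simp only: cfc_add cfc_diff cfc_mult cfc_scale fc_mult fc_add fc_diff fc_const_mult fc_simps cfc_id se \<phi>)
  also have "\<dots> = cfc (\<lambda>t. 0) e"
  proof (rule cfc_cong)
    fix t assume "\<bar>t\<bar> \<le> norm e"
    then have t: "t < 1/2" using ne by linarith
    define s where "s = sqrt (1 - t)"
    have s: "s > 0" "s * s = 1 - t" using t by (auto simp: s_def)
    have "\<phi> t = 1 / s - 1" using t by (simp add: \<phi>_def s_def)
    then have "(1 + \<phi> t) * (1 + \<phi> t) * (1 - t) = 1" using s(1) by (simp add: s(2)[symmetric])
    then show "2 * \<phi> t - t - \<phi> t * t - t * \<phi> t + \<phi> t * \<phi> t - \<phi> t * t * \<phi> t = 0"
      by (simp add: algebra_simps)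
  qed
  finally have \<Phi>0: "2 *\<^sub>R \<Phi> - e - \<Phi> * e - e * \<Phi> + \<Phi> * \<Phi> - \<Phi> * e * \<Phi> = 0"
    by (simp add: cfc_zero_fun se)
  define u where "u = q + \<Phi>"
  have uq: "u * q = u" "q * u = u" by (simp_all add: u_def distrib_left distrib_right sq \<Phi>q q\<Phi>)
  have su: "star u = u" by (simp add: u_def star_add sq s\<Phi>)
  have "star (r * u) * c * (r * u) = u * (star r * c * r) * u" by (simp add: star_mult su mult.assoc)
  also have "\<dots> = (u * q) * (star r * c * r) * (q * u)" by (simp add: uq)
  also have "\<dots> = u * (q - e) * u" by (simp add: e_def mult.assoc)
  also have "\<dots> = q + (2 *\<^sub>R \<Phi> - e - \<Phi> * e - e * \<Phi> + \<Phi> * \<Phi> - \<Phi> * e * \<Phi>)"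
    by (simp add: u_def algebra_simps sq eq \<Phi>q q\<Phi> scaleR_2)
  finally show ?thesis using that[of "r * u"] \<Phi>0 by simp
qed

lemma partial_isometry_right:
  assumes "star v * v = q" "is_projection q"
  shows "v * q = (v::'a::cstar_algebra)"
proof -
  have sq: "star q = q" "q * q = q" using assms(2) by (auto simp: is_projection_def)
  have "star (v - v * q) * (v - v * q) = q - q * q - (q * q - q * q * q)"
    by (simp add: star_diff star_mult sq(1) algebra_simps flip: assms(1))
      (simp add: assms(1) sq flip: mult.assoc)
  then show ?thesis using star_mult_self_eq_0[of "v - v * q"] by (simp add: sq)
qed

text \<open>v = c^(1/2) r. The two implications replace the statement that v has its range inside
  that of c.\<close>

lemma cuntz_le_partial_isometry:
  fixes q :: "'a::cstar_algebra"
  assumes q: "is_projection q" and c: "c \<in> Pos" and le: "cuntz_le q c"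
  obtains v where "star v * v = q" "\<And>g. g * c = 0 \<Longrightarrow> g * v = 0" "\<And>g. g * c = c \<Longrightarrow> g * v = v"
proof -
  obtain r where r: "star r * c * r = q" using cuntz_le_projection[OF q Pos_sa[OF c] le] .
  define s where "s = psqrt c"
  have s: "star s = s" "s * s = c" using psqrt[OF c] by (auto simp: s_def)
  have ss: "s * (s * y) = c * y" for y using s(2) by (metis mult.assoc)
  have zero: "z * s = 0" if "z * c * star z = 0" for z
    using Pos_mult_eq_0_iff[OF c, of "star z"] that s(1)
    by (metis s_def star_mult star_star star_zero)
  show ?thesis
  proof (rule that[of "s * r"])
    show "star (s * r) * (s * r) = q" using r by (simp add: star_mult s(1) ss mult.assoc)
    show "g * (s * r) = 0" if "g * c = 0" for g
      using zero[of g] that by (simp flip: mult.assoc)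
    show "g * (s * r) = s * r" if g: "g * c = c" for g
    proof -
      have "c * star g = c" using arg_cong[OF g, of star] by (simp add: star_mult Pos_sa[OF c])
      then have "(g * s - s) * star (g * s - s) = 0"
        using g by (simp add: star_diff star_mult s algebra_simps ss)
      then have "g * s - s = 0"
        using star_mult_self_eq_0[of "star (g * s - s)"] by (metis star_star star_zero)
      then show ?thesis by (simp flip: mult.assoc)
    qed
  qed
qed

text \<open>When the q i are projections, one equation says both that v i is a partial isometry with
  initial projection q i and that the ranges are pairwise orthogonal.\<close>

definition orthogonal_system :: "(nat \<Rightarrow> 'a::cstar_algebra) \<Rightarrow> nat set \<Rightarrow> (nat \<Rightarrow> 'a) \<Rightarrow> bool" where
  "orthogonal_system q I v \<longleftrightarrow> (\<forall>i\<in>I. \<forall>j\<in>I. star (v i) * v j = (if i = j then q i else 0))"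

lemma orthogonal_systemD:
  "orthogonal_system q I v \<Longrightarrow> i \<in> I \<Longrightarrow> j \<in> I \<Longrightarrow> star (v i) * v j = (if i = j then q i else 0)"
  by (simp add: orthogonal_system_def)

lemma orthogonal_system_subset: "orthogonal_system q I v \<Longrightarrow> J \<subseteq> I \<Longrightarrow> orthogonal_system q J v"
  unfolding orthogonal_system_def by blast

context
  fixes q v :: "nat \<Rightarrow> 'a::cstar_algebra" and I :: "nat set"
  assumes proj: "\<And>i. i \<in> I \<Longrightarrow> is_projection (q i)"
    and orth: "orthogonal_system q I v"
    and fin: "finite I"
begin

lemma star_mult_range_sum:
  assumes "i \<in> I"
  shows "star (v i) * (\<Sum>j\<in>I. v j * star (v j)) = star (v i)"
proof -
  have "v i * q i = v i"
    using orthogonal_systemD[OF orth assms assms] proj[OF assms] by (intro partial_isometry_right) auto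
  then have "q i * star (v i) = star (v i)"
    using proj[OF assms] by (metis is_projection_def star_mult)
  moreover have "star (v i) * (\<Sum>j\<in>I. v j * star (v j)) = (\<Sum>j\<in>I. if j = i then q i * star (v i) else 0)"
    unfolding sum_distrib_left
    by (rule sum.cong) (use orthogonal_systemD[OF orth assms] in \<open>auto simp flip: mult.assoc\<close>)
  ultimately show ?thesis using fin assms by simp
qed

lemma is_projection_range_sum: "is_projection (\<Sum>i\<in>I. v i * star (v i))"
proof -
  let ?F = "\<Sum>i\<in>I. v i * star (v i)"
  have "?F * ?F = (\<Sum>i\<in>I. v i * (star (v i) * ?F))"
    by (simp add: sum_distrib_right mult.assoc)
  also have "\<dots> = ?F" by (rule sum.cong) (auto simp: star_mult_range_sum)
  finally show ?thesis by (simp add: is_projection_def star_sum star_mult star_star)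
qed

lemma qt_range_sum:
  assumes qt: "lsc_quasitrace_on (*) star \<tau>"
  shows "\<tau> (\<Sum>i\<in>I. v i * star (v i)) = (\<Sum>i\<in>I. \<tau> (q i))"
proof -
  have "J \<subseteq> I \<Longrightarrow> \<tau> (\<Sum>i\<in>J. v i * star (v i)) = (\<Sum>i\<in>J. \<tau> (q i))" if "finite J" for J
    using that
  proof (induction J)
    case (insert i J)
    have z: "star (v i) * v j = 0" "star (v j) * v i = 0" if "j \<in> J" for j
      using insert that orthogonal_systemD[OF orth, of i j] orthogonal_systemD[OF orth, of j i] by auto
    have l: "v i * star (v i) * (\<Sum>j\<in>J. v j * star (v j)) = 0"
      unfolding sum_distrib_left
    proof (rule sum.neutral, intro ballI)
      fix j assume "j \<in> J"
      have "v i * star (v i) * (v j * star (v j)) = v i * (star (v i) * v j) * star (v j)"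
        by (simp only: mult.assoc)
      then show "v i * star (v i) * (v j * star (v j)) = 0" using z(1)[OF \<open>j \<in> J\<close>] by simp
    qed
    have r: "(\<Sum>j\<in>J. v j * star (v j)) * (v i * star (v i)) = 0"
      unfolding sum_distrib_right
    proof (rule sum.neutral, intro ballI)
      fix j assume "j \<in> J"
      have "v j * star (v j) * (v i * star (v i)) = v j * (star (v j) * v i) * star (v i)"
        by (simp only: mult.assoc)
      then show "v j * star (v j) * (v i * star (v i)) = 0" using z(2)[OF \<open>j \<in> J\<close>] by simp
    qed
    have "\<tau> (v i * star (v i) + (\<Sum>j\<in>J. v j * star (v j))) = \<tau> (v i * star (v i)) + \<tau> (\<Sum>j\<in>J. v j * star (v j))"
      by (rule qt_add[OF qt]) (auto simp: l r intro!: Pos_sum)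
    moreover have "\<tau> (v i * star (v i)) = \<tau> (q i)"
      using qt_star[OF qt, of "v i"] orthogonal_systemD[OF orth, of i i] insert by simp
    ultimately show ?case using insert by simp
  qed (simp add: qt_zero[OF qt])
  then show ?thesis using fin by blast
qed

end

text \<open>Each v n is cut from B n compressed by 1 - F, where F is the sum of the earlier ranges.
  The left units G n record in which spectral subspace the ranges lie: G n fixes B m for all m \<le>
  n, hence all v built so far.\<close>

lemma orthogonal_system_exists:
  fixes q B G :: "nat \<Rightarrow> 'a::cstar_algebra"
  assumes proj: "\<And>n. n \<ge> N \<Longrightarrow> is_projection (q n)"
    and B: "\<And>n. n \<ge> N \<Longrightarrow> B n \<in> Pos"
    and GB: "\<And>m n. N \<le> m \<Longrightarrow> m \<le> n \<Longrightarrow> G n * B m = B m"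
    and le: "\<And>n v F. N \<le> n \<Longrightarrow> orthogonal_system q {N..<n} v \<Longrightarrow> F = (\<Sum>i\<in>{N..<n}. v i * star (v i)) \<Longrightarrow>
       cuntz_le (q n) (B n - F * B n - B n * F + F * B n * F)"
  obtains v where "orthogonal_system q {N..} v" "\<And>i n. N \<le> i \<Longrightarrow> i \<le> n \<Longrightarrow> G n * v i = v i"
proof -
  \<comment> \<open>The condition on r as the n-th value, in terms of earlier values of v only.
    Below N nothing is asked, so that the recursion may run over all naturals.\<close>
  define P where "P v n r \<longleftrightarrow> (N \<le> n \<longrightarrow> (\<forall>i\<in>{N..<n}. star (v i) * r = 0) \<and> star r * r = q n \<and>
      (\<forall>m\<ge>n. G m * r = r))" for v n r
  have "\<exists>v. \<forall>n. P v n (v n)"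
  proof (rule dependent_wf_choice[of less_than])
    fix f g :: "nat \<Rightarrow> 'a" and n r
    assume "\<And>m. (m, n) \<in> less_than \<Longrightarrow> f m = g m"
    then show "P f n r = P g n r" by (auto simp: P_def)
  next
    fix n f assume IH: "\<And>m. (m, n) \<in> less_than \<Longrightarrow> P f m (f m)"
    show "\<exists>r. P f n r"
    proof (cases "N \<le> n")
      case True
      have orth: "orthogonal_system q {N..<n} f"
        unfolding orthogonal_system_def
      proof (intro ballI)
        fix i j assume i: "i \<in> {N..<n}" and j: "j \<in> {N..<n}"
        have lt: "star (f i) * f j = 0" if "i < j" "i \<in> {N..<n}" "j \<in> {N..<n}" for i j
          using IH[of j] that by (auto simp: P_def)
        have "star (f i) * f j = 0" if "j < i"
          using arg_cong[OF lt[OF that j i], of star] by (simp add: star_mult star_star)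
        moreover have "star (f i) * f i = q i" using IH[of i] i by (auto simp: P_def)
        ultimately show "star (f i) * f j = (if i = j then q i else 0)"
          using lt[OF _ i j] by (cases i j rule: linorder_cases) auto
      qed
      define F where "F = (\<Sum>i\<in>{N..<n}. f i * star (f i))"
      define c where "c = B n - F * B n - B n * F + F * B n * F"
      have Fp: "is_projection F"
        unfolding F_def by (rule is_projection_range_sum[OF _ orth]) (auto intro: proj)
      have cP: "c \<in> Pos" unfolding c_def using Fp B[OF True] by (intro Pos_compress) (auto simp: is_projection_def)
      obtain v where v: "star v * v = q n" "\<And>g. g * c = 0 \<Longrightarrow> g * v = 0" "\<And>g. g * c = c \<Longrightarrow> g * v = v"
        using cuntz_le_partial_isometry[OF proj[OF True] cP le[OF True orth F_def, folded c_def]] by blast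
      have "star (f i) * v = 0" if i: "i \<in> {N..<n}" for i
      proof (rule v(2))
        have "star (f i) * F = star (f i)"
          unfolding F_def by (rule star_mult_range_sum[OF _ orth _ i]) (auto intro: proj)
        then show "star (f i) * c = 0"
          by (simp add: c_def distrib_left right_diff_distrib flip: mult.assoc)
      qed
      moreover have "G m * v = v" if m: "n \<le> m" for m
      proof (rule v(3))
        have "G m * F = F"
          unfolding F_def sum_distrib_left
        proof (rule sum.cong)
          fix i assume "i \<in> {N..<n}"
          then have "G m * f i = f i" using IH[of i] m by (auto simp: P_def)
          then show "G m * (f i * star (f i)) = f i * star (f i)" by (simp flip: mult.assoc)
        qed simp
        then show "G m * c = c"
          using GB[OF True m] by (simp add: c_def distrib_left right_diff_distrib flip: mult.assoc)
      qed
      ultimately show ?thesis using v(1) unfolding P_def by blast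
    qed (simp add: P_def)
  qed simp
  then obtain v where v: "\<And>n. P v n (v n)" by blast
  have lt: "star (v i) * v j = 0" if "i < j" "N \<le> i" for i j
    using v[of j] that by (auto simp: P_def)
  show ?thesis
  proof (rule that[of v])
    show "orthogonal_system q {N..} v"
      unfolding orthogonal_system_def
    proof (intro ballI)
      fix i j assume i: "i \<in> {N..}" and j: "j \<in> {N..}"
      have "star (v i) * v j = 0" if "j < i"
        using arg_cong[OF lt[OF that], of star] j by (simp add: star_mult star_star)
      moreover have "star (v i) * v i = q i" using v[of i] i by (auto simp: P_def)
      ultimately show "star (v i) * v j = (if i = j then q i else 0)"
        using lt[of i j] i by (cases i j rule: linorder_cases) auto
    qed
    show "G n * v i = v i" if "N \<le> i" "i \<le> n" for i n
      using v[of i] that by (auto simp: P_def)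
  qed
qed

section \<open>Weighted sums of partial isometries\<close>

text \<open>By the C*-identity the square of the norm of a block of the sum for x is the norm of the
  same block of the sum for T, so convergence of the latter suffices.\<close>

lemma weighted_sum_exists:
  fixes q v :: "nat \<Rightarrow> 'a::cstar_algebra"
  assumes proj: "\<And>n. N \<le> n \<Longrightarrow> is_projection (q n)"
    and qorth: "\<And>i j. N \<le> i \<Longrightarrow> N \<le> j \<Longrightarrow> i \<noteq> j \<Longrightarrow> q i * q j = 0"
    and orth: "orthogonal_system q {N..} v"
    and w: "\<And>n. N \<le> n \<Longrightarrow> 0 \<le> w n" and T: "(\<lambda>M. \<Sum>i\<in>{N..<N+M}. w i *\<^sub>R q i) \<longlonglongrightarrow> T"
    and le: "\<And>M. (\<Sum>i\<in>{N..<N+M}. w i *\<^sub>R (v i * star (v i))) \<preceq> U"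
  obtains x where "star x * x = T" "x * star x \<preceq> U"
proof -
  define X where "X I = (\<Sum>i\<in>I. sqrt (w i) *\<^sub>R v i)" for I
  have XX: "star (X I) * X I = (\<Sum>i\<in>I. w i *\<^sub>R q i)" if "finite I" "I \<subseteq> {N..}" for I
  proof -
    have "star (X I) * X I = (\<Sum>i\<in>I. \<Sum>j\<in>I. (sqrt (w j) * sqrt (w i)) *\<^sub>R (star (v i) * v j))"
      by (simp add: X_def star_sum star_scaleR sum_product)
    also have "\<dots> = (\<Sum>i\<in>I. \<Sum>j\<in>I. if j = i then w i *\<^sub>R q i else 0)"
      using orthogonal_systemD[OF orth] that w by (intro sum.cong refl) (auto simp: subset_eq)
    finally show ?thesis using that by simp
  qed
  have vq: "v k * q k = v k" if "N \<le> k" for k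
    using orthogonal_systemD[OF orth, of k k] proj[OF that] that by (intro partial_isometry_right) auto
  have vv: "v i * star (v j) = 0" if "N \<le> i" "N \<le> j" "i \<noteq> j" for i j
  proof -
    have "v i * star (v j) = (v i * q i) * star (v j * q j)" using vq that by simp
    also have "\<dots> = v i * (q i * q j) * star (v j)"
      using proj[OF that(2)] by (simp add: star_mult is_projection_def mult.assoc)
    finally show ?thesis using qorth[OF that] by simp
  qed
  have XXs: "X I * star (X I) = (\<Sum>i\<in>I. w i *\<^sub>R (v i * star (v i)))" if "finite I" "I \<subseteq> {N..}" for I
  proof -
    have "X I * star (X I) = (\<Sum>i\<in>I. \<Sum>j\<in>I. (sqrt (w j) * sqrt (w i)) *\<^sub>R (v i * star (v j)))"
      by (simp add: X_def star_sum star_scaleR sum_product)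
    also have "\<dots> = (\<Sum>i\<in>I. \<Sum>j\<in>I. if j = i then w i *\<^sub>R (v i * star (v i)) else 0)"
      using vv that w by (intro sum.cong refl) (auto simp: subset_eq)
    finally show ?thesis using that by simp
  qed
  let ?X = "\<lambda>M. X {N..<N+M}"
  let ?T = "\<lambda>M. \<Sum>i\<in>{N..<N+M}. w i *\<^sub>R q i"
  have split: "sum f {N..<N+M} - sum f {N..<N+k} = sum f {N+k..<N+M}" if "k \<le> M" for f :: "nat \<Rightarrow> 'a" and k M
    using sum.atLeastLessThan_concat[of N "N+k" "N+M" f] that by (simp add: algebra_simps)
  have nX: "(norm (?X M - ?X k))\<^sup>2 = norm (?T M - ?T k)" if "k \<le> M" for k M
  proof -
    have "?X M - ?X k = X {N+k..<N+M}" using split[OF that] by (simp add: X_def)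
    moreover have "{N+k..<N+M} \<subseteq> {N..}" by auto
    ultimately show ?thesis using XX[of "{N+k..<N+M}"] by (simp add: split[OF that] cstar_identity[symmetric])
  qed
  have "Cauchy ?X"
  proof (rule CauchyI')
    fix e :: real assume e: "e > 0"
    have "Cauchy ?T" using T LIMSEQ_imp_Cauchy by blast
    then obtain m where m: "\<And>k M. k \<ge> m \<Longrightarrow> M \<ge> m \<Longrightarrow> norm (?T k - ?T M) < e\<^sup>2"
      using CauchyD[of ?T "e\<^sup>2"] e by auto
    show "\<exists>m. \<forall>k\<ge>m. \<forall>M>k. dist (?X k) (?X M) < e"
    proof (intro exI[of _ m] allI impI)
      fix k M assume "m \<le> k" "k < M"
      then have "(norm (?X M - ?X k))\<^sup>2 < e\<^sup>2" using nX[of k M] m[of M k] by simp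
      then have "norm (?X M - ?X k) < e" using e by (meson power_less_imp_less_base less_imp_le)
      then show "dist (?X k) (?X M) < e" by (simp add: dist_norm norm_minus_commute)
    qed
  qed
  then obtain x where x: "?X \<longlonglongrightarrow> x" using Cauchy_convergent convergent_def by blast
  show ?thesis
  proof (rule that[of x])
    have "(\<lambda>M. star (?X M) * ?X M) \<longlonglongrightarrow> star x * x" by (intro tendsto_mult tendsto_star x)
    moreover have "star (?X M) * ?X M = ?T M" for M by (rule XX) auto
    ultimately show "star x * x = T" using T by (simp add: LIMSEQ_unique)
    have "(\<lambda>M. U - ?X M * star (?X M)) \<longlonglongrightarrow> U - x * star x"
      by (intro tendsto_diff tendsto_const tendsto_mult tendsto_star x)
    moreover have "U - ?X M * star (?X M) \<in> Pos" for M
      using le[of M] XXs[of "{N..<N+M}"] by (simp add: cstar_le_def subset_eq)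
    ultimately show "x * star x \<preceq> U" unfolding cstar_le_def by (rule Pos_limit[rotated])
  qed
qed

lemma projection_le_square:
  assumes F: "is_projection F" and G: "star G = G" "G * F = (F::'a::cstar_algebra)"
  shows "F \<preceq> G * G"
proof -
  have F': "star F = F" "F * F = F" using F by (auto simp: is_projection_def)
  have "F * G = F" using arg_cong[OF G(2), of star] by (simp add: star_mult F' G(1))
  then have "star (G - F) * (G - F) = G * G - F"
    by (simp add: star_diff F' G algebra_simps)
  then show ?thesis by (metis cstar_le_def Pos_star_mult)
qed

text \<open>Abel summation against the projections \<open>F\<^sub>M = \<Sum>\<^sub>i\<^sub>\<le>\<^sub>M v\<^sub>i v\<^sub>i\<^sup>*\<close>, each of which lies below
  \<open>g\<^sub>M(b)\<^sup>2\<close>: where \<open>g\<^sub>M\<close> does not vanish, \<open>w\<^sub>M \<le> h\<close>, so the increments of \<open>min w\<^sub>M h\<close>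
  dominate.\<close>

lemma weighted_range_sum_le:
  fixes q v :: "nat \<Rightarrow> 'a::cstar_algebra"
  assumes proj: "\<And>n. N \<le> n \<Longrightarrow> is_projection (q n)" and orth: "orthogonal_system q {N..} v"
    and w: "\<And>n. N \<le> n \<Longrightarrow> 0 \<le> w n" and wdec: "\<And>n. N \<le> n \<Longrightarrow> w (Suc n) \<le> w n"
    and b: "b \<in> Pos" and g: "\<And>n. N \<le> n \<Longrightarrow> fc (g n)" and g01: "\<And>n t. N \<le> n \<Longrightarrow> 0 \<le> g n t \<and> g n t \<le> 1"
    and gv: "\<And>i n. N \<le> i \<Longrightarrow> i \<le> n \<Longrightarrow> cfc (g n) b * v i = v i"
    and h: "fc h" "\<And>t. 0 \<le> t \<Longrightarrow> 0 \<le> h t"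
    and gh: "\<And>n t. N \<le> n \<Longrightarrow> 0 \<le> t \<Longrightarrow> g n t \<noteq> 0 \<Longrightarrow> w n \<le> h t"
  shows "(\<Sum>i\<in>{N..<N+M}. w i *\<^sub>R (v i * star (v i))) \<preceq> cfc h b"
proof -
  \<comment> \<open>Weights cut off from N + M on: the last term u (N+M) F of the Abel summation is
    then 0.\<close>
  define u where "u i = (if i < N + M then w i else 0)" for i
  have u: "0 \<le> u n" "u (Suc n) \<le> u n" if "N \<le> n" for n
    using w[OF that] wdec[OF that] by (auto simp: u_def)
  define F where "F M = (\<Sum>i\<in>{N..N+M}. v i * star (v i))" for M
  define S where "S M = (\<Sum>i\<in>{N..N+M}. u i *\<^sub>R (v i * star (v i)))" for M
  define k where "k M t = min (u (N+M)) (h t)" for M t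
  have sb: "star b = b" by (rule Pos_sa[OF b])
  have kf: "fc (k M)" for M
    using h(1) u(1)[of "N+M"] by (auto simp: fc_def k_def intro!: continuous_intros)
  define G where "G M t = g (N+M) t * g (N+M) t" for M t
  define d where "d M = u (N+M) - u (Suc (N+M))" for M
  have gf: "fc (G M)" for M unfolding G_def by (intro fc_mult g) auto
  have Fle: "F M \<preceq> cfc (G M) b" for M
  proof -
    have "F M \<preceq> cfc (g (N+M)) b * cfc (g (N+M)) b"
    proof (rule projection_le_square)
      show "is_projection (F M)"
        unfolding F_def by (rule is_projection_range_sum[OF _ orthogonal_system_subset[OF orth]])
          (auto intro: proj)
      show "star (cfc (g (N+M)) b) = cfc (g (N+M)) b" by (rule star_cfc[OF g sb]) simp
      show "cfc (g (N+M)) b * F M = F M"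
        unfolding F_def sum_distrib_left
        by (rule sum.cong) (auto simp: gv simp flip: mult.assoc)
    qed
    then show ?thesis using cfc_mult[OF g g sb, of "N+M" "N+M"] by (simp add: G_def[abs_def])
  qed
  have gg: "0 \<le> G M t" "G M t \<le> 1" for M t
    using g01[of "N+M" t] by (auto simp: G_def mult_le_one)
  have d0: "0 \<le> d M" for M by (simp add: d_def u)
  \<comment> \<open>Passing from M to M + 1 adds d M times F M on the left and k M - k (Suc M) on
    the right.\<close>
  have ind: "S M - u (N+M) *\<^sub>R F M \<preceq> cfc (\<lambda>t. h t - k M t) b" for M
  proof (induction M)
    case 0
    have "0 \<preceq> cfc (\<lambda>t. h t - k 0 t) b"
      unfolding cstar_le_def using Pos_cfc_nonneg[OF b fc_diff[OF h(1) kf], of 0] by (simp add: k_def)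
    then show ?case by (simp add: S_def F_def)
  next
    case (Suc M)
    have "d M *\<^sub>R F M \<preceq> d M *\<^sub>R cfc (G M) b"
      by (rule cstar_le_scale[OF Fle d0])
    also have "\<dots> = cfc (\<lambda>t. d M * G M t) b"
      by (rule cfc_scale[OF gf sb, symmetric])
    finally have i1: "d M *\<^sub>R F M \<preceq> cfc (\<lambda>t. d M * G M t) b" .
    have i2: "cfc (\<lambda>t. d M * G M t) b \<preceq> cfc (\<lambda>t. k M t - k (Suc M) t) b"
    proof (rule cstar_le_cfc[OF b fc_const_mult[OF gf] fc_diff[OF kf kf]])
      fix t :: real assume t: "0 \<le> t"
      show "d M * G M t \<le> k M t - k (Suc M) t"
      proof (cases "g (N+M) t = 0")
        case False
        then have "u (N+M) \<le> h t" using gh[OF _ t] h(2)[OF t] by (simp add: u_def)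
        then have "k M t - k (Suc M) t = d M" using d0[of M] by (simp add: k_def d_def)
        then show ?thesis using mult_left_mono[OF gg(2) d0] by simp
      qed (use d0[of M] in \<open>simp add: k_def G_def d_def\<close>)
    qed
    have "(S M - u (N+M) *\<^sub>R F M) + d M *\<^sub>R F M
        \<preceq> cfc (\<lambda>t. h t - k M t) b + cfc (\<lambda>t. k M t - k (Suc M) t) b"
      by (rule cstar_le_add[OF Suc.IH cstar_le_trans[OF i1 i2]])
    also have "\<dots> = cfc (\<lambda>t. h t - k (Suc M) t) b"
      by (subst cfc_add[symmetric]) (auto intro!: fc_diff kf h sb)
    also have "(S M - u (N+M) *\<^sub>R F M) + d M *\<^sub>R F M
        = S (Suc M) - u (N + Suc M) *\<^sub>R F (Suc M)"
      by (simp add: S_def F_def d_def scaleR_left_diff_distrib scaleR_add_right)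
    finally show ?case .
  qed
  have "S M = (\<Sum>i\<in>{N..<N+M}. w i *\<^sub>R (v i * star (v i)))"
    unfolding S_def by (rule sum.mono_neutral_cong_right) (auto simp: u_def)
  moreover have "k M t = min 0 (h t)" for t by (simp add: k_def u_def)
  then have "cfc (\<lambda>t. h t - k M t) b = cfc h b"
    using h by (intro Pos_cfc_cong[OF b fc_diff[OF h(1) kf]]) auto
  ultimately show ?thesis using ind[of M] by (simp add: u_def)
qed

section \<open>Ideals\<close>

text \<open>Up to \<delta> the ratio is at most 1; beyond it the ratio is at most \<delta> / s, and
  s^(r-1) is decreasing.\<close>

lemma powr_mult_ratio_le:
  fixes s \<delta> r :: real
  assumes "0 \<le> s" "0 < \<delta>" "0 < r" "r \<le> 1"
  shows "s powr r * (\<delta> / (s + \<delta>)) \<le> \<delta> powr r"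
proof (cases "s \<le> \<delta>")
  case True
  have "s powr r * (\<delta> / (s + \<delta>)) \<le> \<delta> powr r * 1"
    using assms True by (intro mult_mono powr_mono2) auto
  then show ?thesis by simp
next
  case False
  then have s: "s > 0" using assms by simp
  have "s powr r * (\<delta> / (s + \<delta>)) \<le> s powr r * (\<delta> / s)"
    using assms s by (intro mult_left_mono divide_left_mono) auto
  also have "\<dots> = \<delta> * s powr (r - 1)" using s by (simp add: powr_diff)
  also have "\<dots> \<le> \<delta> * \<delta> powr (r - 1)"
    using assms False by (intro mult_left_mono powr_mono2') auto
  also have "\<dots> = \<delta> powr r" using assms by (simp add: powr_diff)
  finally show ?thesis .
qed

text \<open>A factorization \<open>x = f(c)\<^sup>1\<^sup>/\<^sup>2 z\<close>, where \<open>z = lim f\<^sup>1\<^sup>/\<^sup>2 (f + \<delta>)\<^sup>-\<^sup>1(c) x\<close>; the limit exists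
  because \<open>p > 1\<close>.\<close>

lemma factor_through_sqrt:
  fixes x c :: "'a::cstar_algebra"
  assumes c: "c \<in> Pos" and f: "fc f" "\<And>t. 0 \<le> f t" and p: "1 < p" "p \<le> 2" and K: "0 \<le> K"
    and x: "x * star x \<preceq> K *\<^sub>R cfc (\<lambda>t. f t powr p) c"
  obtains z where "x = cfc (\<lambda>t. sqrt (f t)) c * z"
proof -
  have sc: "star c = c" by (rule Pos_sa[OF c])
  have fp: "fc (\<lambda>t. f t powr p)"
  proof -
    have "continuous_on UNIV (\<lambda>t. f t powr p)"
      using f p by (intro continuous_on_powr' continuous_on_const) (auto simp: fc_def)
    then show ?thesis using f p by (simp add: fc_def)
  qed
  have conj: "norm (y * star y) \<le> K * B" if y: "y = cfc u c * x" and u: "fc u"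
    and B: "\<And>t. u t * f t powr p * u t \<le> B" for y u B
  proof -
    have su: "star (cfc u c) = cfc u c" by (rule star_cfc[OF u sc])
    have "y * star y = star (cfc u c) * (x * star x) * cfc u c"
      by (simp add: y star_mult su mult.assoc)
    also have "\<dots> \<preceq> star (cfc u c) * (K *\<^sub>R cfc (\<lambda>t. f t powr p) c) * cfc u c"
      by (rule cstar_le_conj[OF x])
    also have "\<dots> = K *\<^sub>R cfc (\<lambda>t. u t * f t powr p * u t) c"
      by (simp add: su cfc_mult u fp fc_mult sc)
    finally have "norm (y * star y) \<le> norm (K *\<^sub>R cfc (\<lambda>t. u t * f t powr p * u t) c)"
      by (rule norm_mono[rotated]) simp
    also have "\<dots> \<le> K * B"
      unfolding norm_scaleR abs_of_nonneg[OF K]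
    proof (intro mult_left_mono norm_cfc_le[OF _ sc] K)
      show "fc (\<lambda>t. u t * f t powr p * u t)" by (intro fc_mult u fp)
      fix t
      have "u t * f t powr p * u t = (u t * u t) * f t powr p" by (simp only: ac_simps)
      also have "\<dots> \<ge> 0" by simp
      finally show "\<bar>u t * f t powr p * u t\<bar> \<le> B" using B[of t] by simp
    qed
    finally show ?thesis .
  qed
  define \<delta> where "\<delta> n = 1 / (real n + 1)" for n
  have \<delta>: "\<delta> n > 0" for n by (simp add: \<delta>_def)
  have \<delta>lim: "\<delta> \<longlonglongrightarrow> 0"
    unfolding \<delta>_def[abs_def] by (rule inverse_Suc_tendsto_0)
  \<comment> \<open>1/2 + p/2 = q + 1, so h n times f^(p/2) is f^q f / (f + \<delta>). Its distance
    from f^q is at most \<delta>^q, which tends to 0 as q > 0.\<close>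
  define q where "q = (p - 1) / 2"
  have q: "0 < q" "q \<le> 1" using p by (auto simp: q_def)
  define h where "h n t = sqrt (f t) / (f t + \<delta> n)" for n t
  have fd: "f t + \<delta> n \<noteq> 0" for n t using f(2)[of t] \<delta>[of n] by linarith
  have hf: "fc (h n)" for n
    using f fd unfolding fc_def h_def by (auto intro!: continuous_intros)
  have hq: "h n t * f t powr (p/2) = f t powr q - f t powr q * (\<delta> n / (f t + \<delta> n))" for n t
  proof (cases "f t = 0")
    case False
    then have ft: "f t > 0" using f(2)[of t] by simp
    have "sqrt (f t) * f t powr (p/2) = f t powr q * f t"
    proof -
      have "sqrt (f t) * f t powr (p/2) = f t powr (1/2 + p/2)"
        using ft by (simp add: powr_add powr_half_sqrt)
      also have "1/2 + p/2 = q + 1" by (simp add: q_def field_simps)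
      finally show ?thesis using ft by (simp add: powr_add)
    qed
    then have "h n t * f t powr (p/2) = f t powr q * (f t / (f t + \<delta> n))" by (simp add: h_def)
    also have "f t / (f t + \<delta> n) = 1 - \<delta> n / (f t + \<delta> n)" using fd by (simp add: field_simps)
    finally show ?thesis by (simp add: algebra_simps)
  qed (use q p in simp)
  have sq: "s * f t powr p * s = (s * f t powr (p/2))\<^sup>2" for s t
    by (simp add: power2_eq_square powr_add[symmetric] mult_ac)
  define z where "z n = cfc (h n) c * x" for n
  have zd: "norm (z n - z m) \<le> sqrt K * (\<delta> n powr q + \<delta> m powr q)" for n m
  proof -
    have "norm ((z n - z m) * star (z n - z m)) \<le> K * (\<delta> n powr q + \<delta> m powr q)\<^sup>2"
    proof (rule conj)
      show "z n - z m = cfc (\<lambda>t. h n t - h m t) c * x"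
        by (simp add: z_def cfc_diff hf sc left_diff_distrib)
      show "fc (\<lambda>t. h n t - h m t)" by (intro fc_diff hf)
      fix t
      let ?a = "\<lambda>n. f t powr q * (\<delta> n / (f t + \<delta> n))"
      have a: "0 \<le> ?a n" "?a n \<le> \<delta> n powr q" for n
        using powr_mult_ratio_le[OF f(2) \<delta> q] f(2)[of t] \<delta>[of n] by (auto intro!: mult_nonneg_nonneg divide_nonneg_nonneg)
      have "(h n t - h m t) * f t powr (p/2) = ?a m - ?a n"
        by (simp add: left_diff_distrib hq)
      moreover have "(?a m - ?a n)\<^sup>2 \<le> (\<delta> n powr q + \<delta> m powr q)\<^sup>2"
        using a[of n] a[of m] by (intro abs_le_square_iff[THEN iffD1]) auto
      ultimately show "(h n t - h m t) * f t powr p * (h n t - h m t) \<le> (\<delta> n powr q + \<delta> m powr q)\<^sup>2"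
        by (simp add: sq)
    qed
    then have "(norm (z n - z m))\<^sup>2 \<le> (sqrt K * (\<delta> n powr q + \<delta> m powr q))\<^sup>2"
      using K by (simp add: cstar_identity' power_mult_distrib)
    then show ?thesis
      by (rule power2_le_imp_le) (use K in simp)
  qed
  have dq: "(\<lambda>n. sqrt K * (\<delta> n powr q)) \<longlonglongrightarrow> 0"
  proof -
    have "(\<lambda>n. \<delta> n powr q) \<longlonglongrightarrow> 0 powr q"
      using \<delta>lim q \<delta> by (intro tendsto_powr') (auto intro!: always_eventually less_imp_le)
    then show ?thesis using tendsto_mult_left[of _ "0 powr q" sequentially "sqrt K"] by simp
  qed
  have "Cauchy z"
  proof (rule CauchyI)
    fix e :: real assume "e > 0"
    then have "\<forall>\<^sub>F n in sequentially. sqrt K * (\<delta> n powr q) < e / 2"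
      using dq by (intro order_tendstoD) auto
    then obtain m where m: "\<And>n. n \<ge> m \<Longrightarrow> sqrt K * (\<delta> n powr q) < e / 2"
      by (auto simp: eventually_sequentially)
    show "\<exists>m. \<forall>k\<ge>m. \<forall>n\<ge>m. norm (z k - z n) < e"
    proof (intro exI[of _ m] allI impI)
      fix k n assume "m \<le> k" "m \<le> n"
      then show "norm (z k - z n) < e" using zd[of k n] m[of k] m[of n] by (simp add: distrib_left)
    qed
  qed
  then obtain Z where Z: "z \<longlonglongrightarrow> Z" using Cauchy_convergent convergent_def by blast
  have sf: "fc (\<lambda>t. sqrt (f t))" using f by (auto simp: fc_def intro!: continuous_intros)
  define S where "S = cfc (\<lambda>t. sqrt (f t)) c"
  have "norm (x - S * z n) \<le> sqrt K * \<delta> n powr (p/2)" for n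
  proof -
    define u where "u t = sqrt (f t) * h n t" for t
    have uf: "fc u" unfolding u_def by (intro fc_mult sf hf)
    have u: "u t = f t / (f t + \<delta> n)" for t using f(2)[of t] by (simp add: u_def h_def)
    have Sz: "S * z n = cfc u c * x"
      unfolding S_def z_def u_def using cfc_mult[OF sf hf sc, of n] by (simp add: mult.assoc)
    have "(norm (x - cfc u c * x))\<^sup>2 \<le> K * (\<delta> n powr (p/2))\<^sup>2"
    proof (rule norm_diff_cfc_mult_le[OF c uf fp K x])
      fix t
      have "1 - u t = \<delta> n / (f t + \<delta> n)" unfolding u using fd[of t n] by (simp add: field_simps)
      then have eq: "(1 - u t)\<^sup>2 * f t powr p = (f t powr (p/2) * (\<delta> n / (f t + \<delta> n)))\<^sup>2"
        using sq[of "1 - u t" t] by (simp add: power2_eq_square mult_ac)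
      have "f t powr (p/2) * (\<delta> n / (f t + \<delta> n)) \<le> \<delta> n powr (p/2)"
        by (rule powr_mult_ratio_le[OF f(2) \<delta>]) (use p in auto)
      moreover have "0 \<le> f t powr (p/2) * (\<delta> n / (f t + \<delta> n))"
        using f(2)[of t] \<delta>[of n] by (intro mult_nonneg_nonneg divide_nonneg_nonneg) auto
      ultimately show "\<bar>(1 - u t)\<^sup>2 * f t powr p\<bar> \<le> (\<delta> n powr (p/2))\<^sup>2"
        unfolding eq by (simp add: power_mono)
    qed
    then have "(norm (x - cfc u c * x))\<^sup>2 \<le> (sqrt K * \<delta> n powr (p/2))\<^sup>2"
      using K by (simp add: power_mult_distrib)
    then have "norm (x - cfc u c * x) \<le> sqrt K * \<delta> n powr (p/2)"
      by (rule power2_le_imp_le) (use K in simp)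
    then show ?thesis by (simp add: Sz)
  qed
  then have b: "norm (S * z n - x) \<le> sqrt K * \<delta> n powr (p/2)" for n
    by (simp add: norm_minus_commute)
  have "(\<lambda>n. \<delta> n powr (p/2)) \<longlonglongrightarrow> 0 powr (p/2)"
    using \<delta>lim p \<delta> by (intro tendsto_powr') (auto intro!: always_eventually less_imp_le)
  then have "(\<lambda>n. sqrt K * \<delta> n powr (p/2)) \<longlonglongrightarrow> 0"
    using tendsto_mult_left[of _ "0 powr (p/2)" sequentially "sqrt K"] by simp
  then have "(\<lambda>n. S * z n - x) \<longlonglongrightarrow> 0"
    by (rule Lim_null_comparison[rotated]) (simp add: b)
  then have "(\<lambda>n. S * z n) \<longlonglongrightarrow> x" by (simp add: LIM_zero_iff)
  moreover have "(\<lambda>n. S * z n) \<longlonglongrightarrow> S * Z" by (intro tendsto_mult tendsto_const Z)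
  ultimately have "x = S * Z" by (rule LIMSEQ_unique)
  then show ?thesis using that by (simp add: S_def)
qed

text \<open>If x = f(c)^(1/2) z then star x * x = star z * f(c) * z. Keeping f apart from c lets the
  result be used with f(c) a power of c.\<close>

lemma star_mult_self_in_ideal:
  fixes x c :: "'a::cstar_algebra"
  assumes J: "cstar_ideal J" and c: "c \<in> Pos" and f: "fc f" "\<And>t. 0 \<le> f t" "cfc f c \<in> J"
    and p: "1 < p" "p \<le> 2" and K: "0 \<le> K" and x: "x * star x \<preceq> K *\<^sub>R cfc (\<lambda>t. f t powr p) c"
  shows "star x * x \<in> J"
proof -
  obtain z where z: "x = cfc (\<lambda>t. sqrt (f t)) c * z"
    using factor_through_sqrt[OF c f(1,2) p K x] .
  have sf: "fc (\<lambda>t. sqrt (f t))" using f by (auto simp: fc_def intro!: continuous_intros)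
  have "star x * x = star z * (cfc (\<lambda>t. sqrt (f t)) c * cfc (\<lambda>t. sqrt (f t)) c) * z"
    by (simp add: z star_mult star_cfc[OF sf Pos_sa[OF c]] mult.assoc)
  also have "cfc (\<lambda>t. sqrt (f t)) c * cfc (\<lambda>t. sqrt (f t)) c = cfc f c"
    by (simp add: cfc_mult[OF sf sf Pos_sa[OF c], symmetric] f(2))
  finally show ?thesis using J f(3) by (simp add: cstar_ideal_def)
qed

lemma cstar_ideal_diff:
  assumes "cstar_ideal J" "x \<in> J" "y \<in> J"
  shows "x - y \<in> J"
proof -
  have "(-1) *\<^sub>C y \<in> J" using assms unfolding cstar_ideal_def by blast
  then have "- y \<in> J" by (simp add: scaleC_minus_left scaleC_one)
  then have "x + - y \<in> J" using assms unfolding cstar_ideal_def by blast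
  then show ?thesis by simp
qed

text \<open>Every y is a linear combination of the positive and negative parts of its real and
  imaginary parts.\<close>

lemma ideal_conj_all:
  assumes J: "cstar_ideal J" and P: "\<And>y. y \<in> Pos \<Longrightarrow> a * y * a \<in> J"
  shows "a * y * (a::'a::cstar_algebra) \<in> J"
proof -
  have sa: "a * h * a \<in> J" if h: "star h = h" for h
  proof -
    have "cfc (\<lambda>t. max t 0) h \<in> Pos" "cfc (\<lambda>t. max (- t) 0) h \<in> Pos"
      using h by (auto intro!: Pos_cfc)
    then have "a * cfc (\<lambda>t. max t 0) h * a - a * cfc (\<lambda>t. max (- t) 0) h * a \<in> J"
      by (intro cstar_ideal_diff[OF J] P)
    also have "a * cfc (\<lambda>t. max t 0) h * a - a * cfc (\<lambda>t. max (- t) 0) h * a = a * h * a"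
      by (subst (3) cfc_pos_neg_parts[OF h]) (simp add: left_diff_distrib right_diff_distrib)
    finally show ?thesis .
  qed
  define y1 where "y1 = (1/2) *\<^sub>R (y + star y)"
  define y2 where "y2 = (1/2) *\<^sub>R (\<i> *\<^sub>C (star y - y))"
  have ii: "\<i> *\<^sub>C \<i> *\<^sub>C v = - v" for v :: 'a
    by (simp add: scaleC_scaleC scaleC_minus_left scaleC_one)
  have "star y1 = y1" by (simp add: y1_def star_scaleR star_add star_star add.commute)
  moreover have "star y2 = y2"
    by (simp add: y2_def star_scaleR star_scaleC star_diff star_star scaleC_minus_left scaleC_diff_right)
  ultimately have "a * y1 * a \<in> J" "a * y2 * a \<in> J" by (auto intro: sa)
  moreover have "y1 + \<i> *\<^sub>C y2 = y"
    by (simp add: y1_def y2_def scaleC_scaleR_commute ii scaleR_add_right[symmetric] scaleR_2[symmetric])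
  then have "a * y * a = a * y1 * a + \<i> *\<^sub>C (a * y2 * a)"
    by (metis distrib_left distrib_right mult_scaleC_left mult_scaleC_right)
  ultimately show ?thesis using J unfolding cstar_ideal_def by metis
qed

text \<open>The set \<open>K\<close> of all \<open>z\<close> with \<open>z a\<close> and \<open>z A a\<close> in \<open>J\<close> is an ideal containing \<open>a\<close>, and so is
  the set \<open>I\<close> of all \<open>z \<in> K\<close> that \<open>K\<close> multiplies into \<open>J\<close> in the same sense; finally \<open>I\<^sup>2 \<subseteq> J\<close>.\<close>

lemma semiprime_ideal_mem:
  assumes J: "semiprime_ideal J" and aa: "a * a \<in> J" and aya: "\<And>y. a * y * a \<in> J"
  shows "(a::'a::cstar_algebra) \<in> J"
proof -
  define K where "K = {z. z * a \<in> J \<and> (\<forall>y. z * y * a \<in> J)}"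
  define I where "I = {z \<in> K. \<forall>w\<in>K. w * z \<in> J \<and> (\<forall>y. w * y * z \<in> J)}"
  have id: "cstar_ideal J" using J by (simp add: semiprime_ideal_def)
  have J0: "0 \<in> J" and Jadd: "\<And>x y. x \<in> J \<Longrightarrow> y \<in> J \<Longrightarrow> x + y \<in> J"
    and Jsc: "\<And>c x. x \<in> J \<Longrightarrow> c *\<^sub>C x \<in> J" and Jr: "\<And>x y. x \<in> J \<Longrightarrow> x * y \<in> J" and Jl: "\<And>x y. x \<in> J \<Longrightarrow> y * x \<in> J"
    using id by (auto simp: cstar_ideal_def)
  have K: "cstar_ideal K"
    unfolding cstar_ideal_def
  proof (intro conjI ballI allI)
    show "0 \<in> K" by (simp add: K_def J0)
    show "x + y \<in> K" if "x \<in> K" "y \<in> K" for x y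
      using that by (auto simp: K_def distrib_right intro!: Jadd)
    show "c *\<^sub>C x \<in> K" if "x \<in> K" for c x
      using that by (auto simp: K_def mult_scaleC_left intro!: Jsc)
    show "x * y \<in> K" if "x \<in> K" for x y
    proof -
      have "x * (y * u) * a \<in> J" for u using that by (simp add: K_def)
      then show ?thesis using that by (simp add: K_def mult.assoc)
    qed
    show "y * x \<in> K" if "x \<in> K" for x y
    proof -
      have "y * (x * a) \<in> J" "y * (x * u * a) \<in> J" for u
        using that by (simp_all add: K_def Jl)
      then show ?thesis by (simp add: K_def mult.assoc)
    qed
  qed
  have aK: "a \<in> K" using aa aya by (simp add: K_def)
  have "cstar_ideal I"
    unfolding cstar_ideal_def
  proof (intro conjI ballI allI)
    show "0 \<in> I" using K by (simp add: I_def J0 cstar_ideal_def)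
    show "x + y \<in> I" if "x \<in> I" "y \<in> I" for x y
      using that K by (auto simp: I_def cstar_ideal_def distrib_left intro!: Jadd)
    show "c *\<^sub>C x \<in> I" if "x \<in> I" for c x
      using that K by (auto simp: I_def cstar_ideal_def mult_scaleC_right intro!: Jsc)
    show "x * y \<in> I" if "x \<in> I" for x y
    proof -
      have "w * x * y \<in> J" "w * u * x * y \<in> J" if "w \<in> K" for w u
        using that \<open>x \<in> I\<close> by (simp_all add: I_def Jr)
      moreover have "x * y \<in> K" using that K by (auto simp: I_def cstar_ideal_def)
      ultimately show ?thesis by (simp add: I_def mult.assoc)
    qed
    show "y * x \<in> I" if "x \<in> I" for x y
    proof -
      have "w * y * x \<in> J" "w * (u * y) * x \<in> J" if "w \<in> K" for w u
        using that \<open>x \<in> I\<close> unfolding I_def by blast+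
      moreover have "y * x \<in> K" using that K by (auto simp: I_def cstar_ideal_def)
      ultimately show ?thesis by (simp add: I_def mult.assoc)
    qed
  qed
  moreover have "{x * y | x y. x \<in> I \<and> y \<in> I} \<subseteq> J" by (auto simp: I_def)
  ultimately have "I \<subseteq> J" using J by (simp add: semiprime_ideal_def)
  moreover have "a \<in> I" using aK by (auto simp: I_def K_def)
  ultimately show ?thesis by blast
qed

section \<open>Diagonal elements\<close>

text \<open>Compressing r - p \<ge> 0 by 1 - r leaves - (1 - r) p (1 - r), which can only be
  positive if p (1 - r) = 0.\<close>

lemma projection_le_mult:
  assumes "is_projection p" "is_projection r" "p \<preceq> (r::'a::cstar_algebra)"
  shows "p * r = p" "r * p = p"
proof -
  have p: "star p = p" "p * p = p" and r: "star r = r" "r * r = r"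
    using assms by (auto simp: is_projection_def)
  have pp: "p * (p * y) = p * y" and rr: "r * (r * y) = r * y" for y
    using p(2) r(2) by (metis mult.assoc)+
  have "(r - p) - r * (r - p) - (r - p) * r + r * (r - p) * r \<in> Pos"
    using assms(3) by (intro Pos_compress r) (simp add: cstar_le_def)
  moreover have "(r - p) - r * (r - p) - (r - p) * r + r * (r - p) * r
      = - (star (p - p * r) * (p - p * r))"
    by (simp add: star_diff star_mult p r pp rr algebra_simps)
  ultimately have "star (p - p * r) * (p - p * r) = 0"
    using Pos_minus_eq_0 Pos_star_mult by metis
  then have "p - p * r = 0" by (simp add: star_mult_self_eq_0)
  then show pr: "p * r = p" by simp
  show "r * p = p" using arg_cong[OF pr, of star] by (simp add: star_mult p r)
qed

context
  fixes p :: "nat \<Rightarrow> 'a::cstar_algebra"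
  assumes unit: "projection_approx_unit p" and p0: "p 0 = 0"
begin

lemma unit_projection: "is_projection (p n)"
  using unit p0 by (cases "n = 0") (auto simp: projection_approx_unit_def)

lemma unit_mult: "i \<le> j \<Longrightarrow> p i * p j = p i \<and> p j * p i = p i"
proof (induction j)
  case 0
  then show ?case by (simp add: p0)
next
  case (Suc j)
  show ?case
  proof (cases "i = Suc j")
    case True
    then show ?thesis using unit_projection[of i] by (simp add: is_projection_def)
  next
    case False
    then have IH: "p i * p j = p i" "p j * p i = p i" using Suc by auto
    have "p j \<preceq> p (Suc j)"
      using unit is_projection_Pos[OF unit_projection[of 1]] p0
      by (cases "j = 0") (auto simp: projection_approx_unit_def cstar_le_def)
    then have "p j * p (Suc j) = p j" "p (Suc j) * p j = p j"
      by (intro projection_le_mult unit_projection; assumption)+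
    then show ?thesis using IH by (metis mult.assoc)
  qed
qed

lemma scale_diff_projection: "is_projection (scale_diff p n)"
proof -
  have "p n * p n = p n" "star (p n) = p n" "star (p (n - 1)) = p (n - 1)" "p (n - 1) * p (n - 1) = p (n - 1)"
    using unit_projection[of n] unit_projection[of "n - 1"] by (auto simp: is_projection_def)
  then show ?thesis using unit_mult[of "n - 1" n]
    by (simp add: is_projection_def scale_diff_def star_diff left_diff_distrib right_diff_distrib)
qed

lemma scale_diff_orth:
  assumes "i \<noteq> j"
  shows "scale_diff p i * scale_diff p j = 0"
proof -
  have "scale_diff p i * scale_diff p j = 0 \<and> scale_diff p j * scale_diff p i = 0" if "i < j" for i j
    using that unit_mult[of i j] unit_mult[of "i - 1" j] unit_mult[of i "j - 1"] unit_mult[of "i - 1" "j - 1"]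
    by (simp add: scale_diff_def left_diff_distrib right_diff_distrib)
  then show ?thesis using assms by (metis linorder_neqE_nat)
qed

lemma sum_scale_diff: "m \<le> n \<Longrightarrow> (\<Sum>i\<in>{m+1..<n+1}. scale_diff p i) = p n - p m"
  by (induction n) (auto simp: scale_diff_def le_Suc_eq)

lemma qt_unit_Suc:
  assumes qt: "lsc_quasitrace_on (*) star \<tau>" and n: "1 \<le> n"
  shows "\<tau> (p n) = \<tau> (p (n - 1)) + \<tau> (scale_diff p n)"
proof -
  have "\<tau> (p (n - 1) + scale_diff p n) = \<tau> (p (n - 1)) + \<tau> (scale_diff p n)"
    using unit_mult[of "n - 1" n]
    by (intro qt_add[OF qt] is_projection_Pos unit_projection scale_diff_projection)
      (simp add: scale_diff_def left_diff_distrib right_diff_distrib)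
  then show ?thesis by (simp add: scale_diff_def)
qed

lemma qt_unit_sum:
  assumes qt: "lsc_quasitrace_on (*) star \<tau>" and "m \<le> n"
  shows "\<tau> (p n) = \<tau> (p m) + (\<Sum>i\<in>{m+1..<n+1}. \<tau> (scale_diff p i))"
  using assms(2)
proof (induction n)
  case (Suc n)
  have "\<tau> (p (Suc n)) = \<tau> (p n) + \<tau> (scale_diff p (Suc n))"
    using qt_unit_Suc[OF qt, of "Suc n"] by simp
  then show ?case using Suc by (auto simp: le_Suc_eq add.assoc)
qed simp

lemma qt_unit_diff:
  assumes qt: "lsc_quasitrace_on (*) star \<tau>" and "m \<le> n"
  shows "\<tau> (p n) = \<tau> (p m) + \<tau> (p n - p m)"
proof -
  have "\<tau> (p m + (p n - p m)) = \<tau> (p m) + \<tau> (p n - p m)"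
  proof (intro qt_add[OF qt] is_projection_Pos unit_projection)
    show "is_projection (p n - p m)"
      using unit_mult[OF assms(2)] unit_projection[of n] unit_projection[of m]
      by (simp add: is_projection_def star_diff left_diff_distrib right_diff_distrib)
  qed (use unit_mult[OF assms(2)] in \<open>simp add: left_diff_distrib right_diff_distrib\<close>)
  then show ?thesis by simp
qed

end

context
  fixes q :: "nat \<Rightarrow> 'a::cstar_algebra" and \<alpha> :: "nat \<Rightarrow> real" and N :: nat and a :: 'a
  assumes proj: "\<And>i. is_projection (q i)" and orth: "\<And>i j. i \<noteq> j \<Longrightarrow> q i * q j = 0"
    and lim: "(\<lambda>M. \<Sum>i\<in>{N..<N+M}. \<alpha> i *\<^sub>R q i) \<longlonglongrightarrow> a"
begin

lemma diagonal_mult: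
  assumes i: "N \<le> i"
  shows "a * q i = \<alpha> i *\<^sub>R q i"
proof -
  have "(\<lambda>M. (\<Sum>j\<in>{N..<N+M}. \<alpha> j *\<^sub>R q j) * q i) \<longlonglongrightarrow> a * q i"
    by (intro tendsto_mult lim tendsto_const)
  moreover have "\<forall>\<^sub>F M in sequentially. (\<Sum>j\<in>{N..<N+M}. \<alpha> j *\<^sub>R q j) * q i = \<alpha> i *\<^sub>R q i"
  proof (rule eventually_sequentiallyI[of "Suc i"])
    fix M assume M: "Suc i \<le> M"
    have "(\<Sum>j\<in>{N..<N+M}. \<alpha> j *\<^sub>R q j) * q i = (\<Sum>j\<in>{N..<N+M}. if j = i then \<alpha> i *\<^sub>R q i else 0)"
      unfolding sum_distrib_right
      by (rule sum.cong) (use orth proj[of i] in \<open>auto simp: is_projection_def\<close>)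
    then show "(\<Sum>j\<in>{N..<N+M}. \<alpha> j *\<^sub>R q j) * q i = \<alpha> i *\<^sub>R q i" using i M by simp
  qed
  ultimately show ?thesis
    by (rule LIMSEQ_unique[OF _ tendsto_eventually])
qed

text \<open>On a partial sum the calculus acts entrywise, since the sum of its q i is a right unit
  for it; \<open>tendsto_cfc\<close> then passes to the limit.\<close>

lemma diagonal_cfc_tendsto:
  assumes f: "fc f"
  shows "(\<lambda>M. \<Sum>i\<in>{N..<N+M}. f (\<alpha> i) *\<^sub>R q i) \<longlonglongrightarrow> cfc f a"
proof -
  let ?S = "\<lambda>M. \<Sum>i\<in>{N..<N+M}. \<alpha> i *\<^sub>R q i" and ?Q = "\<lambda>M. \<Sum>i\<in>{N..<N+M}. q i"
  have sS: "star (?S M) = ?S M" for M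
    using proj by (simp add: star_sum star_scaleR is_projection_def)
  have Sq: "?S M * q i = \<alpha> i *\<^sub>R q i" if "i \<in> {N..<N+M}" for i M
  proof -
    have "?S M * q i = (\<Sum>j\<in>{N..<N+M}. if j = i then \<alpha> i *\<^sub>R q i else 0)"
      unfolding sum_distrib_right
      by (rule sum.cong) (use orth proj[of i] in \<open>auto simp: is_projection_def\<close>)
    then show ?thesis using that by simp
  qed
  have "?S M * ?Q M = ?S M" for M
    unfolding sum_distrib_left by (rule sum.cong[OF refl Sq])
  then have "cfc f (?S M) = cfc f (?S M) * ?Q M" for M
    by (rule cfc_mult_right_unit[OF f sS, symmetric])
  also have "cfc f (?S M) * ?Q M = (\<Sum>i\<in>{N..<N+M}. f (\<alpha> i) *\<^sub>R q i)" for M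
    unfolding sum_distrib_left by (rule sum.cong[OF refl cfc_eigen[OF f sS Sq]])
  finally show ?thesis using tendsto_cfc[OF f sS lim] by simp
qed

lemma diagonal_Pos:
  assumes "\<And>i. N \<le> i \<Longrightarrow> 0 \<le> \<alpha> i"
  shows "a \<in> Pos"
  by (rule Pos_limit[OF _ lim]) (auto intro!: Pos_sum Pos_scale is_projection_Pos[OF proj] assms)

text \<open>The function k is 1 from s on, so k(a) fixes the projection, and k^2 is at most a
  multiple of (u - t)_+. Thus the projection lies below a multiple of the cut.\<close>

lemma dim_fun_diagonal_ge:
  assumes qt: "lsc_2_quasitrace \<tau>" and \<alpha>: "\<And>i. N \<le> i \<Longrightarrow> 0 \<le> \<alpha> i"
    and Q: "is_projection (\<Sum>i\<in>I. q i)" and I: "I \<subseteq> {N..}"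
    and t: "0 \<le> t" "t < s" "\<And>i. i \<in> I \<Longrightarrow> s \<le> \<alpha> i"
  shows "\<tau> (\<Sum>i\<in>I. q i) \<le> dim_fun \<tau> (pos_cut a t)"
proof -
  define k where "k u = min 1 (max (u - t) 0 / (s - t))" for u
  have aP: "a \<in> Pos" by (rule diagonal_Pos[OF \<alpha>])
  have sa: "star a = a" by (rule Pos_sa[OF aP])
  have k: "fc k" using t by (auto simp: fc_def k_def intro!: continuous_intros)
  have k01: "0 \<le> k u" "k u \<le> 1" for u using t by (auto simp: k_def)
  have cut: "fc (\<lambda>u. max (u - t) 0)" using t by simp
  let ?Q = "\<Sum>i\<in>I. q i"
  have "cfc k a * ?Q = ?Q"
    unfolding sum_distrib_left
  proof (rule sum.cong[OF refl])
    fix i assume i: "i \<in> I"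
    then have "k (\<alpha> i) = 1" using t(1,2) t(3)[OF i] by (simp add: k_def)
    moreover have "a * q i = \<alpha> i *\<^sub>R q i" using i I by (intro diagonal_mult) auto
    ultimately show "cfc k a * q i = q i" using cfc_eigen[OF k sa, of "q i" "\<alpha> i"] by simp
  qed
  then have "?Q \<preceq> cfc k a * cfc k a" by (rule projection_le_square[OF Q star_cfc[OF k sa]])
  also have "cfc k a * cfc k a = cfc (\<lambda>u. k u * k u) a" by (rule cfc_mult[OF k k sa, symmetric])
  finally have 1: "?Q \<preceq> cfc (\<lambda>u. k u * k u) a" .
  have 2: "cfc (\<lambda>u. k u * k u) a \<preceq> cfc (\<lambda>u. 1 / (s - t) * max (u - t) 0) a"
  proof (rule cstar_le_cfc[OF aP fc_mult[OF k k] fc_const_mult[OF cut]])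
    fix u
    have "k u * k u \<le> k u * 1" using k01 by (intro mult_left_mono) auto
    also have "\<dots> \<le> 1 / (s - t) * max (u - t) 0" by (simp add: k_def)
    finally show "k u * k u \<le> 1 / (s - t) * max (u - t) 0" .
  qed
  have "?Q \<preceq> (1 / (s - t)) *\<^sub>R pos_cut a t"
    using cstar_le_trans[OF 1 2] by (simp only: cfc_scale[OF cut sa] pos_cut_def)
  then have "dim_fun \<tau> (star ?Q * ?Q) \<le> dim_fun \<tau> (pos_cut a t)"
    using Q t by (intro dim_fun_star_mult_le[OF qt, of _ "1 / (s - t)"])
      (auto simp: pos_cut_def is_projection_def intro!: Pos_cfc sa)
  then show ?thesis using Q dim_fun_projection[OF Q, of \<tau>] by (simp add: is_projection_def)
qed

end

section \<open>Spectral cuts and singular values\<close>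

lemma pos_cut_Pos: "a \<in> Pos \<Longrightarrow> 0 \<le> t \<Longrightarrow> pos_cut a t \<in> Pos"
  unfolding pos_cut_def by (rule Pos_cfc) (auto simp: Pos_sa)

lemma dim_fun_pos_cut_mono:
  assumes "lsc_2_quasitrace \<tau>" "b \<in> Pos" "0 \<le> s" "s \<le> t"
  shows "dim_fun \<tau> (pos_cut b t) \<le> dim_fun \<tau> (pos_cut b s)"
proof (rule dim_fun_mono[OF assms(1)])
  show "pos_cut b t \<preceq> pos_cut b s"
    unfolding pos_cut_def using assms by (intro cstar_le_cfc) auto
qed (use assms in \<open>auto intro: pos_cut_Pos\<close>)

lemma dim_fun_gt_if_less_sing_val:
  assumes b: "b \<in> Pos" and t: "0 \<le> t" "t < sing_val \<tau> s b"
  shows "ennreal s < dim_fun \<tau> (pos_cut b t)"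
proof (rule ccontr)
  assume "\<not> ?thesis"
  then have "t \<in> {t. 0 \<le> t \<and> dim_fun \<tau> (pos_cut (cstar_abs b) t) \<le> ennreal s}"
    using t by (simp add: cstar_abs_Pos[OF b])
  then have "sing_val \<tau> s b \<le> t"
    unfolding sing_val_def by (rule cInf_lower) (auto intro: bdd_belowI[of _ 0])
  then show False using t by simp
qed

lemma sing_val_ge:
  assumes qt: "lsc_2_quasitrace \<tau>" and a: "a \<in> Pos"
    and gt: "\<And>t. 0 \<le> t \<Longrightarrow> t < r \<Longrightarrow> ennreal s < dim_fun \<tau> (pos_cut a t)"
  shows "r \<le> sing_val \<tau> s a"
  unfolding sing_val_def cstar_abs_Pos[OF a]
proof (rule cInf_greatest)
  \<comment> \<open>The level norm a shows that the infimum is taken over a nonempty set.\<close>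
  have "pos_cut a (norm a) = cfc (\<lambda>t. 0) a"
    unfolding pos_cut_def by (rule cfc_cong) auto
  then have "pos_cut a (norm a) = 0" by (simp add: cfc_zero_fun Pos_sa[OF a])
  moreover have "dim_fun \<tau> 0 = 0"
    using dim_fun_projection[OF is_projection_0, of \<tau>] qt qt_zero[of \<tau>]
    by (simp add: lsc_2_quasitrace_def)
  ultimately have "norm a \<in> {t. 0 \<le> t \<and> dim_fun \<tau> (pos_cut a t) \<le> ennreal s}" by simp
  then show "{t. 0 \<le> t \<and> dim_fun \<tau> (pos_cut a t) \<le> ennreal s} \<noteq> {}" by blast
  fix t assume "t \<in> {t. 0 \<le> t \<and> dim_fun \<tau> (pos_cut a t) \<le> ennreal s}"
  then show "r \<le> t" using gt[of t] by (auto simp: not_less[symmetric])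
qed

theorem theorem4p7:
  fixes T :: "('a::cstar_algebra \<Rightarrow> ennreal) set"
    and p :: "nat \<Rightarrow> 'a" and a b e :: 'a
    and \<rho> \<epsilon>\<^sub>0 C L :: real
    and \<Theta> :: "nat \<Rightarrow> nat" and N :: nat and \<alpha> :: "nat \<Rightarrow> real"
  assumes "nonunital TYPE('a)"
    and "admissible_scale T p \<rho> e \<epsilon>\<^sub>0"
    and "strict_mono_on {1..} \<Theta>" and "\<forall>n\<ge>1. n < \<Theta> n"
    and "\<forall>n\<ge>1. 0 < \<alpha> n" and "\<forall>n\<ge>1. \<alpha> (Suc n) \<le> \<alpha> n" and "\<alpha> \<longlonglongrightarrow> 0"
    and "(\<lambda>k. \<alpha> (N + 1 + k) *\<^sub>R scale_diff p (N + 1 + k)) sums a"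
    and "regular_tail_bound \<Theta> N \<alpha> L"
    and "b \<in> Pos" and "0 < C"
    and inf_part: "T_inf T p \<noteq> {} \<Longrightarrow>
           (\<forall>n\<ge>1. \<forall>\<tau>\<in>T_inf T p. 2 * \<tau> (p n) + ennreal \<rho> \<le> \<tau> (p (\<Theta> n))) \<and>
           (\<forall>s>0. \<forall>\<tau>\<in>T_inf T p. sing_val \<tau> s a \<le> C * sing_val \<tau> s b)"
    and fin_part: "T_fin T p \<noteq> {} \<Longrightarrow>
           \<alpha> (N + 1) / (2 * C) < \<epsilon>\<^sub>0 \<and>
           (\<forall>\<tau>\<in>T_fin T p.
              (SUP j\<in>{1..}. \<tau> (p j)) - \<tau> (p N) + ennreal \<rho> < dim_fun \<tau> (pos_cut b \<epsilon>\<^sub>0))"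
  shows "(\<exists>x. star x * x = a * a \<and>
              x * star x \<preceq> (4 * C\<^sup>2 * L\<^sup>2 * norm b) *\<^sub>R b) \<and>
         (\<forall>J. semiprime_ideal J \<and> b \<in> J \<inter> Pos \<longrightarrow> a \<in> J)"
proof -
  have adm: "projection_approx_unit p" "p 0 = 0" "\<And>n. n \<ge> 1 \<Longrightarrow> scale_diff p n \<noteq> 0"
    "\<And>\<tau>. \<tau> \<in> T \<Longrightarrow> lsc_2_quasitrace \<tau>" "\<And>\<tau>. \<tau> \<in> T \<Longrightarrow> faithful \<tau>" "0 \<le> \<rho>" "0 < \<epsilon>\<^sub>0"
    "\<And>n c. n \<ge> 1 \<Longrightarrow> c \<in> Pos \<Longrightarrow> (\<And>\<tau>. \<tau> \<in> T \<Longrightarrow> dim_fun \<tau> (scale_diff p n) + ennreal \<rho> < dim_fun \<tau> c)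
       \<Longrightarrow> cuntz_le (scale_diff p n) c"
    "\<And>n. T_inf T p \<noteq> {} \<Longrightarrow> n \<ge> 1 \<Longrightarrow> (SUP \<tau>\<in>T_inf T p. \<tau> (p n)) < \<infinity>"
    using assms(2) unfolding admissible_scale_def by blast+
  have b: "b \<in> Pos" and C: "0 < C" by fact+
  have \<Theta>: "n < \<Theta> n" if "1 \<le> n" for n using assms(4) that by blast
  have \<Theta>mono: "\<Theta> m \<le> \<Theta> n" if "1 \<le> m" "m \<le> n" for m n
    using assms(3) that by (metis atLeast_iff le_less order_trans strict_mono_onD)
  have \<alpha>0: "0 < \<alpha> n" if "1 \<le> n" for n using assms(5) that by blast
  have \<alpha>dec: "\<alpha> n \<le> \<alpha> m" if "1 \<le> m" "m \<le> n" for m n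
    using that(2)
  proof (induction rule: dec_induct)
    case (step k)
    then have "\<alpha> (Suc k) \<le> \<alpha> k" using assms(6) that(1) by simp
    then show ?case using step by simp
  qed simp
  have L: "0 < L" and \<alpha>L: "\<alpha> n \<le> L * \<alpha> (\<Theta> n)" if "N + 1 \<le> n" for n
  proof -
    show "0 < L" using assms(9) by (simp add: regular_tail_bound_def)
    have "1 \<le> \<Theta> n" using \<Theta>[of n] that by simp
    moreover have "\<alpha> n / \<alpha> (\<Theta> n) \<le> L" using assms(9) that unfolding regular_tail_bound_def by blast
    ultimately show "\<alpha> n \<le> L * \<alpha> (\<Theta> n)" using \<alpha>0[of "\<Theta> n"] by (simp add: pos_divide_le_eq)
  qed
  note L = L[OF order_refl]
  define q where "q = scale_diff p"
  note proj = scale_diff_projection[OF adm(1,2), folded q_def]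
  note orth = scale_diff_orth[OF adm(1,2), folded q_def]
  have lim: "(\<lambda>M. \<Sum>i\<in>{N+1..<N+1+M}. \<alpha> i *\<^sub>R q i) \<longlonglongrightarrow> a"
  proof -
    have "(\<Sum>k<M. \<alpha> (N + 1 + k) *\<^sub>R q (N + 1 + k)) = (\<Sum>i\<in>{N+1..<N+1+M}. \<alpha> i *\<^sub>R q i)" for M
      using sum.shift_bounds_nat_ivl[of "\<lambda>i. \<alpha> i *\<^sub>R q i" 0 "N+1" M]
      by (simp add: atLeast0LessThan add.commute add.left_commute)
    then show ?thesis using assms(8) by (simp add: sums_def q_def)
  qed
  have aP: "a \<in> Pos" using \<alpha>0 by (intro diagonal_Pos[OF proj orth lim]) (auto intro: less_imp_le)

  have T_cases: "\<tau> \<in> T_fin T p \<or> \<tau> \<in> T_inf T p" if "\<tau> \<in> T" for \<tau>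
  proof (cases "(SUP n\<in>{1..}. \<tau> (p n)) = \<infinity>")
    case False
    then have "(SUP n\<in>{1..}. \<tau> (p n)) < \<infinity>" unfolding infinity_ennreal_def less_top .
    then show ?thesis using that unfolding T_fin_def by blast
  qed (use that in \<open>unfold T_inf_def, blast\<close>)
  have qt: "lsc_quasitrace_on (*) star \<tau>" if "\<tau> \<in> T" for \<tau>
    using adm(4)[OF that] by (simp add: lsc_2_quasitrace_def)
  have fin: "\<tau> (p n) < \<infinity>" if "\<tau> \<in> T" for \<tau> n
  proof (cases "n = 0")
    case True
    then show ?thesis using qt_zero[OF qt[OF that]] adm(2) by simp
  next
    case False
    show ?thesis
    proof (cases "\<tau> \<in> T_fin T p")
      case True
      have "\<tau> (p n) \<le> (SUP n\<in>{1..}. \<tau> (p n))" using False by (intro SUP_upper) simp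
      then show ?thesis using True by (auto simp: T_fin_def intro: le_less_trans)
    next
      case F: False
      then have "\<tau> \<in> T_inf T p" using T_cases that by blast
      then have "\<tau> (p n) \<le> (SUP \<tau>\<in>T_inf T p. \<tau> (p n))" "T_inf T p \<noteq> {}" by (auto intro: SUP_upper)
      then show ?thesis using adm(9)[of n] False by (auto intro: le_less_trans)
    qed
  qed
  have qpos: "0 < \<tau> (q n)" if "\<tau> \<in> T" "1 \<le> n" for \<tau> n
    using adm(3)[OF that(2)] adm(5)[OF that(1)] is_projection_Pos[OF proj[of n]]
    by (auto simp: faithful_def q_def zero_less_iff_neq_zero)

  \<comment> \<open>\<eta> is the ratio t n / r n. Below 2 it keeps t n under \<alpha> (\<Theta> n)
    / C; the last bound, available since \<alpha> (N + 1) / (2 C) < \<epsilon>_0, keeps t n at most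
    \<epsilon>_0.\<close>
  obtain \<eta> where \<eta>: "1 < \<eta>" "\<eta> < 2" "T_fin T p \<noteq> {} \<Longrightarrow> \<eta> * \<alpha> (N + 1) / (2 * C) \<le> \<epsilon>\<^sub>0"
  proof (cases "T_fin T p = {}")
    case True
    then show ?thesis using that[of "3/2"] by simp
  next
    case False
    have pos: "0 < \<alpha> (N + 1) / (2 * C)" using \<alpha>0[of "N+1"] C by simp
    define x where "x = \<alpha> (N + 1) / (2 * C)"
    define \<eta> where "\<eta> = min (3/2) (\<epsilon>\<^sub>0 / x)"
    have "1 < \<epsilon>\<^sub>0 / x" using fin_part[OF False] pos by (simp only: x_def less_divide_eq_1_pos)
    then have "1 < \<eta>" "\<eta> < 2" by (auto simp: \<eta>_def)
    have "\<eta> * x \<le> \<epsilon>\<^sub>0 / x * x" using pos by (intro mult_right_mono) (auto simp: \<eta>_def x_def)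
    moreover have "x \<noteq> 0" using pos by (auto simp: x_def)
    ultimately have "\<eta> * x \<le> \<epsilon>\<^sub>0" by simp
    then show ?thesis using that[OF \<open>1 < \<eta>\<close> \<open>\<eta> < 2\<close>] by (simp add: x_def)
  qed
  define r where "r n = \<alpha> (\<Theta> n) / (2 * C)" for n
  define t where "t n = \<eta> * r n" for n
  have \<Theta>1: "1 \<le> \<Theta> n" if "1 \<le> n" for n using \<Theta>[OF that] that by simp
  have r0: "0 < r n" if "1 \<le> n" for n using \<alpha>0[OF \<Theta>1[OF that]] C by (simp add: r_def)
  have rt: "r n < t n" if "1 \<le> n" for n using r0[OF that] \<eta>(1) by (simp add: t_def)
  have tdec: "t n \<le> t m" if "1 \<le> m" "m \<le> n" for m n
  proof -
    have "\<alpha> (\<Theta> n) \<le> \<alpha> (\<Theta> m)" using that by (intro \<alpha>dec \<Theta>1 \<Theta>mono)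
    then show ?thesis unfolding t_def r_def using \<eta>(1) C
      by (intro mult_left_mono divide_right_mono) auto
  qed

  \<comment> \<open>The room for q n at level t n. \<tau>(p N) is put on the right because
    subtraction in \<open>ennreal\<close> is truncated; it is finite and can be cancelled.\<close>
  have dim: "\<tau> (p n) + ennreal \<rho> < dim_fun \<tau> (pos_cut b (t n)) + \<tau> (p N)"
    if \<tau>: "\<tau> \<in> T" and n: "N + 1 \<le> n" for \<tau> n
  proof (cases "\<tau> \<in> T_fin T p")
    case True
    then have ne: "T_fin T p \<noteq> {}" by blast
    define S where "S = (SUP j\<in>{1..}. \<tau> (p j))"
    have "\<alpha> (\<Theta> n) \<le> \<alpha> (N + 1)" using \<Theta>[of n] n by (intro \<alpha>dec) auto
    then have "t n \<le> \<eta> * \<alpha> (N + 1) / (2 * C)"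
      using \<eta>(1) C by (simp add: t_def r_def divide_right_mono mult_left_mono)
    then have "t n \<le> \<epsilon>\<^sub>0" using \<eta>(3)[OF ne] by linarith
    have "0 \<le> t n" using rt[of n] r0[of n] n by simp
    have nS: "\<tau> (p n) \<le> S" unfolding S_def using n by (intro SUP_upper) simp
    have "\<tau> (p N) \<le> \<tau> (p n)" using qt_unit_diff[OF adm(1,2) qt[OF \<tau>], of N n] n by simp
    then have "S = (S - \<tau> (p N)) + \<tau> (p N)" using nS by (metis diff_add_cancel_ennreal order_trans)
    then have "\<tau> (p n) + ennreal \<rho> \<le> (S - \<tau> (p N) + ennreal \<rho>) + \<tau> (p N)"
      using nS by (metis add.assoc add.commute add_right_mono)
    also have "\<dots> < dim_fun \<tau> (pos_cut b \<epsilon>\<^sub>0) + \<tau> (p N)"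
    proof -
      have "S - \<tau> (p N) + ennreal \<rho> < dim_fun \<tau> (pos_cut b \<epsilon>\<^sub>0)"
        using fin_part[OF ne] True by (auto simp: S_def)
      then show ?thesis using fin[OF \<tau>, of N]
        by (subst (1 2) add.commute) (auto simp: ennreal_add_left_cancel_less)
    qed
    also have "\<dots> \<le> dim_fun \<tau> (pos_cut b (t n)) + \<tau> (p N)"
      using dim_fun_pos_cut_mono[OF adm(4)[OF \<tau>] b \<open>0 \<le> t n\<close> \<open>t n \<le> \<epsilon>\<^sub>0\<close>] by (rule add_right_mono)
    finally show ?thesis .
  next
    case False
    then have inf: "\<tau> \<in> T_inf T p" and ne: "T_inf T p \<noteq> {}" using T_cases[OF \<tau>] by auto
    define P where "P k = enn2real (\<tau> (p k))" for k
    have P: "\<tau> (p k) = ennreal (P k)" for k using fin[OF \<tau>, of k] by (simp add: P_def)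
    have P0: "0 \<le> P k" for k by (simp add: P_def)
    have n1: "1 \<le> n" using n by simp
    have "\<tau> (p N) \<le> \<tau> (p (n - 1))" using qt_unit_diff[OF adm(1,2) qt[OF \<tau>], of N "n - 1"] n by simp
    also have "\<dots> < \<tau> (p n)"
      using qt_unit_Suc[OF adm(1,2) qt[OF \<tau>] n1] qpos[OF \<tau> n1] fin[OF \<tau>, of "n - 1"]
        ennreal_add_left_cancel_less[of "\<tau> (p (n - 1))" 0 "\<tau> (q n)"]
      by (simp add: q_def)
    finally have PNn: "P N < P n" using P0 by (simp add: P ennreal_less_iff)
    have "2 * \<tau> (p n) + ennreal \<rho> \<le> \<tau> (p (\<Theta> n))" using inf_part[OF ne] inf n1 by blast
    also have "2 * \<tau> (p n) + ennreal \<rho> = ennreal (2 * P n + \<rho>)"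
      using P0 adm(6) by (simp add: P ennreal_mult)
    finally have P\<Theta>: "2 * P n + \<rho> \<le> P (\<Theta> n)" using P0 by (simp add: P)
    \<comment> \<open>The dimension that b must exceed at level t n. Singular values are compared
      for s > 0 only, and faithfulness, through \<tau>(q n) > 0, makes s positive even if \<rho> =
      0.\<close>
    define s where "s = P n - P N + \<rho>"
    have s: "0 < s" using PNn adm(6) by (simp add: s_def)
    have "\<alpha> (\<Theta> n) \<le> sing_val \<tau> s a"
    proof (rule sing_val_ge[OF adm(4)[OF \<tau>] aP])
      fix t' assume t': "0 \<le> t'" "t' < \<alpha> (\<Theta> n)"
      have N\<Theta>: "N \<le> \<Theta> n" using \<Theta>[OF n1] n by simp
      have sum: "(\<Sum>i\<in>{N+1..<\<Theta> n+1}. q i) = p (\<Theta> n) - p N"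
        using sum_scale_diff[OF adm(1,2) N\<Theta>] by (simp add: q_def)
      have "ennreal (P (\<Theta> n)) = ennreal (P N) + \<tau> (p (\<Theta> n) - p N)"
        using qt_unit_diff[OF adm(1,2) qt[OF \<tau>] N\<Theta>] by (simp add: P)
      then have "\<tau> (p (\<Theta> n) - p N) = ennreal (P (\<Theta> n) - P N)"
        using P0 by (metis ennreal_add_diff_cancel_left ennreal_minus ennreal_neq_top)
      \<comment> \<open>P n > 0 turns 2 P n + \<rho> \<le> P (\<Theta> n) into the strict P n +
        \<rho> < P (\<Theta> n).\<close>
      moreover have "s < P (\<Theta> n) - P N" using P\<Theta> PNn P0[of N] by (simp add: s_def)
      ultimately have "ennreal s < \<tau> (\<Sum>i\<in>{N+1..<\<Theta> n+1}. q i)"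
        unfolding sum using s by (simp add: ennreal_less_iff)
      also have "\<dots> \<le> dim_fun \<tau> (pos_cut a t')"
      proof (rule dim_fun_diagonal_ge[OF proj orth lim adm(4)[OF \<tau>] _ _ _ t'])
        show "0 \<le> \<alpha> i" if "N + 1 \<le> i" for i using \<alpha>0[of i] that by simp
        show "is_projection (\<Sum>i\<in>{N+1..<\<Theta> n+1}. q i)"
          unfolding sum using unit_mult[OF adm(1,2) N\<Theta>] unit_projection[OF adm(1,2), of N]
            unit_projection[OF adm(1,2), of "\<Theta> n"]
          by (simp add: is_projection_def star_diff left_diff_distrib right_diff_distrib)
        show "\<alpha> (\<Theta> n) \<le> \<alpha> i" if "i \<in> {N+1..<\<Theta> n+1}" for i using that by (intro \<alpha>dec) auto
      qed auto
      finally show "ennreal s < dim_fun \<tau> (pos_cut a t')" .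
    qed
    also have "\<dots> \<le> C * sing_val \<tau> s b" using inf_part[OF ne] s inf by blast
    finally have "\<alpha> (\<Theta> n) / C \<le> sing_val \<tau> s b" using C by (simp add: pos_divide_le_eq mult.commute)
    moreover have "t n < 2 * r n" using \<eta>(2) r0[OF n1] by (simp add: t_def)
    then have "t n < \<alpha> (\<Theta> n) / C" by (simp add: r_def)
    moreover have "0 \<le> t n" using rt[OF n1] r0[OF n1] by simp
    ultimately have "ennreal s < dim_fun \<tau> (pos_cut b (t n))"
      by (intro dim_fun_gt_if_less_sing_val[OF b]) auto
    then have "ennreal s + \<tau> (p N) < dim_fun \<tau> (pos_cut b (t n)) + \<tau> (p N)"
      using fin[OF \<tau>, of N] by (subst (1 2) add.commute) (auto simp: ennreal_add_left_cancel_less)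
    moreover have "ennreal s + \<tau> (p N) = \<tau> (p n) + ennreal \<rho>"
      using s P0 adm(6) by (simp add: P s_def flip: ennreal_plus)
    ultimately show ?thesis by simp
  qed

  \<comment> \<open>0 up to r n and 1 from t n on. As t decreases, g n (b) is a left unit for all
    cuts (b - t m)_+ with m \<le> n.\<close>
  define g where "g n s = min 1 (max ((s - r n) / (t n - r n)) 0)" for n s
  have gf: "fc (g n)" if "1 \<le> n" for n
    using rt[OF that] r0[OF that] by (auto simp: fc_def g_def divide_nonpos_pos intro!: continuous_intros)
  have g1: "g n s = 1" if "1 \<le> n" "t n \<le> s" for n s
    using rt[OF that(1)] that(2) by (simp add: g_def)
  have sb: "star b = b" by (rule Pos_sa[OF b])
  obtain v where v: "orthogonal_system q {N+1..} v" "\<And>i n. N + 1 \<le> i \<Longrightarrow> i \<le> n \<Longrightarrow> cfc (g n) b * v i = v i"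
  proof (rule orthogonal_system_exists[of "N+1" q "\<lambda>n. pos_cut b (t n)" "\<lambda>n. cfc (g n) b"])
    fix n assume "N + 1 \<le> n"
    then show "pos_cut b (t n) \<in> Pos" using rt[of n] r0[of n] by (intro pos_cut_Pos b) simp
  next
    fix m n assume mn: "N + 1 \<le> m" "m \<le> n"
    have "0 \<le> t m" using rt[of m] r0[of m] mn by simp
    then have "cfc (g n) b * pos_cut b (t m) = cfc (\<lambda>s. g n s * max (s - t m) 0) b"
      unfolding pos_cut_def using mn by (intro cfc_mult[symmetric] gf sb) auto
    also have "(\<lambda>s. g n s * max (s - t m) 0) = (\<lambda>s. max (s - t m) 0)"
    proof
      fix s show "g n s * max (s - t m) 0 = max (s - t m) 0"
        using g1[of n s] tdec[of m n] mn by (cases "t m \<le> s") auto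
    qed
    finally show "cfc (g n) b * pos_cut b (t m) = pos_cut b (t m)" by (simp add: pos_cut_def)
  next
    fix n v F assume n: "N + 1 \<le> n" and v: "orthogonal_system q {N+1..<n} v"
      and F: "F = (\<Sum>i\<in>{N+1..<n}. v i * star (v i))"
    define B where "B = pos_cut b (t n)"
    have BP: "B \<in> Pos" unfolding B_def using rt[of n] r0[of n] n by (intro pos_cut_Pos b) simp
    have Fp: "is_projection F" unfolding F by (rule is_projection_range_sum[OF proj v]) auto
    show "cuntz_le (q n) (pos_cut b (t n) - F * pos_cut b (t n) - pos_cut b (t n) * F + F * pos_cut b (t n) * F)"
      unfolding q_def B_def[symmetric]
    proof (rule adm(8))
      show "B - F * B - B * F + F * B * F \<in> Pos"
        using Fp by (intro Pos_compress BP) (simp add: is_projection_def)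
      fix \<tau> assume \<tau>: "\<tau> \<in> T"
      let ?c = "dim_fun \<tau> (B - F * B - B * F + F * B * F)"
      have n1: "1 \<le> n" using n by simp
      have "\<tau> F = (\<Sum>i\<in>{N+1..<n}. \<tau> (q i))"
        unfolding F by (rule qt_range_sum[OF proj v _ qt[OF \<tau>]]) auto
      then have Fn: "\<tau> (p (n - 1)) = \<tau> (p N) + \<tau> F"
        using qt_unit_sum[OF adm(1,2) qt[OF \<tau>], of N "n - 1"] n by (simp add: q_def)
      \<comment> \<open>The comparison is made after adding \<tau>(p (n - 1)) = \<tau>(p N) +
        \<tau>(F), which accounts for the ranges already used.\<close>
      have "\<tau> (q n) + ennreal \<rho> + \<tau> (p (n - 1)) = \<tau> (p n) + ennreal \<rho>"
        using qt_unit_Suc[OF adm(1,2) qt[OF \<tau>] n1] by (simp add: q_def ac_simps)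
      also have "\<dots> < dim_fun \<tau> B + \<tau> (p N)" unfolding B_def by (rule dim[OF \<tau> n])
      also have "\<dots> \<le> ?c + \<tau> F + \<tau> (p N)"
        using dim_fun_compress[OF adm(4)[OF \<tau>] BP Fp] by (rule add_right_mono)
      also have "\<dots> = ?c + \<tau> (p (n - 1))" by (simp only: Fn ac_simps)
      finally have "\<tau> (q n) + ennreal \<rho> < ?c"
        by (meson add_right_mono leD leI)
      then show "dim_fun \<tau> (scale_diff p n) + ennreal \<rho> < ?c"
        using dim_fun_projection[OF proj[of n], of \<tau>] by (simp add: q_def)
    qed (use n in simp)
  qed (use proj in auto)

  have powf: "fc (\<lambda>s. (c * max s 0) powr k)" if "0 < k" "0 \<le> c" for c k
  proof -
    have "continuous_on UNIV (\<lambda>s. (c * max s 0) powr k)"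
      using that by (intro continuous_on_powr' continuous_intros) auto
    then show ?thesis using that by (simp add: fc_def)
  qed
  \<comment> \<open>The same v serves every exponent. The factor 1 gives both functions the form (c
    max(s, 0))^k, so that \<open>powf\<close> and \<open>sq\<close> cover both.\<close>
  have ex: "\<exists>x. star x * x = cfc (\<lambda>s. (1 * max s 0) powr k) a \<and>
      x * star x \<preceq> cfc (\<lambda>s. (2 * C * L * max s 0) powr k) b" if k: "0 < k" for k
  proof -
    have lim': "(\<lambda>M. \<Sum>i\<in>{N+1..<N+1+M}. (1 * max (\<alpha> i) 0) powr k *\<^sub>R q i) \<longlonglongrightarrow> cfc (\<lambda>s. (1 * max s 0) powr k) a"
      by (rule diagonal_cfc_tendsto[OF proj orth lim powf[OF k zero_le_one]])
    obtain x where "star x * x = cfc (\<lambda>s. (1 * max s 0) powr k) a"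
        "x * star x \<preceq> cfc (\<lambda>s. (2 * C * L * max s 0) powr k) b"
    proof (rule weighted_sum_exists[OF proj orth v(1) _ lim'])
      fix M
      show "(\<Sum>i\<in>{N+1..<N+1+M}. (1 * max (\<alpha> i) 0) powr k *\<^sub>R (v i * star (v i)))
          \<preceq> cfc (\<lambda>s. (2 * C * L * max s 0) powr k) b"
      proof (rule weighted_range_sum_le[OF proj v(1) _ _ b])
        fix n assume n: "N + 1 \<le> n"
        then have n1: "1 \<le> n" by simp
        show "(1 * max (\<alpha> (Suc n)) 0) powr k \<le> (1 * max (\<alpha> n) 0) powr k"
          using \<alpha>dec[of n "Suc n"] \<alpha>0[of n] \<alpha>0[of "Suc n"] k n by (intro powr_mono2) auto
        show "fc (g n)" by (rule gf[OF n1])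
        show "0 \<le> g n s \<and> g n s \<le> 1" for s by (simp add: g_def)
        fix s :: real assume s: "0 \<le> s" "g n s \<noteq> 0"
        have "r n < s"
          using s(2) rt[OF n1] by (rule_tac ccontr) (auto simp: g_def divide_nonpos_pos max_def split: if_splits)
        have "\<alpha> n \<le> 2 * C * L * r n" using \<alpha>L[OF n] C by (simp add: r_def)
        also have "\<dots> \<le> 2 * C * L * s" using \<open>r n < s\<close> C L by (intro mult_left_mono) auto
        finally show "(1 * max (\<alpha> n) 0) powr k \<le> (2 * C * L * max s 0) powr k"
          using \<alpha>0[OF n1] k s by (intro powr_mono2) auto
      next
        show "fc (\<lambda>s. (2 * C * L * max s 0) powr k)" using C L by (intro powf k) simp
      qed (use v(2) in auto)
    qed auto
    then show ?thesis by blast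
  qed
  have sa: "star a = a" by (rule Pos_sa[OF aP])
  have sq: "cfc (\<lambda>s. (c * max s 0) powr 2) d = c\<^sup>2 *\<^sub>R (d * d)" if d: "d \<in> Pos" and c: "0 \<le> c" for c and d :: 'a
  proof -
    have "cfc (\<lambda>s. (c * max s 0) powr 2) d = cfc (\<lambda>s. c\<^sup>2 * (s * s)) d"
      by (rule Pos_cfc_cong[OF d powf fc_const_mult[OF fc_mult]])
        (use c in \<open>auto simp: powr_numeral power_mult_distrib power2_eq_square\<close>)
    then show ?thesis by (simp add: cfc_scale cfc_mult fc_mult cfc_id Pos_sa[OF d])
  qed
  show ?thesis
  proof (intro conjI allI impI)
    obtain x where x: "star x * x = cfc (\<lambda>s. (1 * max s 0) powr 2) a"
        "x * star x \<preceq> cfc (\<lambda>s. (2 * C * L * max s 0) powr 2) b"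
      using ex[of 2] by auto
    have "star x * x = a * a" using x(1) sq[OF aP, of 1] by simp
    have "b * b \<preceq> norm b *\<^sub>R b"
    proof -
      have "star (psqrt b) * b * psqrt b = b * b" "star (psqrt b) * psqrt b = b"
        using psqrt[OF b] by (metis mult.assoc)+
      then show ?thesis using conj_le_norm[OF b order_refl, of "psqrt b"] by simp
    qed
    then have "(2 * C * L)\<^sup>2 *\<^sub>R (b * b) \<preceq> (2 * C * L)\<^sup>2 *\<^sub>R (norm b *\<^sub>R b)"
      by (rule cstar_le_scale) simp
    moreover have "x * star x \<preceq> (2 * C * L)\<^sup>2 *\<^sub>R (b * b)" using x(2) sq[OF b, of "2 * C * L"] C L by simp
    ultimately have "x * star x \<preceq> (2 * C * L)\<^sup>2 *\<^sub>R (norm b *\<^sub>R b)" by (rule cstar_le_trans[rotated])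
    then have "x * star x \<preceq> (4 * C\<^sup>2 * L\<^sup>2 * norm b) *\<^sub>R b" by (simp add: power_mult_distrib)
    with \<open>star x * x = a * a\<close>
    show "\<exists>x. star x * x = a * a \<and> x * star x \<preceq> (4 * C\<^sup>2 * L\<^sup>2 * norm b) *\<^sub>R b" by blast
  next
    fix J :: "'a set" assume J: "semiprime_ideal J \<and> b \<in> J \<inter> Pos"
    have id: "cstar_ideal J" using J by (simp add: semiprime_ideal_def)
    let ?k = "sqrt 2 :: real"
    have k: "1 < ?k" "?k \<le> 2" "0 < ?k" by (auto simp: real_le_lsqrt)
    have kk: "?k < 2" by (simp add: real_less_lsqrt)
    define f where "f s = (1 * max s 0) powr ?k" for s :: real
    have f: "fc f" unfolding f_def by (rule powf[OF k(3)]) simp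
    obtain x where x: "star x * x = cfc f a" "x * star x \<preceq> cfc (\<lambda>s. (2 * C * L * max s 0) powr ?k) b"
      using ex[OF k(3)] unfolding f_def by blast
    have fa: "cfc f a \<in> J"
      unfolding x(1)[symmetric]
    proof (rule star_mult_self_in_ideal[OF id b fc_simps(3) _ _ k(1,2), where K="(2 * C * L) powr ?k"])
      have "cfc (\<lambda>s. max s 0) b = b"
        using Pos_cfc_cong[OF b, of "\<lambda>s. max s 0" "\<lambda>s. s"] by (simp add: cfc_id sb)
      then show "cfc (\<lambda>s. max s 0) b \<in> J" using J by simp
      have "(\<lambda>s. (2 * C * L * max s 0) powr ?k) = (\<lambda>s. (2 * C * L) powr ?k * (1 * max s 0) powr ?k)"
        using C L by (simp add: powr_mult fun_eq_iff)
      then have "cfc (\<lambda>s. (2 * C * L * max s 0) powr ?k) b = (2 * C * L) powr ?k *\<^sub>R cfc (\<lambda>s. (1 * max s 0) powr ?k) b"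
        using cfc_scale[OF powf[OF k(3), of 1] sb] by simp
      then show "x * star x \<preceq> (2 * C * L) powr ?k *\<^sub>R cfc (\<lambda>s. max s 0 powr ?k) b" using x(2) by simp
    qed auto
    have faa: "cfc (\<lambda>s. f s powr ?k) a = a * a"
    proof -
      have "(\<lambda>s. f s powr ?k) = (\<lambda>s. (1 * max s 0) powr 2)"
        by (simp add: f_def powr_powr)
      then show ?thesis using sq[OF aP, of 1] by simp
    qed
    show "a \<in> J"
    proof (rule semiprime_ideal_mem)
      show "semiprime_ideal J" using J by simp
      \<comment> \<open>a^2 = a^k a^(2 - k) with 2 - k > 0, so that the second factor lies in
        A.\<close>
      have "cfc f a * cfc (\<lambda>s. (1 * max s 0) powr (2 - ?k)) a = cfc (\<lambda>s. (1 * max s 0) powr 2) a"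
        unfolding f_def using powf[of ?k 1] powf[of "2 - ?k" 1] k kk sa
        by (subst cfc_mult[symmetric]) (auto simp flip: powr_add)
      then have "a * a = cfc f a * cfc (\<lambda>s. (1 * max s 0) powr (2 - ?k)) a" using sq[OF aP, of 1] by simp
      then show "a * a \<in> J" using fa id by (simp add: cstar_ideal_def)
      show "a * y * a \<in> J" for y
      proof (rule ideal_conj_all[OF id])
        fix y :: 'a assume y: "y \<in> Pos"
        have ayaP: "a * y * a \<in> Pos" using Pos_conj[OF y, of a] by (simp add: sa)
        \<comment> \<open>X X^* = a y a \<le> norm y a^2, and a^2 = f(a)^k since k^2 = 2; this is
          the form that the factorization needs, with f(a) in J.\<close>
        define X where "X = psqrt (a * y * a)"
        have X: "star X = X" "X * X = a * y * a" using psqrt[OF ayaP] by (auto simp: X_def)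
        have "star X * X \<in> J"
        proof (rule star_mult_self_in_ideal[OF id aP f _ fa k(1,2), where K="norm y"])
          show "0 \<le> f s" for s by (simp add: f_def)
          show "X * star X \<preceq> norm y *\<^sub>R cfc (\<lambda>s. f s powr ?k) a"
            using conj_le_norm[OF y order_refl, of a] by (simp add: X faa sa)
        qed simp
        then show "a * y * a \<in> J" by (simp add: X)
      qed
    qed
  qed
qed

end
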